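(* Let $n\ge 2$, $k\ge 1$, $N=\binom{n+k-1}{k}$, let $\lambda=(\lambda_\alpha)_{|\alpha|=k}\in\mathbb{R}^N$, let $U$ be a Haar-distributed random $N\times N$ unitary matrix and $H=U\,\mathrm{diag}(\lambda)\,U^\dagger$. For a nonnegative integer $p$ and $\bm{i}=(i_1,\dots,i_p),\bm{j}=(j_1,\dots,j_p)\in\{1,\dots,n\}^{\times p}$, $$\mathbb{E}\left[\prod_{s=1}^p\pi(H)_{i_s,j_s}\right]=\sum_{\sigma,\tau\in\mathfrak{S}_p}\mathrm{Wg}_N(\sigma^{-1}\tau)\,\mathrm{Tr}_\tau(\lambda)\,\Delta^{n,k}_\sigma(\bm{i},\bm{j}),$$ where $$\Delta^{n,k}_\sigma(\bm{i},\bm{j})=\frac{1}{k^p}\sum_{\gamma^{(1)},\dots,\gamma^{(p)}}\prod_{s=1}^p\sqrt{(\gamma^{(s)}_{i_s}+1)(\gamma^{(s)}_{j_s}+1)}\ \delta_\sigma\big((e_{i_1}+\gamma^{(1)},\dots,e_{i_p}+\gamma^{(p)}),(e_{j_1}+\gamma^{(1)},\dots,e_{j_p}+\gamma^{(p)})\big),$$ each $\gamma^{(s)}$ running over $n$-component multi-indices with $|\gamma^{(s)}|=k-1$.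
   Context: Multi-indices $\alpha=(\alpha_1,\dots,\alpha_n)$ have nonnegative integer entries, $|\alpha|=\sum_i\alpha_i$, $\alpha!=\prod_i\alpha_i!$; they are added componentwise, and $e_i$ is the multi-index with $1$ in position $i$ and $0$ elsewhere. $N\times N$ matrices are indexed by multi-indices $\alpha$ with $|\alpha|=k$ (basis $v_\alpha=\prod_ix_i^{\alpha_i}/\sqrt{\alpha!}$ of $\mathrm{Sym}^k\mathbb{C}^n$). For $\bm{i}\in\{1,\dots,n\}^{\times k}$, $\mathrm{tab}(\bm{i})$ is the multi-index whose $j$th entry is the number of occurrences of $j$ in $\bm{i}$; $S$ is the $n^k\times N$ matrix with $S_{\bm{i},\alpha}=\sqrt{\alpha!/k!}\,\delta(\mathrm{tab}(\bm{i}),\alpha)$. For an $n^k\times n^k$ matrix $M$, $\pi_1(M)_{i,j}=\sum_{l_1,\dots,l_{k-1}=1}^nM_{(i,l_1,\dots,l_{k-1}),(j,l_1,\dots,l_{k-1})}$, and $\pi(H)=\pi_1(SHS^T)$. For $\sigma\in\mathfrak{S}_p$ and sequences $\bm{a},\bm{b}$ of length $p$ (here of multi-indices), $\delta_\sigma(\bm{a},\bm{b})=\prod_{r=1}^p\delta(a_{\sigma(r)},b_r)$, with $\delta$ equal to $1$ if its arguments are equal and $0$ otherwise. For $\tau$ of cycle type $(\mu_1,\mu_2,\dots)$, $\mathrm{Tr}_\tau(\lambda)=\prod_j\mathrm{Tr}(\mathrm{diag}(\lambda)^{\mu_j})$. The unitary Weingarten function: $\mathrm{Wg}_N(\sigma)=\frac{1}{p!}\sum_{\rho\vdash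 p,\ C_\rho(N)\ne0}\frac{\chi^\rho(\mathrm{id}_p)\chi^\rho(\sigma)}{C_\rho(N)}$, with $\chi^\rho$ the irreducible character of $\mathfrak{S}_p$ for the partition $\rho$ and $C_\rho(N)=\prod_{i=1}^{\ell(\rho)}\prod_{j=1}^{\rho_i}(N+j-i)$. *)

theory Defs
  imports "HOL-Probability.Probability" "HOL-Combinatorics.Permutations" "HOL-Library.FuncSet"
begin

definition mi :: "nat \<Rightarrow> nat \<Rightarrow> (nat \<Rightarrow> nat) set" where
  "mi n k = {a. (\<forall>t. n \<le> t \<longrightarrow> a t = 0) \<and> (\<Sum>t<n. a t) = k}"

definition mfact :: "nat \<Rightarrow> (nat \<Rightarrow> nat) \<Rightarrow> nat" where
  "mfact n a = (\<Prod>t<n. fact (a t))"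

definition unitvec :: "nat \<Rightarrow> nat \<Rightarrow> nat" where
  "unitvec i = (\<lambda>t. if t = i then 1 else 0)"

definition tab :: "nat \<Rightarrow> nat list \<Rightarrow> nat \<Rightarrow> nat" where
  "tab n xs = (\<lambda>t. if t < n then count_list xs t else 0)"

type_synonym mmat = "(nat \<Rightarrow> nat) \<Rightarrow> (nat \<Rightarrow> nat) \<Rightarrow> complex"

definition matspace :: "(nat \<Rightarrow> nat) set \<Rightarrow> mmat measure" where
  "matspace A = PiM A (\<lambda>_. PiM A (\<lambda>_. (borel :: complex measure)))"

definition mmul :: "(nat \<Rightarrow> nat) set \<Rightarrow> mmat \<Rightarrow> mmat \<Rightarrow> mmat" where
  "mmul A V U = (\<lambda>a\<in>A. \<lambda>b\<in>A. \<Sum>c\<in>A. V a c * U c b)"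

definition unitary_on :: "(nat \<Rightarrow> nat) set \<Rightarrow> mmat \<Rightarrow> bool" where
  "unitary_on A U \<longleftrightarrow>
     (\<forall>a\<in>A. \<forall>b\<in>A. (\<Sum>c\<in>A. U a c * cnj (U b c)) = (if a = b then 1 else 0))"

text \<open>Haar (uniform) probability measure on the unitary group U(A): a probability measure on
  A x A complex matrices, concentrated on unitary matrices and invariant under left
  multiplication by any unitary matrix (this determines it uniquely).\<close>
definition haar_unitary :: "(nat \<Rightarrow> nat) set \<Rightarrow> mmat measure \<Rightarrow> bool" where
  "haar_unitary A M \<longleftrightarrow>
     sets M = sets (matspace A) \<and> prob_space M \<and> (AE U in M. unitary_on A U) \<and>
     (\<forall>V\<in>space (matspace A). unitary_on A V \<longrightarrow> distr M (matspace A) (mmul A V) = M)"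

definition Hmat :: "(nat \<Rightarrow> nat) set \<Rightarrow> ((nat \<Rightarrow> nat) \<Rightarrow> real) \<Rightarrow> mmat \<Rightarrow> mmat" where
  "Hmat A lam U = (\<lambda>a b. \<Sum>c\<in>A. U a c * complex_of_real (lam c) * cnj (U b c))"

text \<open>The matrix S (rows indexed by sequences in {0..n-1}^k, given as lists)\<close>
definition Smat :: "nat \<Rightarrow> nat \<Rightarrow> nat list \<Rightarrow> (nat \<Rightarrow> nat) \<Rightarrow> real" where
  "Smat n k xs a = (if tab n xs = a then sqrt (real (mfact n a) / real (fact k)) else 0)"

text \<open>pi(H) = pi_1(S H S^T)\<close>
definition piH :: "nat \<Rightarrow> nat \<Rightarrow> mmat \<Rightarrow> nat \<Rightarrow> nat \<Rightarrow> complex" where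
  "piH n k H i j =
     (\<Sum>l\<in>{l. set l \<subseteq> {..<n} \<and> length l = k - 1}.
        \<Sum>a\<in>mi n k. \<Sum>b\<in>mi n k.
          complex_of_real (Smat n k (i # l) a) * H a b * complex_of_real (Smat n k (j # l) b))"

definition partitions_of :: "nat \<Rightarrow> nat list set" where
  "partitions_of p = {r. sorted_wrt (\<ge>) r \<and> 0 \<notin> set r \<and> sum_list r = p}"

text \<open>Irreducible character chi^rho of S_p (on {0..p-1}), defined by the determinantal
  (Jacobi--Trudi / Frobenius) formula chi^rho = sum_w sgn(w) xi^(rho_i - i + w(i)), where
  xi^alpha(sigma) is the permutation character of the Young subgroup S_alpha, i.e. the number
  of alpha-tabloids (maps g : {0..p-1} -> {0..l-1} with fibre sizes alpha) fixed by sigma.\<close>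
definition irr_char :: "nat \<Rightarrow> nat list \<Rightarrow> (nat \<Rightarrow> nat) \<Rightarrow> int" where
  "irr_char p r \<sigma> =
     (\<Sum>w\<in>{w. w permutes {..<length r}}. sign w *
        int (card {g\<in>{..<p} \<rightarrow>\<^sub>E {..<length r}. (\<forall>x<p. g (\<sigma> x) = g x) \<and>
              (\<forall>i<length r. int (card {x. x < p \<and> g x = i}) = int (r ! i) - int i + int (w i))}))"

definition Cpoly :: "nat list \<Rightarrow> nat \<Rightarrow> int" where
  "Cpoly r N = (\<Prod>i<length r. \<Prod>j<r ! i. int N + int j - int i)"

definition Wg :: "nat \<Rightarrow> nat \<Rightarrow> (nat \<Rightarrow> nat) \<Rightarrow> real" where
  "Wg N p \<sigma> = 1 / fact p *
     (\<Sum>r\<in>{r\<in>partitions_of p. Cpoly r N \<noteq> 0}.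
        real_of_int (irr_char p r id) * real_of_int (irr_char p r \<sigma>) / real_of_int (Cpoly r N))"

definition cycles_of :: "nat \<Rightarrow> (nat \<Rightarrow> nat) \<Rightarrow> nat set set" where
  "cycles_of p \<tau> = {{(\<tau> ^^ m) x | m. True} | x. x < p}"

definition Tr_perm :: "nat \<Rightarrow> (nat \<Rightarrow> nat) set \<Rightarrow> ((nat \<Rightarrow> nat) \<Rightarrow> real) \<Rightarrow> (nat \<Rightarrow> nat) \<Rightarrow> real" where
  "Tr_perm p A lam \<tau> = (\<Prod>c\<in>cycles_of p \<tau>. \<Sum>a\<in>A. lam a ^ card c)"

definition delta_perm :: "nat \<Rightarrow> (nat \<Rightarrow> nat) \<Rightarrow> (nat \<Rightarrow> 'a) \<Rightarrow> (nat \<Rightarrow> 'a) \<Rightarrow> real" where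
  "delta_perm p \<sigma> a b = (\<Prod>r<p. if a (\<sigma> r) = b r then 1 else 0)"

definition Delta :: "nat \<Rightarrow> nat \<Rightarrow> nat \<Rightarrow> (nat \<Rightarrow> nat) \<Rightarrow> (nat \<Rightarrow> nat) \<Rightarrow> (nat \<Rightarrow> nat) \<Rightarrow> real" where
  "Delta n k p \<sigma> ii jj =
     1 / real k ^ p *
     (\<Sum>\<gamma>\<in>{..<p} \<rightarrow>\<^sub>E mi n (k - 1).
        (\<Prod>s<p. sqrt (real ((\<gamma> s (ii s) + 1) * (\<gamma> s (jj s) + 1)))) *
        delta_perm p \<sigma> (\<lambda>s t. unitvec (ii s) t + \<gamma> s t) (\<lambda>s t. unitvec (jj s) t + \<gamma> s t))"

end

theory Submission
  imports Defs "HOL-Combinatorics.Multiset_Permutations"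
begin

text \<open>The tensor \<open>T = E[H\<^sup>\<otimes>\<^sup>p]\<close> commutes with \<open>V\<^sup>\<otimes>\<^sup>p\<close> for all unitary \<open>V\<close>, hence with every permutation
  invariant matrix. The explicit map \<open>\<Pi>(X) = (\<Sum>\<sigma> \<tau>. Wg(\<sigma>\<inverse>\<tau>) Tr(P\<^sub>\<tau>\<inverse> X) P\<^sub>\<sigma>)\<close> has a permutation invariant
  kernel, so \<open>\<Pi>(T) = T \<Pi>(1)\<close>, and \<open>\<Pi>(1) = 1\<close> says that \<open>Wg\<close> inverts the Gram function
  \<open>\<sigma> \<mapsto> N\<^bsup>#cycles(\<sigma>)\<^esup>\<close> up to its kernel. No semisimplicity or Schur--Weyl duality is needed.

  For \<open>\<Pi>(1) = 1\<close> two facts about the determinantal characters suffice: convolution with the Gram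
  function multiplies \<open>\<chi>\<^sup>\<rho>\<close> by \<open>C\<^sub>\<rho>(N)\<close>, and \<open>(\<Sum>\<rho>. \<chi>\<^sup>\<rho>(id) \<chi>\<^sup>\<rho>) = p! \<delta>\<^bsub>id\<^esub>\<close>. Both follow by induction on \<open>p\<close>
  from the branching rule and from the eigenvalue of the sum of all transpositions on \<open>\<chi>\<^sup>\<rho>\<close>, because
  a class function on the symmetric group of degree \<open>p + 1\<close> is determined by its values, and those of
  its product with the Jucys--Murphy element, on the symmetric group of degree \<open>p\<close>.\<close>

section \<open>Determinantal characters and sums of transpositions\<close>

text \<open>If N < p the permutation operators are linearly dependent, the Gram function is
  singular, and \<open>Wg\<close> omits the \<rho> with zero content product. Subtracting its
  convolution with the Gram function from the delta function leaves a combination of the omitted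
  characters, hence an element of the Gram kernel. The Gram form of real coefficients is the squared
  Hilbert-Schmidt norm of the operator they define, so that operator is zero and small N needs no
  separate treatment. The passage from unitary matrices to all permutation invariant ones is
  polynomial, with no density argument: 1 + \<zeta>P with P a rank one projection is unitary for
  \<zeta> on a circle, so the coefficient of \<zeta> gives commutation with the derivation of P.
  Derivations generate all tensor powers W of degree p, and Ryser's formula for the permanent
  extracts symmetrized matrix units from these. The characters are only known as signed counts of
  colourings, so the transposition eigenvalue is also a count: a product of transposition and
  permutation becomes a chain of moves of single points between colours, and the signs cancel all
  weights except those that are again permutations.\<close>

abbreviation perms :: "nat \<Rightarrow> (nat \<Rightarrow> nat) set" where
  "perms p \<equiv> {\<pi>. \<pi> permutes {..<p}}"

abbreviation swp :: "'a \<Rightarrow> 'a \<Rightarrow> 'a \<Rightarrow> 'a" where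
  "swp \<equiv> Transposition.transpose"

lemma finite_perms [simp]: "finite (perms p)"
  by (simp add: finite_permutations)

definition alternating_sum :: "nat \<Rightarrow> ((nat \<Rightarrow> nat) \<Rightarrow> real) \<Rightarrow> real" where
  "alternating_sum l F = (\<Sum>w\<in>perms l. of_int (sign w) * F w)"

text \<open>The fibre sizes are integers, so a weight with a negative entry has no colouring; this
  is the convention that makes such terms of the determinant vanish.\<close>

definition colorings :: "nat \<Rightarrow> nat \<Rightarrow> (nat \<Rightarrow> int) \<Rightarrow> (nat \<Rightarrow> nat) set" where
  "colorings p l \<alpha> = {g \<in> {..<p} \<rightarrow>\<^sub>E {..<l}. \<forall>i<l. int (card {x. x < p \<and> g x = i}) = \<alpha> i}"

text \<open>The permutation character on tabloids of weight \<alpha>, induced from the trivial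
  character of a Young subgroup.\<close>

definition tabl :: "nat \<Rightarrow> nat \<Rightarrow> (nat \<Rightarrow> int) \<Rightarrow> (nat \<Rightarrow> nat) \<Rightarrow> real" where
  "tabl p l \<alpha> \<sigma> = real (card {g \<in> colorings p l \<alpha>. \<forall>x<p. g (\<sigma> x) = g x})"

text \<open>Allowing any integer sequence \<open>b\<close>, not only those coming from partitions, makes the branching
  rule hold without case distinctions: sequences that are not partitions contribute \<open>0\<close>.\<close>
definition chi :: "nat \<Rightarrow> nat \<Rightarrow> (nat \<Rightarrow> int) \<Rightarrow> (nat \<Rightarrow> nat) \<Rightarrow> real" where
  "chi p l b \<sigma> = alternating_sum l (\<lambda>w. tabl p l (\<lambda>i. b i + int (w i)) \<sigma>)"

text \<open>The share of ordered pairs (x, y) with colours (i, j) in the sum of \<open>tabl\<close>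
  over all \<open>\<sigma> \<circ> swp x y\<close>. The difficult case is i \<noteq> j, since
  exchanging two points of one colour does not change the colouring.\<close>

definition swap_count :: "nat \<Rightarrow> nat \<Rightarrow> nat \<Rightarrow> nat \<Rightarrow> (nat \<Rightarrow> int) \<Rightarrow> (nat \<Rightarrow> nat) \<Rightarrow> real" where
  "swap_count p l i j \<alpha> \<sigma> = real (card {(g, x, y). g \<in> colorings p l \<alpha> \<and> x < p \<and> y < p \<and>
     g x = i \<and> g y = j \<and> (\<forall>z<p. g (\<sigma> z) = g (swp x y z))})"

lemma finite_colorings [simp]: "finite (colorings p l \<alpha>)"
  unfolding colorings_def by (rule finite_subset[OF _ finite_PiE[of "{..<p}" "\<lambda>_. {..<l}"]]) auto

text \<open>Sign-reversing involution. Fixed points of \<open>h\<close> are harmless: there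
  \<open>f\<close> is its own negative.\<close>

lemma sum_antisym_zero:
  fixes f :: "'b \<Rightarrow> real"
  assumes "\<And>x. x \<in> S \<Longrightarrow> h x \<in> S" "\<And>x. x \<in> S \<Longrightarrow> h (h x) = x" "\<And>x. x \<in> S \<Longrightarrow> f (h x) = - f x"
  shows "sum f S = 0"
proof -
  have "sum f S = (\<Sum>x\<in>S. - f x)"
    by (rule sum.reindex_bij_witness[of _ h h]) (use assms in force)+
  then show ?thesis by (simp add: sum_negf)
qed

lemma swp_permutes: "i < p \<Longrightarrow> j < p \<Longrightarrow> swp i j permutes {..<p::nat}"
  by (simp add: permutes_swap_id)

lemma sign_comp_swp:
  "w permutes {..<l::nat} \<Longrightarrow> i \<noteq> j \<Longrightarrow> sign (w \<circ> swp i j) = - sign w"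
  by (subst sign_compose) (auto simp: sign_swap_id permutation_swap_id intro: permutes_imp_permutation)

lemma comp_swp_swp [simp]: "w \<circ> swp i j \<circ> swp i j = w"
  by (simp add: comp_assoc)

lemma card_perm_less:
  assumes "w permutes {..<l}" "i < l"
  shows "card {j\<in>{..<l} - {i}. w j < w i} = w i"
proof -
  have "bij_betw w {j\<in>{..<l} - {i}. w j < w i} {..<w i}"
  proof (rule bij_betwI')
    fix x y show "(w x = w y) = (x = y)" using assms(1) by (metis permutes_inj injD)
  next
    fix y assume "y \<in> {..<w i}"
    moreover have "w i < l" using assms(2) permutes_in_image[OF assms(1), of i] by auto
    ultimately show "\<exists>x\<in>{j\<in>{..<l} - {i}. w j < w i}. y = w x"
      using assms(1) permutes_inverses(1)[OF assms(1)] permutes_in_image[OF permutes_inv[OF assms(1)]]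
      by (intro bexI[of _ "inv w y"]) auto
  qed auto
  then show ?thesis using bij_betw_same_card by fastforce
qed

text \<open>The top term c = w j is w with the values at i and j exchanged. Summed over j, a given
  permutation w arises in this way once for each j with w j < w i, that is w i times, and with the
  opposite sign. A term with c strictly below w j has the value w i + w j - c both at j and at the
  index k where w itself takes that value, so exchanging j and k in w reproduces the argument of
  \<open>Y\<close> with the opposite sign.\<close>

lemma moves:
  fixes Y :: "(nat \<Rightarrow> nat) \<Rightarrow> real"
  assumes i: "i < l"
  shows "(\<Sum>j\<in>{..<l} - {i}. \<Sum>w\<in>{w\<in>perms l. w i < w j}. of_int (sign w) *
            (\<Sum>c\<in>{w i<..w j}. Y (w(i := c, j := w i + w j - c))))
       = - alternating_sum l (\<lambda>w. real (w i) * Y w)"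
proof -
  have split: "(\<Sum>c\<in>{w i<..w j}. Y (w(i := c, j := w i + w j - c))) =
     Y (w \<circ> swp i j) + (\<Sum>c\<in>{w i<..<w j}. Y (w(i := c, j := w i + w j - c)))"
    if "w i < w j" for w :: "nat \<Rightarrow> nat" and j
  proof -
    have e: "{w i<..w j} = insert (w j) {w i<..<w j}" using that by auto
    have "w(i := w j, j := w i) = w \<circ> swp i j" using that by (auto simp: fun_eq_iff Transposition.transpose_def)
    then show ?thesis unfolding e by simp
  qed
  have ne: "j \<noteq> i" if "w i < w j" for w :: "nat \<Rightarrow> nat" and j using that by auto
  have "(\<Sum>j\<in>{..<l} - {i}. \<Sum>w\<in>{w\<in>perms l. w i < w j}. of_int (sign w) * Y (w \<circ> swp i j))
      = (\<Sum>j\<in>{..<l} - {i}. \<Sum>w\<in>{w\<in>perms l. w j < w i}. - of_int (sign w) * Y w)"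
  proof (rule sum.cong[OF refl])
    fix j assume j: "j \<in> {..<l} - {i}"
    show "(\<Sum>w\<in>{w\<in>perms l. w i < w j}. of_int (sign w) * Y (w \<circ> swp i j))
      = (\<Sum>w\<in>{w\<in>perms l. w j < w i}. - of_int (sign w) * Y w)"
      by (rule sum.reindex_bij_witness[of _ "\<lambda>w. w \<circ> swp i j" "\<lambda>w. w \<circ> swp i j"])
         (use i j in \<open>auto simp: sign_comp_swp intro: permutes_compose swp_permutes\<close>)
  qed
  also have "\<dots> = (\<Sum>j\<in>{..<l} - {i}. \<Sum>w\<in>perms l. if w j < w i then - of_int (sign w) * Y w else 0)"
    by (intro sum.cong refl sum.inter_filter) simp
  also have "\<dots> = (\<Sum>w\<in>perms l. \<Sum>j\<in>{..<l} - {i}. if w j < w i then - of_int (sign w) * Y w else 0)"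
    by (rule sum.swap)
  also have "\<dots> = (\<Sum>w\<in>perms l. - (of_int (sign w) * (real (w i) * Y w)))"
  proof (rule sum.cong[OF refl])
    fix w assume w: "w \<in> perms l"
    have "(\<Sum>j\<in>{..<l} - {i}. if w j < w i then - of_int (sign w) * Y w else 0)
       = (\<Sum>j\<in>{j\<in>{..<l} - {i}. w j < w i}. - of_int (sign w) * Y w)"
      by (rule sum.inter_filter[symmetric]) simp
    then show "(\<Sum>j\<in>{..<l} - {i}. if w j < w i then - of_int (sign w) * Y w else 0)
       = - (of_int (sign w) * (real (w i) * Y w))"
      using card_perm_less[of w l i] w i by simp
  qed
  finally have 1: "(\<Sum>j\<in>{..<l} - {i}. \<Sum>w\<in>{w\<in>perms l. w i < w j}. of_int (sign w) * Y (w \<circ> swp i j))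
     = - alternating_sum l (\<lambda>w. real (w i) * Y w)" by (simp add: alternating_sum_def sum_negf)
  let ?S = "SIGMA j:{..<l} - {i}. SIGMA w:{w\<in>perms l. w i < w j}. {w i<..<w j}"
  let ?f = "\<lambda>(j, w, c). of_int (sign w) * Y (w(i := c, j := w i + w j - c))"
  let ?k = "\<lambda>j w c. inv w (w i + w j - c)"
  let ?h = "\<lambda>(j, w, c). (?k j w c, w \<circ> swp j (?k j w c), c)"
  have fin: "finite {w\<in>perms l. w i < w j}" for j by simp
  have "(\<Sum>j\<in>{..<l} - {i}. \<Sum>w\<in>{w\<in>perms l. w i < w j}. of_int (sign w) *
          (\<Sum>c\<in>{w i<..<w j}. Y (w(i := c, j := w i + w j - c)))) = sum ?f ?S"
    by (simp add: sum.Sigma sum_distrib_left fin)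
  also have "\<dots> = 0"
  proof (rule sum_antisym_zero[of _ ?h])
    fix x assume "x \<in> ?S"
    obtain j w c where x: "x = (j, w, c)" by (cases x) auto
    have jl: "j < l" and w: "w permutes {..<l}" and c: "w i < c" "c < w j"
      using \<open>x \<in> ?S\<close> unfolding x by auto
    have j: "j < l" "j \<noteq> i" using jl c by auto
    define k where "k = ?k j w c"
    have wk: "w k = w i + w j - c" unfolding k_def using permutes_inverses(1)[OF w] by simp
    have wj: "w j < l" using permutes_in_image[OF w] j by auto
    have kl: "k < l" using wk wj c permutes_in_image[OF w, of k] by auto
    have ki: "k \<noteq> i" and kj: "k \<noteq> j" using wk c by auto
    have w': "w \<circ> swp j k permutes {..<l}" using w j kl by (auto intro: permutes_compose swp_permutes)
    have hx: "?h x = (k, w \<circ> swp j k, c)" using x k_def by simp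
    have k2: "?k k (w \<circ> swp j k) c = j"
      using wk c ki kj j permutes_inv_eq[OF w', of "w i + w j - c" j] by simp
    show "?h x \<in> ?S" unfolding hx using kl ki w' c wk kj j by auto
    show "?h (?h x) = x" unfolding hx using k2 x by (simp add: transpose_commute[of k j])
    have eq: "(w \<circ> swp j k)(i := c, k := w i + w j - c) = w(i := c, j := w i + w j - c)"
      using wk ki kj j c by (auto simp: fun_eq_iff Transposition.transpose_def)
    have "sign (w \<circ> swp j k) = - sign w" using sign_comp_swp[OF w] kj by metis
    then show "?f (?h x) = - ?f x" unfolding hx using x eq ki kj j by simp
  qed
  finally have 2: "(\<Sum>j\<in>{..<l} - {i}. \<Sum>w\<in>{w\<in>perms l. w i < w j}. of_int (sign w) *
          (\<Sum>c\<in>{w i<..<w j}. Y (w(i := c, j := w i + w j - c)))) = 0" .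
  have "(\<Sum>j\<in>{..<l} - {i}. \<Sum>w\<in>{w\<in>perms l. w i < w j}. of_int (sign w) *
            (\<Sum>c\<in>{w i<..w j}. Y (w(i := c, j := w i + w j - c)))) =
        (\<Sum>j\<in>{..<l} - {i}. \<Sum>w\<in>{w\<in>perms l. w i < w j}. of_int (sign w) * Y (w \<circ> swp i j) + of_int (sign w) *
            (\<Sum>c\<in>{w i<..<w j}. Y (w(i := c, j := w i + w j - c))))"
    by (intro sum.cong refl) (simp add: split distrib_left)
  then show ?thesis using 1 2 by (simp add: sum.distrib)
qed

section \<open>Moving points between colour classes\<close>

lemma colorings_upd:
  assumes g: "g \<in> colorings p l \<alpha>" and x: "x < p" and gx: "g x = j" and i: "i < l" "i \<noteq> j"
  shows "g(x := i) \<in> colorings p l (\<alpha>(i := \<alpha> i + 1, j := \<alpha> j - 1))"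
proof -
  have j: "j < l" using g x gx by (auto simp: colorings_def)
  have fin: "finite {z. z < p \<and> g z = m}" for m by simp
  have c: "int (card {z. z < p \<and> g z = m}) = \<alpha> m" if "m < l" for m using g that by (simp add: colorings_def)
  have si: "{z. z < p \<and> (g(x := i)) z = i} = insert x {z. z < p \<and> g z = i}" using x by auto
  have sj: "{z. z < p \<and> (g(x := i)) z = j} = {z. z < p \<and> g z = j} - {x}" using i by auto
  have so: "{z. z < p \<and> (g(x := i)) z = m} = {z. z < p \<and> g z = m}" if "m \<noteq> i" "m \<noteq> j" for m
    using that gx by auto
  have "int (card {z. z < p \<and> (g(x := i)) z = i}) = \<alpha> i + 1"
    unfolding si using gx i c[of i] by (subst card_insert_disjoint) auto
  moreover have "int (card {z. z < p \<and> (g(x := i)) z = j}) = \<alpha> j - 1"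
  proof -
    have m: "x \<in> {z. z < p \<and> g z = j}" using gx x by auto
    then have "card {z. z < p \<and> g z = j} > 0" by (metis card_gt_0_iff empty_iff fin)
    then show ?thesis unfolding sj card_Diff_singleton[OF m] using c[OF j] by linarith
  qed
  moreover have "int (card {z. z < p \<and> (g(x := i)) z = m}) = \<alpha> m" if "m < l" "m \<noteq> i" "m \<noteq> j" for m
    using so[of m] c that by auto
  moreover have "g(x := i) \<in> {..<p} \<rightarrow>\<^sub>E {..<l}" using g x i by (auto simp: colorings_def PiE_iff extensional_def)
  ultimately show ?thesis using i by (auto simp: colorings_def)
qed

lemma finite_marked: "finite {(g, x, y). g \<in> colorings p l \<alpha> \<and> x < p \<and> y < p \<and> P g x y}"
  by (rule finite_subset[of _ "colorings p l \<alpha> \<times> {..<p} \<times> {..<p}"]) auto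

text \<open>In the action of gl on tensors this is the cyclicity of the trace of
  $E_{ji} E_{ij} \sigma$, restricted to a weight space.\<close>
lemma swap_count_rec:
  fixes \<alpha> :: "nat \<Rightarrow> int"
  assumes \<sigma>: "\<sigma> permutes {..<p}" and i: "i < l" and j: "j < l" and ij: "i \<noteq> j"
  defines "\<alpha>' \<equiv> \<alpha>(i := \<alpha> i + 1, j := \<alpha> j - 1)"
  shows "swap_count p l j i \<alpha> \<sigma> + of_int (\<alpha> j) * tabl p l \<alpha> \<sigma>
       = swap_count p l i j \<alpha>' \<sigma> + (of_int (\<alpha> i) + 1) * tabl p l \<alpha>' \<sigma>"
proof -
  \<comment> \<open>Two successive moves: \<open>x\<close> goes from colour j to i, then
    \<open>y\<close> from i to j, and the outcome has to be g \<circ> \<sigma>. If y = x the second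
    move undoes the first, which gives the diagonal term; otherwise the two moves exchange
    \<open>x\<close> and \<open>y\<close>.\<close>
  define R where "R = (\<lambda>\<beta> i j. {(g, x, y). g \<in> colorings p l \<beta> \<and> x < p \<and> y < p \<and>
      g x = j \<and> (g(x := i)) y = i \<and> (\<forall>z<p. g (\<sigma> z) = (g(x := i, y := j)) z)})"
  have R: "real (card (R \<beta> i j)) = swap_count p l j i \<beta> \<sigma> + of_int (\<beta> j) * tabl p l \<beta> \<sigma>"
    if ij: "i \<noteq> j" "i < l" "j < l" for \<beta> i j
  proof -
    define F where "F = {g \<in> colorings p l \<beta>. \<forall>x<p. g (\<sigma> x) = g x}"
    define S where "S = {(g, x, y). g \<in> colorings p l \<beta> \<and> x < p \<and> y < p \<and>
     g x = j \<and> g y = i \<and> (\<forall>z<p. g (\<sigma> z) = g (swp x y z))}"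
    define D where "D = (\<lambda>(g, x). (g, x, x)) ` (SIGMA g:F. {x. x < p \<and> g x = j})"
    have sw: "g(x := i, y := j) = g \<circ> swp x y" if "g x = j" "g y = i" for g :: "nat \<Rightarrow> nat" and x y
      using that by (auto simp: fun_eq_iff Transposition.transpose_def)
    have RS: "R \<beta> i j = S \<union> D"
    proof
      show "R \<beta> i j \<subseteq> S \<union> D"
      proof
        fix t assume "t \<in> R \<beta> i j"
        then obtain g x y where t: "t = (g, x, y)" "g \<in> colorings p l \<beta>" "x < p" "y < p"
          "g x = j" "(g(x := i)) y = i" "\<forall>z<p. g (\<sigma> z) = (g(x := i, y := j)) z" unfolding R_def by auto
        show "t \<in> S \<union> D"
        proof (cases "y = x")
          case True
          then have "g(x := i, y := j) = g" using t by auto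
          then have "g \<in> F" using t by (auto simp: F_def)
          then show ?thesis using t True unfolding D_def by force
        next
          case False
          then have "g y = i" using t by auto
          then show ?thesis using t sw[of g x y] by (auto simp: S_def)
        qed
      qed
      show "S \<union> D \<subseteq> R \<beta> i j"
      proof
        fix t assume "t \<in> S \<union> D"
        then show "t \<in> R \<beta> i j"
        proof
          assume "t \<in> S"
          then show ?thesis unfolding S_def R_def using sw by auto
        next
          assume "t \<in> D"
          then obtain g x where t: "t = (g, x, x)" "g \<in> F" "x < p" "g x = j" unfolding D_def by auto
          then have "g(x := i, x := j) = g" by auto
          then show ?thesis using t by (auto simp: R_def F_def)
        qed
      qed
    qed
    have "S \<inter> D = {}" using ij unfolding S_def D_def by auto
    moreover have "finite S" unfolding S_def by (rule finite_marked)
    moreover have finF: "finite F" unfolding F_def by simp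
    moreover have "finite D" unfolding D_def using finF by auto
    moreover have "real (card D) = of_int (\<beta> j) * tabl p l \<beta> \<sigma>"
    proof -
      have "card D = (\<Sum>g\<in>F. card {x. x < p \<and> g x = j})" unfolding D_def
        by (subst card_image) (auto simp: inj_on_def finF)
      moreover have "real (card {x. x < p \<and> g x = j}) = of_int (\<beta> j)" if "g \<in> F" for g
      proof -
        have "int (card {x. x < p \<and> g x = j}) = \<beta> j" using that ij by (simp add: F_def colorings_def)
        then show ?thesis by (metis of_int_of_nat_eq)
      qed
      ultimately show ?thesis by (simp add: tabl_def flip: F_def)
    qed
    ultimately show ?thesis unfolding RS by (subst card_Un_disjoint) (auto simp: swap_count_def S_def)
  qed
  have \<sigma>p: "\<sigma> x < p \<longleftrightarrow> x < p" "inv \<sigma> x < p \<longleftrightarrow> x < p" for x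
    using permutes_in_image[OF \<sigma>, of x] permutes_in_image[OF permutes_inv[OF \<sigma>], of x] by auto
  note inv = permutes_inverses[OF \<sigma>]
  have \<sigma>e: "\<sigma> z = x \<longleftrightarrow> z = inv \<sigma> x" for z x using inv by metis
  \<comment> \<open>The closed chain of moves is read from its second move on: the former first
    move, transported through \<sigma>, becomes the last one and takes place at
    \<open>inv \<sigma> x\<close>.\<close>
  have "bij_betw (\<lambda>(g, x, y). (g(x := i), y, inv \<sigma> x)) (R \<alpha> i j) (R \<alpha>' j i)"
  proof (rule bij_betw_byWitness[where f' = "\<lambda>(h, y, x'). (h(\<sigma> x' := j), \<sigma> x', y)"])
    show "\<forall>a\<in>R \<alpha> i j. (case case a of (g, x, y) \<Rightarrow> (g(x := i), y, inv \<sigma> x) of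
            (h, y, x') \<Rightarrow> (h(\<sigma> x' := j), \<sigma> x', y)) = a"
      using inv by (auto simp: R_def)
    show "\<forall>a\<in>R \<alpha>' j i. (case case a of (h, y, x') \<Rightarrow> (h(\<sigma> x' := j), \<sigma> x', y) of
            (g, x, y) \<Rightarrow> (g(x := i), y, inv \<sigma> x)) = a"
      using inv ij by (auto simp: R_def fun_eq_iff split: if_splits)
    show "(\<lambda>(g, x, y). (g(x := i), y, inv \<sigma> x)) ` R \<alpha> i j \<subseteq> R \<alpha>' j i"
    proof clarify
      fix g x y assume "(g, x, y) \<in> R \<alpha> i j"
      then have t: "g \<in> colorings p l \<alpha>" "x < p" "y < p"
          "g x = j" "(g(x := i)) y = i" and u: "\<And>z. z < p \<Longrightarrow> g (\<sigma> z) = (g(x := i, y := j)) z"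
        unfolding R_def by auto
      have "g(x := i) \<in> colorings p l \<alpha>'" unfolding \<alpha>'_def using colorings_upd t i ij by blast
      moreover have "((g(x := i))(y := j)) (inv \<sigma> x) = j" using u[of "inv \<sigma> x"] t inv \<sigma>p by simp
      moreover have "(g(x := i)) (\<sigma> z) = ((g(x := i))(y := j, inv \<sigma> x := i)) z" if "z < p" for z
        using u[OF that] inv \<sigma>e by simp
      ultimately show "(g(x := i), y, inv \<sigma> x) \<in> R \<alpha>' j i" unfolding R_def using t \<sigma>p by auto
    qed
    show "(\<lambda>(h, y, x'). (h(\<sigma> x' := j), \<sigma> x', y)) ` R \<alpha>' j i \<subseteq> R \<alpha> i j"
    proof clarify
      fix h y x assume "(h, y, x) \<in> R \<alpha>' j i"
      then have t: "h \<in> colorings p l \<alpha>'" "x < p" "y < p"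
          "h y = i" "(h(y := j)) x = j" and u: "\<And>z. z < p \<Longrightarrow> h (\<sigma> z) = (h(y := j, x := i)) z"
        unfolding R_def by auto
      have hx: "h (\<sigma> x) = i" using u[of x] t by simp
      have "\<alpha>'(j := \<alpha>' j + 1, i := \<alpha>' i - 1) = \<alpha>" unfolding \<alpha>'_def using ij by auto
      then have "h(\<sigma> x := j) \<in> colorings p l \<alpha>"
        using colorings_upd[OF t(1) _ hx j] t ij \<sigma>p by auto
      moreover have "((h(\<sigma> x := j))(\<sigma> x := i)) y = i" using t by auto
      moreover have e: "h(\<sigma> x := i) = h" using hx by auto
      moreover have "(h(\<sigma> x := j)) (\<sigma> z) = ((h(\<sigma> x := j))(\<sigma> x := i, y := j)) z" if "z < p" for z
        using u[OF that] t(5) inv \<sigma>e e by auto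
      ultimately show "(h(\<sigma> x := j), \<sigma> x, y) \<in> R \<alpha> i j" unfolding R_def using t \<sigma>p by auto
    qed
  qed
  then have "card (R \<alpha> i j) = card (R \<alpha>' j i)" by (rule bij_betw_same_card)
  moreover have "\<alpha>' i = \<alpha> i + 1" using ij by (simp add: \<alpha>'_def)
  ultimately show ?thesis using R[of i j \<alpha>] R[of j i \<alpha>'] i j ij by simp
qed

lemma swap_count_sym: "swap_count p l i j \<alpha> \<sigma> = swap_count p l j i \<alpha> \<sigma>"
  unfolding swap_count_def
  by (rule arg_cong[where f = real], rule bij_betw_same_card[where f = "\<lambda>(g, x, y). (g, y, x)"],
      rule bij_betw_byWitness[where f' = "\<lambda>(g, x, y). (g, y, x)"])
     (auto simp: transpose_commute)

lemma swap_count_eq_sum: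
  "swap_count p l i j \<alpha> \<sigma> = (\<Sum>g\<in>colorings p l \<alpha>. \<Sum>x<p. \<Sum>y<p.
     if g x = i \<and> g y = j \<and> (\<forall>z<p. g (\<sigma> z) = g (swp x y z)) then 1 else 0)"
proof -
  let ?P = "\<lambda>g x y. g x = i \<and> g y = j \<and> (\<forall>z<p. g (\<sigma> z) = g (swp x y z))"
  have "swap_count p l i j \<alpha> \<sigma> = real (card {t \<in> colorings p l \<alpha> \<times> {..<p} \<times> {..<p}. case t of (g, x, y) \<Rightarrow> ?P g x y})"
    unfolding swap_count_def by (rule arg_cong[where f = "\<lambda>S. real (card S)"]) auto
  also have "\<dots> = (\<Sum>t\<in>colorings p l \<alpha> \<times> {..<p} \<times> {..<p}. if case t of (g, x, y) \<Rightarrow> ?P g x y then 1 else 0)"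
    by (simp only: real_of_card sum.inter_filter finite_cartesian_product finite_colorings finite_lessThan)
  also have "\<dots> = (\<Sum>t\<in>colorings p l \<alpha> \<times> {..<p} \<times> {..<p}. case t of (g, x, y) \<Rightarrow> if ?P g x y then 1 else 0)"
    by (rule sum.cong[OF refl]) (simp split: prod.split)
  finally show ?thesis by (simp add: sum.cartesian_product)
qed

lemma tabl_eq_sum:
  "tabl p l \<alpha> \<sigma> = (\<Sum>g\<in>colorings p l \<alpha>. if \<forall>x<p. g (\<sigma> x) = g x then 1 else 0)"
  unfolding tabl_def by (simp only: real_of_card sum.inter_filter finite_colorings)

lemma comp_swp_fix_iff:
  assumes "x < p" "y < p"
  shows "(\<forall>z<p. g ((\<sigma> \<circ> swp x y) z) = g z) \<longleftrightarrow> (\<forall>z<p. g (\<sigma> z) = g (swp x y z))"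
proof -
  have "swp x y z < p" if "z < p" for z using that assms by (auto simp: Transposition.transpose_def)
  then show ?thesis by (metis comp_apply transpose_involutory)
qed

text \<open>The ordered pairs (x, y), with x = y included, are sorted by the colours of the two
  points. Inside colour class i the exchange is invisible, so each fixed colouring is counted once
  for each of its pairs, a square number of times.\<close>

lemma sum_tabl_comp_swp:
  assumes \<sigma>: "\<sigma> permutes {..<p}"
  shows "(\<Sum>x<p. \<Sum>y<p. tabl p l \<alpha> (\<sigma> \<circ> swp x y))
    = (\<Sum>i<l. (of_int (\<alpha> i))\<^sup>2) * tabl p l \<alpha> \<sigma> + (\<Sum>i<l. \<Sum>j\<in>{..<l} - {i}. swap_count p l i j \<alpha> \<sigma>)"
proof -
  let ?P = "\<lambda>g x y. (\<forall>z<p. g (\<sigma> z) = g (swp x y z))"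
  have "(\<Sum>x<p. \<Sum>y<p. tabl p l \<alpha> (\<sigma> \<circ> swp x y))
     = (\<Sum>x<p. \<Sum>y<p. \<Sum>g\<in>colorings p l \<alpha>. if ?P g x y then 1 else 0)"
    by (intro sum.cong refl) (simp add: tabl_eq_sum comp_swp_fix_iff del: comp_apply)
  also have "\<dots> = (\<Sum>g\<in>colorings p l \<alpha>. \<Sum>x<p. \<Sum>y<p. if ?P g x y then 1 else 0)"
    by (simp only: sum.swap[of _ "colorings p l \<alpha>" "{..<p}"])
  also have "\<dots> = (\<Sum>g\<in>colorings p l \<alpha>. \<Sum>x<p. \<Sum>y<p. \<Sum>i<l. \<Sum>j<l.
       if g x = i \<and> g y = j \<and> ?P g x y then 1 else 0)"
  proof (intro sum.cong refl)
    fix g x y assume "g \<in> colorings p l \<alpha>" "x \<in> {..<p}" "y \<in> {..<p}"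
    then have "g x < l" "g y < l" by (auto simp: colorings_def)
    then have "(\<Sum>i<l. \<Sum>j<l. if g x = i \<and> g y = j \<and> ?P g x y then 1 else (0::real))
      = (\<Sum>i<l. if i = g x then (\<Sum>j<l. if j = g y then if ?P g x y then 1 else 0 else 0) else 0)"
      by (intro sum.cong refl) (auto intro!: sum.neutral sum.cong)
    also have "\<dots> = (if ?P g x y then 1 else 0)" using \<open>g x < l\<close> \<open>g y < l\<close> by (simp add: sum.delta')
    finally show "(if ?P g x y then 1 else 0) = (\<Sum>i<l. \<Sum>j<l. if g x = i \<and> g y = j \<and> ?P g x y then 1 else (0::real))" ..
  qed
  also have "\<dots> = (\<Sum>i<l. \<Sum>j<l. swap_count p l i j \<alpha> \<sigma>)"
  proof -
    have 1: "(\<Sum>y<p. \<Sum>i<l. \<Sum>j<l. f y i j) = (\<Sum>i<l. \<Sum>j<l. \<Sum>y<p. f y i j)" for f :: "nat \<Rightarrow> nat \<Rightarrow> nat \<Rightarrow> real"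
      by (subst sum.swap, rule sum.cong[OF refl], rule sum.swap)
    have 2: "(\<Sum>y\<in>colorings p l \<alpha>. \<Sum>i<l. \<Sum>j<l. f y i j) = (\<Sum>i<l. \<Sum>j<l. \<Sum>y\<in>colorings p l \<alpha>. f y i j)"
      for f :: "(nat \<Rightarrow> nat) \<Rightarrow> nat \<Rightarrow> nat \<Rightarrow> real"
      by (subst sum.swap, rule sum.cong[OF refl], rule sum.swap)
    show ?thesis unfolding 1 2 swap_count_eq_sum ..
  qed
  also have "\<dots> = (\<Sum>i<l. (of_int (\<alpha> i))\<^sup>2 * tabl p l \<alpha> \<sigma> + (\<Sum>j\<in>{..<l} - {i}. swap_count p l i j \<alpha> \<sigma>))"
  proof (rule sum.cong[OF refl])
    fix i assume i: "i \<in> {..<l}"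
    have "swap_count p l i i \<alpha> \<sigma> = (of_int (\<alpha> i))\<^sup>2 * tabl p l \<alpha> \<sigma>"
    proof -
      let ?S = "SIGMA g:{g \<in> colorings p l \<alpha>. \<forall>x<p. g (\<sigma> x) = g x}. {x. x < p \<and> g x = i} \<times> {x. x < p \<and> g x = i}"
      have sw: "g (swp x y z) = g z" if "g x = g y" for g :: "nat \<Rightarrow> nat" and x y z
        using that by (auto simp: Transposition.transpose_def)
      have S: "{(g, x, y). g \<in> colorings p l \<alpha> \<and> x < p \<and> y < p \<and> g x = i \<and> g y = i \<and> (\<forall>z<p. g (\<sigma> z) = g (swp x y z))} = ?S"
        by (auto simp: sw)
      have "real (card ?S) = (\<Sum>g\<in>{g \<in> colorings p l \<alpha>. \<forall>x<p. g (\<sigma> x) = g x}. (real (card {x. x < p \<and> g x = i}))\<^sup>2)"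
        by (subst card_SigmaI) (auto simp: power2_eq_square)
      also have "\<dots> = (\<Sum>g\<in>{g \<in> colorings p l \<alpha>. \<forall>x<p. g (\<sigma> x) = g x}. (of_int (\<alpha> i))\<^sup>2)"
      proof (intro sum.cong refl)
        fix g assume "g \<in> {g \<in> colorings p l \<alpha>. \<forall>x<p. g (\<sigma> x) = g x}"
        then have "int (card {x. x < p \<and> g x = i}) = \<alpha> i" using i by (auto simp: colorings_def)
        then show "(real (card {x. x < p \<and> g x = i}))\<^sup>2 = (of_int (\<alpha> i))\<^sup>2" by (metis of_int_of_nat_eq)
      qed
      finally show ?thesis unfolding swap_count_def S by (simp add: tabl_def)
    qed
    then show "(\<Sum>j<l. swap_count p l i j \<alpha> \<sigma>) = (of_int (\<alpha> i))\<^sup>2 * tabl p l \<alpha> \<sigma> + (\<Sum>j\<in>{..<l} - {i}. swap_count p l i j \<alpha> \<sigma>)"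
      using i by (subst sum.remove[of _ i]) auto
  qed
  finally show ?thesis by (simp add: sum.distrib sum_distrib_right)
qed

text \<open>The permutations w and \<open>w \<circ> swp i j\<close> are paired, and their weights
  are joined by a path that moves one unit at a time from the larger entry to the smaller.
  \<open>swap_count_rec\<close> gives the change of \<open>swap_count\<close> along each unit step,
  and the sum telescopes. \<open>P i j\<close> is an inner sum of the form treated by
  \<open>moves\<close>.\<close>

lemma alternating_sum_swap_count:
  fixes b :: "nat \<Rightarrow> int"
  assumes \<sigma>: "\<sigma> permutes {..<p}" and i: "i < l" and j: "j < l" and ij: "i \<noteq> j"
  defines "Y \<equiv> \<lambda>i v. (of_int (b i) + real (v i)) * tabl p l (\<lambda>m. b m + int (v m)) \<sigma>"
  defines "P \<equiv> \<lambda>i j. \<Sum>w\<in>{w\<in>perms l. w i < w j}. of_int (sign w) *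
            (\<Sum>c\<in>{w i<..w j}. Y i (w(i := c, j := w i + w j - c)))"
  shows "alternating_sum l (\<lambda>w. swap_count p l i j (\<lambda>m. b m + int (w m)) \<sigma>) = P i j + P j i"
proof -
  define A where "A = (\<lambda>v. swap_count p l i j (\<lambda>m. b m + int (v m)) \<sigma>)"
  have step: "A (v(i := c, j := Suc d)) + Y j (v(i := c, j := Suc d)) = A (v(i := Suc c, j := d)) + Y i (v(i := Suc c, j := d))" for v c d
  proof -
    let ?\<alpha> = "\<lambda>m. b m + int ((v(i := c, j := Suc d)) m)"
    have "(\<lambda>m. b m + int ((v(i := Suc c, j := d)) m)) = ?\<alpha>(i := ?\<alpha> i + 1, j := ?\<alpha> j - 1)"
      using ij by auto
    then show ?thesis
      using swap_count_rec[OF \<sigma> i j ij, of ?\<alpha>] swap_count_sym[of p l j i] ij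
      unfolding A_def Y_def by (simp add: algebra_simps)
  qed
  have tel: "A w - A (w \<circ> swp i j) = (\<Sum>c\<in>{w i<..w j}. Y i (w(i := c, j := w i + w j - c)))
       - (\<Sum>c\<in>{w i<..w j}. Y j (w(j := c, i := w i + w j - c)))" if "w i < w j" for w
  proof -
    define s t where "s = w i" and "t = w j"
    have st: "s < t" using that s_def t_def by simp
    define V where "V = (\<lambda>c. w(i := c, j := s + t - c))"
    have V0: "V s = w" unfolding V_def s_def t_def by (auto simp: fun_eq_iff)
    have V1: "V t = w \<circ> swp i j" unfolding V_def s_def t_def using ij by (auto simp: fun_eq_iff Transposition.transpose_def)
    have "A (V c) - A (V (Suc c)) = Y i (V (Suc c)) - Y j (V c)" if "c < t" for c
      using step[of w c "s + t - Suc c"] that unfolding V_def by (simp add: Suc_diff_Suc)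
    then have "(\<Sum>c\<in>{s..<t}. A (V c) - A (V (Suc c))) = (\<Sum>c\<in>{s..<t}. Y i (V (Suc c)) - Y j (V c))"
      by (intro sum.cong) auto
    moreover have "(\<Sum>c\<in>{s..<t}. A (V c) - A (V (Suc c))) = A (V s) - A (V t)"
      using sum_Suc_diff'[of s t "\<lambda>c. - A (V c)"] st by simp
    moreover have "(\<Sum>c\<in>{s..<t}. Y i (V (Suc c))) = (\<Sum>c\<in>{s<..t}. Y i (V c))"
      by (rule sum.reindex_bij_witness[of _ "\<lambda>c. c - 1" Suc]) auto
    moreover have "(\<Sum>c\<in>{s..<t}. Y j (V c)) = (\<Sum>c\<in>{s<..t}. Y j (w(j := c, i := s + t - c)))"
      by (rule sum.reindex_bij_witness[of _ "\<lambda>c. s + t - c" "\<lambda>c. s + t - c"])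
         (use ij st in \<open>auto simp: V_def fun_upd_twist\<close>)
    ultimately show ?thesis using V0 V1 unfolding V_def s_def t_def by (simp add: sum_subtractf)
  qed
  have ne: "w i \<noteq> w j" if "w permutes {..<l}" for w
    using that ij by (metis injD permutes_inj)
  have split: "perms l = {w\<in>perms l. w i < w j} \<union> {w\<in>perms l. w j < w i}" using ne[unfolded neq_iff] by blast
  have fin: "finite {w\<in>perms l. w i < w j}" for i j by simp
  have "alternating_sum l A = (\<Sum>w\<in>{w\<in>perms l. w i < w j}. of_int (sign w) * A w) + (\<Sum>w\<in>{w\<in>perms l. w j < w i}. of_int (sign w) * A w)"
    unfolding alternating_sum_def by (subst split, rule sum.union_disjoint) (use fin in auto)
  also have "(\<Sum>w\<in>{w\<in>perms l. w j < w i}. of_int (sign w) * A w) = (\<Sum>w\<in>{w\<in>perms l. w i < w j}. - of_int (sign w) * A (w \<circ> swp i j))"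
    by (rule sum.reindex_bij_witness[of _ "\<lambda>w. w \<circ> swp i j" "\<lambda>w. w \<circ> swp i j"])
         (use i j ij in \<open>auto simp: sign_comp_swp intro: permutes_compose swp_permutes\<close>)
  also have "(\<Sum>w\<in>{w\<in>perms l. w i < w j}. of_int (sign w) * A w) + \<dots>
     = (\<Sum>w\<in>{w\<in>perms l. w i < w j}. of_int (sign w) * (A w - A (w \<circ> swp i j)))"
    by (simp add: sum.distrib[symmetric] algebra_simps)
  also have "\<dots> = P i j + (\<Sum>w\<in>{w\<in>perms l. w i < w j}. - of_int (sign w) *
       (\<Sum>c\<in>{w i<..w j}. Y j (w(j := c, i := w i + w j - c))))"
    unfolding P_def by (simp add: tel sum.distrib[symmetric] algebra_simps sum_subtractf)
  also have "(\<Sum>w\<in>{w\<in>perms l. w i < w j}. - of_int (sign w) *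
       (\<Sum>c\<in>{w i<..w j}. Y j (w(j := c, i := w i + w j - c)))) = P j i"
    unfolding P_def
  proof (rule sum.reindex_bij_witness[of _ "\<lambda>w. w \<circ> swp i j" "\<lambda>w. w \<circ> swp i j"], goal_cases)
    case (5 w)
    have "(w \<circ> swp i j)(j := c, i := d) = w(j := c, i := d)" for c d
      by (auto simp: fun_eq_iff Transposition.transpose_def)
    then show ?case using 5 ij sign_comp_swp[of w l i j] by (simp add: add.commute)
  qed (use i j ij in \<open>auto simp: sign_comp_swp intro: permutes_compose swp_permutes\<close>)
  finally show ?thesis unfolding A_def .
qed

lemma alternating_sum_sum:
  "alternating_sum l (\<lambda>w. \<Sum>i\<in>I. F i w) = (\<Sum>i\<in>I. alternating_sum l (F i))"
  unfolding alternating_sum_def by (subst sum.swap) (simp add: sum_distrib_left)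

lemma alternating_sum_add: "alternating_sum l (\<lambda>w. F w + G w) = alternating_sum l F + alternating_sum l G"
  by (simp add: alternating_sum_def distrib_left sum.distrib)

lemma alternating_sum_cmult: "alternating_sum l (\<lambda>w. c * F w) = c * alternating_sum l F"
  by (simp add: alternating_sum_def sum_distrib_left algebra_simps)

lemma sum_perm_square:
  assumes "w permutes {..<l::nat}" shows "(\<Sum>i<l. (real (w i))\<^sup>2) = (\<Sum>i<l. (real i)\<^sup>2)"
  using sum.permute[OF assms, of "\<lambda>i. (real i)\<^sup>2"] by simp

text \<open>For b i = \<rho> i - i with \<rho> a partition of p, the eigenvalue is p plus twice the
  sum of the contents of \<rho>: the pairs x = y contribute p, and every transposition occurs as two
  ordered pairs.\<close>

theorem sum_chi_comp_swp:
  assumes \<sigma>: "\<sigma> permutes {..<p}"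
  shows "(\<Sum>x<p. \<Sum>y<p. chi p l b (\<sigma> \<circ> swp x y)) = (\<Sum>i<l. (of_int (b i))\<^sup>2 - (real i)\<^sup>2) * chi p l b \<sigma>"
proof -
  define X where "X = (\<lambda>v. tabl p l (\<lambda>m. b m + int (v m)) \<sigma>)"
  define Y where "Y = (\<lambda>i v. (of_int (b i) + real (v i)) * X v)"
  define P where "P = (\<lambda>i j. \<Sum>w\<in>{w\<in>perms l. w i < w j}. of_int (sign w) *
            (\<Sum>c\<in>{w i<..w j}. Y i (w(i := c, j := w i + w j - c))))"
  have "(\<Sum>x<p. \<Sum>y<p. chi p l b (\<sigma> \<circ> swp x y))
     = alternating_sum l (\<lambda>w. \<Sum>x<p. \<Sum>y<p. tabl p l (\<lambda>m. b m + int (w m)) (\<sigma> \<circ> swp x y))"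
    by (simp add: chi_def alternating_sum_sum)
  also have "\<dots> = alternating_sum l (\<lambda>w. (\<Sum>i<l. (of_int (b i + int (w i)))\<^sup>2 * X w) +
       (\<Sum>i<l. \<Sum>j\<in>{..<l} - {i}. swap_count p l i j (\<lambda>m. b m + int (w m)) \<sigma>))"
    unfolding sum_tabl_comp_swp[OF \<sigma>] X_def sum_distrib_right by simp
  also have "\<dots> = (\<Sum>i<l. alternating_sum l (\<lambda>w. (of_int (b i + int (w i)))\<^sup>2 * X w)) +
       (\<Sum>i<l. \<Sum>j\<in>{..<l} - {i}. alternating_sum l (\<lambda>w. swap_count p l i j (\<lambda>m. b m + int (w m)) \<sigma>))"
    by (simp only: alternating_sum_add alternating_sum_sum)
  also have "(\<Sum>i<l. \<Sum>j\<in>{..<l} - {i}. alternating_sum l (\<lambda>w. swap_count p l i j (\<lambda>m. b m + int (w m)) \<sigma>))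
     = (\<Sum>i<l. \<Sum>j\<in>{..<l} - {i}. P i j + P j i)"
  proof (intro sum.cong refl)
    fix i j assume "i \<in> {..<l}" "j \<in> {..<l} - {i}"
    then have "i < l" "j < l" "i \<noteq> j" by auto
    from alternating_sum_swap_count[OF \<sigma> this, of b]
    show "alternating_sum l (\<lambda>w. swap_count p l i j (\<lambda>m. b m + int (w m)) \<sigma>) = P i j + P j i"
      unfolding P_def Y_def X_def by simp
  qed
  also have "\<dots> = 2 * (\<Sum>i<l. \<Sum>j\<in>{..<l} - {i}. P i j)"
  proof -
    have "(\<Sum>i<l. \<Sum>j\<in>{..<l} - {i}. P j i) = (\<Sum>i<l. \<Sum>j\<in>{..<l} - {i}. P i j)"
      by (simp add: sum.Sigma, rule sum.reindex_bij_witness[of _ "\<lambda>(a, b). (b, a)" "\<lambda>(a, b). (b, a)"]) auto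
    then show ?thesis by (simp add: sum.distrib)
  qed
  also have "(\<Sum>i<l. \<Sum>j\<in>{..<l} - {i}. P i j) = (\<Sum>i<l. - alternating_sum l (\<lambda>w. real (w i) * Y i w))"
    unfolding P_def by (intro sum.cong refl moves) simp
  also have "(\<Sum>i<l. alternating_sum l (\<lambda>w. (of_int (b i + int (w i)))\<^sup>2 * X w)) + 2 * \<dots>
     = (\<Sum>i<l. alternating_sum l (\<lambda>w. (of_int (b i + int (w i)))\<^sup>2 * X w + (- 2) * (real (w i) * Y i w)))"
    by (simp only: alternating_sum_add alternating_sum_cmult sum.distrib sum_distrib_left sum_negf) (simp add: sum_negf sum_distrib_left)
  \<comment> \<open>With b and w for the entries at i, (b + w)^2 - 2 w (b + w) = b^2 - w^2. The
    squares of the w i add up to a constant because w permutes the indices, so the factor leaves the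
    alternating sum.\<close>
  also have "\<dots> = alternating_sum l (\<lambda>w. \<Sum>i<l. ((of_int (b i))\<^sup>2 - (real (w i))\<^sup>2) * X w)"
    unfolding alternating_sum_sum Y_def
    by (intro sum.cong refl arg_cong[where f = "alternating_sum l"] ext) (simp add: power2_eq_square algebra_simps)
  also have "\<dots> = alternating_sum l (\<lambda>w. (\<Sum>i<l. (of_int (b i))\<^sup>2 - (real i)\<^sup>2) * X w)"
    unfolding alternating_sum_def
    by (intro sum.cong refl) (simp add: sum_distrib_right[symmetric] sum_subtractf sum_perm_square)
  finally show ?thesis by (simp only: alternating_sum_cmult chi_def X_def)
qed

section \<open>Restriction to one point less\<close>

lemma permutes_Suc: "\<tau> permutes {..<p} \<Longrightarrow> \<tau> permutes {..<Suc p}"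
  by (auto elim: permutes_subset)

lemma permutes_bound: "\<sigma> permutes {..<p::nat} \<Longrightarrow> x < p \<Longrightarrow> \<sigma> x < p"
  using permutes_in_image[of \<sigma> "{..<p}" x] by auto

lemma card_fixed_colorings_last:
  assumes \<tau>: "\<tau> permutes {..<p}" and i: "i < l"
  shows "real (card {g \<in> colorings (Suc p) l \<alpha>. (\<forall>x<Suc p. g (\<tau> x) = g x) \<and> g p = i})
       = tabl p l (\<alpha>(i := \<alpha> i - 1)) \<tau>"
proof -
  define S where "S = {g \<in> colorings (Suc p) l \<alpha>. \<forall>x<Suc p. g (\<tau> x) = g x}"
  define R where "R = (\<lambda>i. {g \<in> colorings p l (\<alpha>(i := \<alpha> i - 1)). \<forall>x<p. g (\<tau> x) = g x})"
  have \<tau>p: "\<tau> p = p" using \<tau> by (auto simp: permutes_def)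
  have \<tau>l: "\<tau> x < p" if "x < p" for x using permutes_bound[OF \<tau> that] .
    have "bij_betw (\<lambda>g. g(p := undefined)) {g \<in> S. g p = i} (R i)"
    proof (rule bij_betw_byWitness[where f' = "\<lambda>h. h(p := i)"])
      show "\<forall>a\<in>{g \<in> S. g p = i}. (a(p := undefined))(p := i) = a" by auto
      show "\<forall>a\<in>R i. (a(p := i))(p := undefined) = a"
        by (auto simp: R_def colorings_def PiE_iff extensional_def fun_eq_iff)
      have cnt: "card {x. x < Suc p \<and> (h(p := i)) x = m} = card {x. x < p \<and> h x = m} + (if m = i then 1 else 0)" for h m
      proof -
        have "{x. x < Suc p \<and> (h(p := i)) x = m} = {x. x < p \<and> h x = m} \<union> (if m = i then {p} else {})"
          by (auto simp: less_Suc_eq)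
        then show ?thesis by (auto simp: card_insert_if)
      qed
      show "(\<lambda>g. g(p := undefined)) ` {g \<in> S. g p = i} \<subseteq> R i"
      proof clarify
        fix g assume g: "g \<in> S" "i = g p"
        let ?h = "g(p := undefined)"
        have gh: "g = ?h(p := i)" using g by auto
        have "\<alpha> m = int (card {x. x < p \<and> ?h x = m}) + (if m = i then 1 else 0)" if "m < l" for m
        proof -
          have "\<alpha> m = int (card {x. x < Suc p \<and> g x = m})" using g that by (simp add: S_def colorings_def)
          also have "\<dots> = int (card {x. x < Suc p \<and> (?h(p := i)) x = m})" using gh by simp
          finally show ?thesis unfolding cnt by simp
        qed
        then have "?h \<in> colorings p l (\<alpha>(i := \<alpha> i - 1))"
          using g by (auto simp: S_def colorings_def PiE_iff extensional_def)
        then show "?h \<in> R (g p)" using g \<tau>l unfolding R_def S_def by (auto dest: less_imp_neq)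
      qed
      show "(\<lambda>h. h(p := i)) ` R i \<subseteq> {g \<in> S. g p = i}"
      proof clarify
        fix h assume h: "h \<in> R i"
        have "int (card {x. x < Suc p \<and> (h(p := i)) x = m}) = \<alpha> m" if "m < l" for m
          using h that unfolding cnt R_def colorings_def by auto
        moreover have "h(p := i) \<in> {..<Suc p} \<rightarrow>\<^sub>E {..<l}"
          using h i by (auto simp: R_def colorings_def PiE_iff extensional_def)
        ultimately have "h(p := i) \<in> colorings (Suc p) l \<alpha>"
          by (simp add: colorings_def del: fun_upd_apply)
        then show "h(p := i) \<in> S \<and> (h(p := i)) p = i" using h \<tau>l \<tau>p unfolding R_def S_def
          by (auto simp: less_Suc_eq dest: less_imp_neq)
      qed
    qed
    then have "card {g \<in> S. g p = i} = card (R i)" by (rule bij_betw_same_card)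
  moreover have "{g \<in> S. g p = i} = {g \<in> colorings (Suc p) l \<alpha>. (\<forall>x<Suc p. g (\<tau> x) = g x) \<and> g p = i}"
    by (auto simp: S_def)
  ultimately show ?thesis by (simp add: tabl_def R_def)
qed

lemma inj_swp: "inj f \<Longrightarrow> f (swp a b z) = swp (f a) (f b) (f z)"
  by (simp add: Transposition.transpose_def inj_eq)

lemma tabl_branch:
  assumes \<tau>: "\<tau> permutes {..<p}"
  shows "tabl (Suc p) l \<alpha> \<tau> = (\<Sum>i<l. tabl p l (\<alpha>(i := \<alpha> i - 1)) \<tau>)"
proof -
  define S where "S = {g \<in> colorings (Suc p) l \<alpha>. \<forall>x<Suc p. g (\<tau> x) = g x}"
  have S: "S = (\<Union>i\<in>{..<l}. {g \<in> S. g p = i})" unfolding S_def colorings_def by auto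
  have fin: "finite S" unfolding S_def by simp
  have "card S = (\<Sum>i<l. card {g \<in> S. g p = i})"
    by (subst S, rule card_UN_disjoint) (auto simp: fin)
  then have "tabl (Suc p) l \<alpha> \<tau> = (\<Sum>i<l. real (card {g \<in> S. g p = i}))"
    by (simp add: tabl_def flip: S_def)
  also have "\<dots> = (\<Sum>i<l. tabl p l (\<alpha>(i := \<alpha> i - 1)) \<tau>)"
    by (intro sum.cong refl) (simp add: S_def conj_assoc card_fixed_colorings_last[OF \<tau>, symmetric])
  finally show ?thesis .
qed

lemma comp_perm_fix_iff:
  assumes \<pi>: "\<pi> permutes {..<p::nat}"
  shows "(\<forall>x<p. g (\<pi> ((\<sigma> ((inv \<pi>) x))))  = g x) \<longleftrightarrow> (\<forall>x<p. g (\<pi> (\<sigma> x)) = g (\<pi> x))"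
  using permutes_bound[OF \<pi>] permutes_bound[OF permutes_inv[OF \<pi>]] permutes_inverses[OF \<pi>] by metis

lemma extensional_comp_perm:
  assumes \<pi>: "\<pi> permutes {..<p::nat}" and g: "g \<in> {..<p} \<rightarrow>\<^sub>E A"
  shows "g \<circ> \<pi> \<in> {..<p} \<rightarrow>\<^sub>E A"
proof -
  have "\<pi> x = x" if "\<not> x < p" for x using that \<pi> by (auto simp: permutes_def)
  then show ?thesis using g permutes_bound[OF \<pi>] by (auto simp: PiE_iff extensional_def)
qed

lemma colorings_comp_perm:
  assumes \<pi>: "\<pi> permutes {..<p}" and g: "g \<in> colorings p l \<alpha>"
  shows "g \<circ> \<pi> \<in> colorings p l \<alpha>"
proof -
  have "card {x. x < p \<and> g (\<pi> x) = i} = card {x. x < p \<and> g x = i}" for i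
  proof (rule bij_betw_same_card[of \<pi>], rule bij_betw_byWitness[where f' = "inv \<pi>"])
  qed (use permutes_inverses[OF \<pi>] permutes_bound[OF \<pi>] permutes_bound[OF permutes_inv[OF \<pi>]] in auto)
  then show ?thesis using g extensional_comp_perm[OF \<pi>] by (auto simp: colorings_def)
qed

lemma tabl_conj:
  assumes \<pi>: "\<pi> permutes {..<p}"
  shows "tabl p l \<alpha> (\<pi> \<circ> \<sigma> \<circ> inv \<pi>) = tabl p l \<alpha> \<sigma>"
  unfolding tabl_def
proof (rule arg_cong[where f = real], rule bij_betw_same_card[of "\<lambda>g. g \<circ> \<pi>"],
    rule bij_betw_byWitness[where f' = "\<lambda>g. g \<circ> inv \<pi>"])
  note inv = permutes_inv_o[OF \<pi>]
  show "\<forall>a\<in>{g \<in> colorings p l \<alpha>. \<forall>x<p. g ((\<pi> \<circ> \<sigma> \<circ> inv \<pi>) x) = g x}. a \<circ> \<pi> \<circ> inv \<pi> = a"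
       "\<forall>a\<in>{g \<in> colorings p l \<alpha>. \<forall>x<p. g (\<sigma> x) = g x}. a \<circ> inv \<pi> \<circ> \<pi> = a"
    using inv by (auto simp: comp_assoc)
  show "(\<lambda>g. g \<circ> \<pi>) ` {g \<in> colorings p l \<alpha>. \<forall>x<p. g ((\<pi> \<circ> \<sigma> \<circ> inv \<pi>) x) = g x}
      \<subseteq> {g \<in> colorings p l \<alpha>. \<forall>x<p. g (\<sigma> x) = g x}"
  proof clarify
    fix g assume "g \<in> colorings p l \<alpha>" "\<forall>x<p. g ((\<pi> \<circ> \<sigma> \<circ> inv \<pi>) x) = g x"
    then show "g \<circ> \<pi> \<in> colorings p l \<alpha> \<and> (\<forall>x<p. (g \<circ> \<pi>) (\<sigma> x) = (g \<circ> \<pi>) x)"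
      using colorings_comp_perm[OF \<pi>] comp_perm_fix_iff[OF \<pi>, of g \<sigma>] by simp
  qed
  show "(\<lambda>g. g \<circ> inv \<pi>) ` {g \<in> colorings p l \<alpha>. \<forall>x<p. g (\<sigma> x) = g x}
      \<subseteq> {g \<in> colorings p l \<alpha>. \<forall>x<p. g ((\<pi> \<circ> \<sigma> \<circ> inv \<pi>) x) = g x}"
    using colorings_comp_perm[OF permutes_inv[OF \<pi>]] permutes_inverses[OF \<pi>]
      permutes_bound[OF permutes_inv[OF \<pi>]] by auto
qed

lemma chi_conj:
  "\<pi> permutes {..<p} \<Longrightarrow> chi p l b (\<pi> \<circ> \<sigma> \<circ> inv \<pi>) = chi p l b \<sigma>"
  by (simp add: chi_def tabl_conj)

text \<open>The point p is fixed by \<tau>, so colourings are sorted by its colour. All rows i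
  appear here; those from which no box can be removed contribute zero by
  \<open>chi_remove_zero\<close>.\<close>

lemma chi_branch:
  assumes \<tau>: "\<tau> permutes {..<p}"
  shows "chi (Suc p) l b \<tau> = (\<Sum>i<l. chi p l (b(i := b i - 1)) \<tau>)"
proof -
  have "(\<lambda>m. b m + int (w m))(i := b i + int (w i) - 1) = (\<lambda>m. (b(i := b i - 1)) m + int (w m))" for w i
    by auto
  then show ?thesis unfolding chi_def tabl_branch[OF \<tau>] alternating_sum_sum by simp
qed

lemma sum_lessThan_Suc_square:
  fixes F :: "nat \<Rightarrow> nat \<Rightarrow> real"
  shows "(\<Sum>x<Suc p. \<Sum>y<Suc p. F x y) = (\<Sum>x<p. \<Sum>y<p. F x y) + (\<Sum>x<p. F x p) + (\<Sum>y<p. F p y) + F p p"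
  by (simp add: sum.distrib)

text \<open>The transpositions that move p are those of degree p + 1 minus those of degree p. Both
  sums act by scalars on the terms of the branching rule, and the scalars differ by 2 b i - 1; the
  pair (p, p) takes away another 1, and ordered pairs account for the factor 2. For b i = \<rho> i -
  i the remaining b i - 1 is the content of the last box of row i.\<close>

lemma chi_jucys:
  assumes \<tau>: "\<tau> permutes {..<p}"
  shows "(\<Sum>y<p. chi (Suc p) l b (\<tau> \<circ> swp p y)) = (\<Sum>i<l. (of_int (b i) - 1) * chi p l (b(i := b i - 1)) \<tau>)"
proof -
  let ?E = "\<lambda>b. (\<Sum>i<l. (of_int (b i))\<^sup>2 - (real i)\<^sup>2)"
  let ?b = "\<lambda>i. b(i := b i - 1)"
  have E: "?E b - ?E (?b i) = 2 * of_int (b i) - 1" if "i < l" for i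
  proof -
    have "?E b - ?E (?b i) = (\<Sum>j<l. (of_int (b j))\<^sup>2 - (of_int (?b i j))\<^sup>2)"
      by (simp add: sum_subtractf)
    also have "\<dots> = (\<Sum>j<l. if j = i then 2 * of_int (b i) - 1 else 0)"
      by (intro sum.cong refl) (auto simp: power2_eq_square algebra_simps)
    also have "\<dots> = 2 * of_int (b i) - 1" using that by simp
    finally show ?thesis .
  qed
  have "(\<Sum>x<Suc p. \<Sum>y<Suc p. chi (Suc p) l b (\<tau> \<circ> swp x y)) = ?E b * chi (Suc p) l b \<tau>"
    using sum_chi_comp_swp[OF permutes_Suc[OF \<tau>]] .
  moreover have "(\<Sum>x<p. \<Sum>y<p. chi (Suc p) l b (\<tau> \<circ> swp x y)) = (\<Sum>i<l. ?E (?b i) * chi p l (?b i) \<tau>)"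
  proof -
    have "(\<Sum>x<p. \<Sum>y<p. chi (Suc p) l b (\<tau> \<circ> swp x y)) = (\<Sum>x<p. \<Sum>y<p. \<Sum>i<l. chi p l (?b i) (\<tau> \<circ> swp x y))"
      by (intro sum.cong refl chi_branch permutes_compose[OF swp_permutes \<tau>]) auto
    also have "\<dots> = (\<Sum>i<l. \<Sum>x<p. \<Sum>y<p. chi p l (?b i) (\<tau> \<circ> swp x y))"
      by (simp only: sum.swap[of _ "{..<l}" "{..<p}"])
    finally show ?thesis by (simp only: sum_chi_comp_swp[OF \<tau>])
  qed
  moreover have "chi (Suc p) l b (\<tau> \<circ> swp p p) = chi (Suc p) l b \<tau>" by simp
  moreover have "(\<Sum>x<p. chi (Suc p) l b (\<tau> \<circ> swp x p)) = (\<Sum>x<p. chi (Suc p) l b (\<tau> \<circ> swp p x))"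
    by (simp add: transpose_commute)
  ultimately have "2 * (\<Sum>y<p. chi (Suc p) l b (\<tau> \<circ> swp p y))
     = (?E b - 1) * chi (Suc p) l b \<tau> - (\<Sum>i<l. ?E (?b i) * chi p l (?b i) \<tau>)"
    unfolding sum_lessThan_Suc_square by (simp add: algebra_simps)
  also have "\<dots> = (\<Sum>i<l. (?E b - ?E (?b i) - 1) * chi p l (?b i) \<tau>)"
    unfolding chi_branch[OF \<tau>] by (simp only: sum_distrib_left left_diff_distrib sum_subtractf) 
  also have "\<dots> = (\<Sum>i<l. 2 * ((of_int (b i) - 1) * chi p l (?b i) \<tau>))"
    by (intro sum.cong refl) (simp only: E lessThan_iff, simp add: algebra_simps)
  finally show ?thesis by (simp add: sum_distrib_left[symmetric])
qed

section \<open>Cycles and the determination of class functions\<close>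

definition cyc :: "(nat \<Rightarrow> nat) \<Rightarrow> nat \<Rightarrow> nat set" where
  "cyc \<sigma> x = {(\<sigma> ^^ m) x | m. True}"

lemma cyc_self: "x \<in> cyc \<sigma> x"
  unfolding cyc_def by (metis (mono_tags, lifting) funpow_0 mem_Collect_eq)

lemma cyc_closed: "y \<in> cyc \<sigma> x \<Longrightarrow> \<sigma> y \<in> cyc \<sigma> x"
proof -
  assume "y \<in> cyc \<sigma> x"
  then obtain m where "y = (\<sigma> ^^ m) x" unfolding cyc_def by blast
  then have "\<sigma> y = (\<sigma> ^^ Suc m) x" by simp
  then show "\<sigma> y \<in> cyc \<sigma> x" unfolding cyc_def by blast
qed

lemma cyc_subsetI:
  assumes "x \<in> S" "\<And>y. y \<in> S \<Longrightarrow> \<sigma> y \<in> S" shows "cyc \<sigma> x \<subseteq> S"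
proof -
  have "(\<sigma> ^^ m) x \<in> S" for m by (induction m) (use assms in auto)
  then show ?thesis unfolding cyc_def by blast
qed

lemma cyc_subset: "\<sigma> permutes {..<p} \<Longrightarrow> x < p \<Longrightarrow> cyc \<sigma> x \<subseteq> {..<p}"
  by (rule cyc_subsetI) (simp_all add: permutes_bound)

lemma finite_cyc: "\<sigma> permutes {..<p} \<Longrightarrow> x < p \<Longrightarrow> finite (cyc \<sigma> x)"
  by (rule finite_subset[OF cyc_subset]) auto

text \<open>\<open>cyc\<close> is built from non-negative powers only. It is finite and mapped
  injectively into itself, hence onto itself, so preimages stay in it.\<close>

lemma inv_in_cyc:
  assumes \<sigma>: "\<sigma> permutes {..<p}" and x: "x < p"
  shows "inv \<sigma> x \<in> cyc \<sigma> x"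
proof -
  have "inj_on \<sigma> (cyc \<sigma> x)" using \<sigma> permutes_inj_on by blast
  moreover have "\<sigma> ` cyc \<sigma> x \<subseteq> cyc \<sigma> x" using cyc_closed by blast
  ultimately have "\<sigma> ` cyc \<sigma> x = cyc \<sigma> x" using finite_cyc[OF \<sigma> x] by (metis endo_inj_surj)
  then obtain y where "y \<in> cyc \<sigma> x" "\<sigma> y = x" using cyc_self[of x \<sigma>] by (metis imageE)
  then show ?thesis using permutes_inverses(2)[OF \<sigma>] by metis
qed

lemma funpow_conj:
  assumes "\<pi> permutes S" shows "(\<pi> \<circ> \<sigma> \<circ> inv \<pi>) ^^ m = \<pi> \<circ> \<sigma> ^^ m \<circ> inv \<pi>"
proof (induction m)
  case 0 then show ?case using permutes_inv_o[OF assms] by simp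
next
  case (Suc m)
  then show ?case using permutes_inverses[OF assms] by (simp add: fun_eq_iff)
qed

lemma cyc_conj:
  assumes "\<pi> permutes S" shows "cyc (\<pi> \<circ> \<sigma> \<circ> inv \<pi>) (\<pi> x) = \<pi> ` cyc \<sigma> x"
  unfolding cyc_def funpow_conj[OF assms] using permutes_inverses[OF assms] by auto

text \<open>Induction on the length of a cycle: a cycle of length \<open>r + 1\<close> is obtained from one of length
  \<open>r\<close> by inserting the fixed point \<open>p\<close>, and inserting it elsewhere keeps a cycle of length at
  most \<open>r\<close>.\<close>
lemma class_function_zero:
  fixes f :: "(nat \<Rightarrow> nat) \<Rightarrow> real"
  assumes cl: "\<And>\<sigma> \<pi>. \<sigma> permutes {..<Suc p} \<Longrightarrow> \<pi> permutes {..<Suc p} \<Longrightarrow> f (\<pi> \<circ> \<sigma> \<circ> inv \<pi>) = f \<sigma>"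
    and z: "\<And>\<tau>. \<tau> permutes {..<p} \<Longrightarrow> f \<tau> = 0"
    and J: "\<And>\<tau>. \<tau> permutes {..<p} \<Longrightarrow> (\<Sum>y<p. f (\<tau> \<circ> swp p y)) = 0"
    and \<sigma>: "\<sigma> permutes {..<Suc p}"
  shows "f \<sigma> = 0"
proof -
  have "f \<sigma> = 0" if "\<sigma> permutes {..<Suc p}" "x < Suc p" "card (cyc \<sigma> x) = r" for r \<sigma> x
    using that
  proof (induction r arbitrary: \<sigma> x rule: less_induct)
    case (less r \<sigma>0 x0)
    \<comment> \<open>Conjugation moves the chosen point to p and changes neither \<open>f\<close>
      nor the length of the cycle.\<close>
    define \<pi> where "\<pi> = swp x0 p"
    have \<pi>: "\<pi> permutes {..<Suc p}" using less.prems unfolding \<pi>_def by (auto intro: swp_permutes)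
    define \<sigma> where "\<sigma> = \<pi> \<circ> \<sigma>0 \<circ> inv \<pi>"
    have \<sigma>: "\<sigma> permutes {..<Suc p}" unfolding \<sigma>_def using less.prems \<pi> by (intro permutes_compose permutes_inv)
    have f\<sigma>: "f \<sigma> = f \<sigma>0" unfolding \<sigma>_def using cl less.prems \<pi> by blast
    have "cyc \<sigma> p = \<pi> ` cyc \<sigma>0 x0" using cyc_conj[OF \<pi>, of \<sigma>0 x0] unfolding \<sigma>_def by (simp add: \<pi>_def)
    then have card\<sigma>: "card (cyc \<sigma> p) = r" using less.prems(3) permutes_inj[OF \<pi>]
      by (simp add: card_image inj_on_subset)
    have to_p: "\<tau> permutes {..<p}" if "\<tau> permutes {..<Suc p}" "\<tau> p = p" for \<tau>
      by (rule permutes_superset[OF that(1)]) (use that less_Suc_eq in auto)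
    show ?case
    proof (cases "\<sigma> p = p")
      case True
      then show ?thesis using z to_p \<sigma> f\<sigma> by metis
    next
      case False
      define y0 where "y0 = inv \<sigma> p"
      define \<tau> where "\<tau> = \<sigma> \<circ> swp p y0"
      have \<sigma>y0: "\<sigma> y0 = p" unfolding y0_def using permutes_inverses[OF \<sigma>] by simp
      have y0p: "y0 \<noteq> p" using False \<sigma>y0 by auto
      have y0S: "y0 < Suc p" unfolding y0_def using permutes_bound[OF permutes_inv[OF \<sigma>]] by simp
      then have y0l: "y0 < p" using y0p by simp
      have "\<tau> permutes {..<Suc p}" unfolding \<tau>_def using \<sigma> y0S by (auto intro: permutes_compose swp_permutes)
      moreover have \<tau>p: "\<tau> p = p" unfolding \<tau>_def using \<sigma>y0 by simp
      ultimately have \<tau>: "\<tau> permutes {..<p}" using to_p by blast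
      have \<tau>y0: "\<tau> y0 = \<sigma> p" unfolding \<tau>_def by simp
      have \<tau>o: "\<tau> z = \<sigma> z" if "z \<noteq> p" "z \<noteq> y0" for z unfolding \<tau>_def using that by simp
      have \<sigma>\<tau>: "\<tau> \<circ> swp p y0 = \<sigma>" unfolding \<tau>_def by simp
      have sub: "cyc \<tau> y0 \<subseteq> cyc \<sigma> p - {p}"
      proof (rule cyc_subsetI)
        show "y0 \<in> cyc \<sigma> p - {p}" using y0p inv_in_cyc[OF \<sigma>, of p] by (simp add: y0_def)
        fix z assume z: "z \<in> cyc \<sigma> p - {p}"
        show "\<tau> z \<in> cyc \<sigma> p - {p}"
        proof (cases "z = y0")
          case True
          then show ?thesis using \<tau>y0 False cyc_closed[OF cyc_self, of \<sigma> p] by simp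
        next
          case False
          then have "\<sigma> z \<noteq> p" using \<sigma>y0 permutes_inj[OF \<sigma>] by (metis injD)
          then show ?thesis using \<tau>o[of z] False z cyc_closed[of z \<sigma> p] by auto
        qed
      qed
      have finC: "finite (cyc \<tau> y0)" using finite_cyc[OF \<tau> y0l] .
      have cardC: "card (cyc \<tau> y0) < r"
        unfolding card\<sigma>[symmetric] using finite_cyc[OF \<sigma>, of p] cyc_self[of p \<sigma>] sub
        by (intro psubset_card_mono) auto
      have Cp: "cyc \<tau> y0 \<subseteq> {..<p}" using cyc_subset[OF \<tau> y0l] .
      \<comment> \<open>Here p is inserted into a cycle that avoids \<open>y0\<close>, so the cycle
        of \<open>y0\<close> keeps a length below \<open>r\<close>. The induction is over cycles
        through an arbitrary point precisely so that it applies to \<open>y0\<close> instead of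
        p.\<close>
      have out: "f (\<tau> \<circ> swp p y) = 0" if y: "y < p" "y \<notin> cyc \<tau> y0" for y
      proof -
        have "cyc (\<tau> \<circ> swp p y) y0 \<subseteq> cyc \<tau> y0"
        proof (rule cyc_subsetI)
          fix z assume z: "z \<in> cyc \<tau> y0"
          then have "z \<noteq> p" "z \<noteq> y" using Cp y by auto
          then show "(\<tau> \<circ> swp p y) z \<in> cyc \<tau> y0" using cyc_closed[OF z] by simp
        qed (rule cyc_self)
        then have "card (cyc (\<tau> \<circ> swp p y) y0) < r" using cardC finC by (meson card_mono le_less_trans)
        moreover have "\<tau> \<circ> swp p y permutes {..<Suc p}"
          using y by (intro permutes_compose[OF swp_permutes permutes_Suc[OF \<tau>]]) auto
        ultimately show ?thesis using less.IH y0S by blast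
      qed
      \<comment> \<open>A power of \<tau> takes \<open>y0\<close> to \<open>y\<close>; it commutes
        with \<tau> and fixes p, so it conjugates \<open>\<tau> \<circ> swp p y0\<close> to
        \<open>\<tau> \<circ> swp p y\<close>. All positions on the cycle thus contribute the same
        value to a sum that is zero.\<close>
      have inC: "f (\<tau> \<circ> swp p y) = f \<sigma>" if y: "y \<in> cyc \<tau> y0" for y
      proof -
        obtain m where m: "y = (\<tau> ^^ m) y0" using y unfolding cyc_def by auto
        have tm: "\<tau> ^^ m permutes {..<p}" by (induction m) (simp_all only: funpow.simps permutes_id permutes_compose \<tau>)
        have tmp: "(\<tau> ^^ m) p = p" using tm by (auto simp: permutes_def)
        have comm: "(\<tau> ^^ m) (\<tau> z) = \<tau> ((\<tau> ^^ m) z)" for z by (simp add: funpow_swap1)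
        have "(\<tau> ^^ m) (swp p y0 z) = swp p y ((\<tau> ^^ m) z)" for z
          using inj_swp[OF permutes_inj[OF tm], of p y0 z] tmp m by simp
        then have "\<tau> \<circ> swp p y = \<tau> ^^ m \<circ> \<sigma> \<circ> inv (\<tau> ^^ m)"
          unfolding \<sigma>\<tau>[symmetric] using comm permutes_inverses(1)[OF tm] by (auto simp: fun_eq_iff)
        then show ?thesis using cl[OF \<sigma> permutes_Suc[OF tm]] by simp
      qed
      have "0 = (\<Sum>y<p. f (\<tau> \<circ> swp p y))" using J[OF \<tau>] by simp
      also have "\<dots> = (\<Sum>y\<in>cyc \<tau> y0. f (\<tau> \<circ> swp p y))"
        using Cp out by (intro sum.mono_neutral_right) auto
      also have "\<dots> = real (card (cyc \<tau> y0)) * f \<sigma>" using inC by simp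
      finally have "f \<sigma> = 0" using finC cyc_self[of y0 \<tau>] by auto
      then show ?thesis using f\<sigma> by simp
    qed
  qed
  then show ?thesis using \<sigma> by blast
qed

section \<open>The Gram function and the Weingarten function\<close>

text \<open>For finite \<open>A\<close> this is card A raised to the number of cycles of g, which is
  the trace of the permutation operator of g. Counting fixed words keeps cycles out of the recursion
  on p.\<close>

definition fixc :: "'a set \<Rightarrow> nat \<Rightarrow> (nat \<Rightarrow> nat) \<Rightarrow> real" where
  "fixc A p g = real (card {c \<in> {..<p} \<rightarrow>\<^sub>E A. \<forall>x<p. c (g x) = c x})"

lemma fixc_Suc:
  assumes \<tau>: "\<tau> permutes {..<p}" and A: "finite A"
  shows "fixc A (Suc p) \<tau> = real (card A) * fixc A p \<tau>"
proof -
  have \<tau>p: "\<tau> p = p" using \<tau> by (auto simp: permutes_def)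
  have \<tau>l: "\<tau> x < p" "\<tau> x \<noteq> p" if "x < p" for x using permutes_bound[OF \<tau> that] by auto
  have "bij_betw (\<lambda>c. (c p, c(p := undefined))) {c \<in> {..<Suc p} \<rightarrow>\<^sub>E A. \<forall>x<Suc p. c (\<tau> x) = c x}
     (A \<times> {c \<in> {..<p} \<rightarrow>\<^sub>E A. \<forall>x<p. c (\<tau> x) = c x})"
  proof (rule bij_betw_byWitness[where f' = "\<lambda>(a, c). c(p := a)"])
    show "(\<lambda>c. (c p, c(p := undefined))) ` {c \<in> {..<Suc p} \<rightarrow>\<^sub>E A. \<forall>x<Suc p. c (\<tau> x) = c x}
      \<subseteq> A \<times> {c \<in> {..<p} \<rightarrow>\<^sub>E A. \<forall>x<p. c (\<tau> x) = c x}"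
      using \<tau>l by (auto simp: PiE_iff extensional_def dest: less_imp_neq)
    show "(\<lambda>(a, c). c(p := a)) ` (A \<times> {c \<in> {..<p} \<rightarrow>\<^sub>E A. \<forall>x<p. c (\<tau> x) = c x})
      \<subseteq> {c \<in> {..<Suc p} \<rightarrow>\<^sub>E A. \<forall>x<Suc p. c (\<tau> x) = c x}"
      using \<tau>l \<tau>p by (auto simp: PiE_iff extensional_def less_Suc_eq dest: less_imp_neq)
  qed (auto simp: PiE_iff extensional_def fun_eq_iff)
  then show ?thesis unfolding fixc_def by (simp add: bij_betw_same_card card_cartesian_product)
qed

text \<open>The transposition inserts p into the cycle of y, so the letter at p is forced and,
  unlike for a fixed point p, no factor card A appears.\<close>

lemma fixc_swp_comp:
  assumes \<tau>: "\<tau> permutes {..<p}" and y: "y < p"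
  shows "fixc A (Suc p) (swp p y \<circ> \<tau>) = fixc A p \<tau>"
proof -
  have \<tau>p: "\<tau> p = p" using \<tau> by (auto simp: permutes_def)
  have \<tau>l: "\<tau> x < p" "\<tau> x \<noteq> p" if "x < p" for x using permutes_bound[OF \<tau> that] by auto
  have *: "(\<forall>x<Suc p. c ((swp p y \<circ> \<tau>) x) = c x) \<longleftrightarrow> c p = c y \<and> (\<forall>x<p. c (\<tau> x) = c x)" for c :: "nat \<Rightarrow> 'a"
  proof -
    have "c (swp p y z) = c z" if "c p = c y" for z using that by (auto simp: Transposition.transpose_def)
    then show ?thesis using \<tau>p \<tau>l by (auto simp: less_Suc_eq)
  qed
  have "bij_betw (\<lambda>c. c(p := undefined)) {c \<in> {..<Suc p} \<rightarrow>\<^sub>E A. \<forall>x<Suc p. c ((swp p y \<circ> \<tau>) x) = c x}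
     {c \<in> {..<p} \<rightarrow>\<^sub>E A. \<forall>x<p. c (\<tau> x) = c x}"
    unfolding *
  proof (rule bij_betw_byWitness[where f' = "\<lambda>c. c(p := c y)"])
    show "(\<lambda>c. c(p := undefined)) ` {c \<in> {..<Suc p} \<rightarrow>\<^sub>E A. c p = c y \<and> (\<forall>x<p. c (\<tau> x) = c x)}
      \<subseteq> {c \<in> {..<p} \<rightarrow>\<^sub>E A. \<forall>x<p. c (\<tau> x) = c x}"
      using \<tau>l by (auto simp: PiE_iff extensional_def dest: less_imp_neq)
    show "(\<lambda>c. c(p := c y)) ` {c \<in> {..<p} \<rightarrow>\<^sub>E A. \<forall>x<p. c (\<tau> x) = c x}
      \<subseteq> {c \<in> {..<Suc p} \<rightarrow>\<^sub>E A. c p = c y \<and> (\<forall>x<p. c (\<tau> x) = c x)}"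
      using \<tau>l \<tau>p y by (auto simp: PiE_iff extensional_def less_Suc_eq dest: less_imp_neq)
  qed (use y in \<open>auto simp: PiE_iff extensional_def fun_eq_iff\<close>)
  then show ?thesis unfolding fixc_def by (simp only: bij_betw_same_card)
qed

lemma fixc_conj:
  assumes \<pi>: "\<pi> permutes {..<p}"
  shows "fixc A p (\<pi> \<circ> \<sigma> \<circ> inv \<pi>) = fixc A p \<sigma>"
  unfolding fixc_def
proof (rule arg_cong[where f = real], rule bij_betw_same_card[of "\<lambda>g. g \<circ> \<pi>"],
    rule bij_betw_byWitness[where f' = "\<lambda>g. g \<circ> inv \<pi>"])
  note inv = permutes_inv_o[OF \<pi>]
  show "\<forall>a\<in>{g \<in> {..<p} \<rightarrow>\<^sub>E A. \<forall>x<p. g ((\<pi> \<circ> \<sigma> \<circ> inv \<pi>) x) = g x}. a \<circ> \<pi> \<circ> inv \<pi> = a"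
       "\<forall>a\<in>{g \<in> {..<p} \<rightarrow>\<^sub>E A. \<forall>x<p. g (\<sigma> x) = g x}. a \<circ> inv \<pi> \<circ> \<pi> = a"
    using inv by (auto simp: comp_assoc)
  show "(\<lambda>g. g \<circ> \<pi>) ` {g \<in> {..<p} \<rightarrow>\<^sub>E A. \<forall>x<p. g ((\<pi> \<circ> \<sigma> \<circ> inv \<pi>) x) = g x}
      \<subseteq> {g \<in> {..<p} \<rightarrow>\<^sub>E A. \<forall>x<p. g (\<sigma> x) = g x}"
  proof clarify
    fix g assume "g \<in> {..<p} \<rightarrow>\<^sub>E A" "\<forall>x<p. g ((\<pi> \<circ> \<sigma> \<circ> inv \<pi>) x) = g x"
    then show "g \<circ> \<pi> \<in> {..<p} \<rightarrow>\<^sub>E A \<and> (\<forall>x<p. (g \<circ> \<pi>) (\<sigma> x) = (g \<circ> \<pi>) x)"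
      using extensional_comp_perm[OF \<pi>] comp_perm_fix_iff[OF \<pi>, of g \<sigma>] by simp
  qed
  show "(\<lambda>g. g \<circ> inv \<pi>) ` {g \<in> {..<p} \<rightarrow>\<^sub>E A. \<forall>x<p. g (\<sigma> x) = g x}
      \<subseteq> {g \<in> {..<p} \<rightarrow>\<^sub>E A. \<forall>x<p. g ((\<pi> \<circ> \<sigma> \<circ> inv \<pi>) x) = g x}"
    using extensional_comp_perm[OF permutes_inv[OF \<pi>]] permutes_inverses[OF \<pi>]
      permutes_bound[OF permutes_inv[OF \<pi>]] by auto
qed

lemma tabl_inv:
  assumes \<pi>: "\<pi> permutes {..<p}" shows "tabl p l \<alpha> (inv \<pi>) = tabl p l \<alpha> \<pi>"
proof -
  have "(\<forall>x<p. c (inv \<pi> x) = c x) \<longleftrightarrow> (\<forall>x<p. c (\<pi> x) = c x)" for c :: "nat \<Rightarrow> nat"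
    using permutes_bound[OF \<pi>] permutes_bound[OF permutes_inv[OF \<pi>]] permutes_inverses[OF \<pi>] by metis
  then show ?thesis by (simp add: tabl_def)
qed

lemma chi_inv: "\<pi> permutes {..<p} \<Longrightarrow> chi p l b (inv \<pi>) = chi p l b \<pi>"
  by (simp add: chi_def tabl_inv)

lemma tabl_recolor:
  assumes i: "i < l" and k: "k < l" and \<sigma>: "\<sigma> permutes {..<p}"
  shows "tabl p l (\<alpha> \<circ> swp i k) \<sigma> = tabl p l \<alpha> \<sigma>"
proof -
  let ?F = "\<lambda>\<alpha>. {g \<in> colorings p l \<alpha>. \<forall>x<p. g (\<sigma> x) = g x}"
  let ?h = "\<lambda>g x. if x < p then swp i k (g x) else undefined"
  have sub: "?h g \<in> ?F (\<alpha> \<circ> swp i k)" if "g \<in> ?F \<alpha>" for g \<alpha>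
  proof -
    have sl: "swp i k m < l" if "m < l" for m using that i k by (auto simp: Transposition.transpose_def)
    have e: "{x. x < p \<and> ?h g x = m} = {x. x < p \<and> g x = swp i k m}" for m
    proof -
      have "swp i k a = m \<longleftrightarrow> a = swp i k m" for a by (metis transpose_involutory)
      then show ?thesis by auto
    qed
    have "?h g \<in> {..<p} \<rightarrow>\<^sub>E {..<l}" using that sl by (auto simp: colorings_def PiE_iff extensional_def)
    moreover have "int (card {x. x < p \<and> ?h g x = m}) = (\<alpha> \<circ> swp i k) m" if "m < l" for m
      using \<open>g \<in> ?F \<alpha>\<close> sl[OF that] unfolding e by (simp add: colorings_def)
    ultimately have "?h g \<in> colorings p l (\<alpha> \<circ> swp i k)" unfolding colorings_def by blast
    then show ?thesis using that permutes_bound[OF \<sigma>] by simp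
  qed
  have inv: "?h (?h g) = g" if "g \<in> ?F \<alpha>" for g \<alpha>
    using that by (auto simp: colorings_def PiE_iff extensional_def fun_eq_iff)
  have "card (?F (\<alpha> \<circ> swp i k)) = card (?F \<alpha>)"
  proof (rule bij_betw_same_card[of ?h], rule bij_betw_byWitness[where f' = ?h])
    show "?h ` ?F (\<alpha> \<circ> swp i k) \<subseteq> ?F \<alpha>" using sub[of _ "\<alpha> \<circ> swp i k"] by (auto simp del: mem_Collect_eq)
    show "?h ` ?F \<alpha> \<subseteq> ?F (\<alpha> \<circ> swp i k)" using sub[of _ \<alpha>] by (auto simp del: mem_Collect_eq)
  qed (use inv in blast)+
  then show ?thesis by (simp add: tabl_def)
qed

text \<open>A determinant with two equal rows: exchanging i and k in w only renames two colours,
  which \<open>tabl\<close> does not notice, while the sign changes.\<close>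

lemma chi_eq_zero:
  assumes \<sigma>: "\<sigma> permutes {..<p}" and i: "i < l" "k < l" "i \<noteq> k" and b: "b i = b k"
  shows "chi p l b \<sigma> = 0"
  unfolding chi_def alternating_sum_def
proof (rule sum_antisym_zero[of _ "\<lambda>w. w \<circ> swp i k"])
  fix w assume "w \<in> perms l"
  then have w: "w permutes {..<l}" by simp
  show "w \<circ> swp i k \<in> perms l" using i w by (auto intro!: permutes_compose swp_permutes)
  show "w \<circ> swp i k \<circ> swp i k = w" by simp
  have e: "(\<lambda>m. b m + int ((w \<circ> swp i k) m)) = (\<lambda>m. b m + int (w m)) \<circ> swp i k"
    using b by (auto simp: fun_eq_iff Transposition.transpose_def)
  show "real_of_int (sign (w \<circ> swp i k)) * tabl p l (\<lambda>m. b m + int ((w \<circ> swp i k) m)) \<sigma> =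
        - (real_of_int (sign w) * tabl p l (\<lambda>i. b i + int (w i)) \<sigma>)"
    unfolding e tabl_recolor[OF i(1,2) \<sigma>] using sign_comp_swp[OF w i(3)] by simp
qed

lemma tabl_neg: "i < l \<Longrightarrow> \<alpha> i < 0 \<Longrightarrow> tabl p l \<alpha> \<sigma> = 0"
proof -
  assume "i < l" "\<alpha> i < 0"
  then have "colorings p l \<alpha> = {}" by (force simp: colorings_def)
  then show ?thesis by (simp add: tabl_def)
qed

text \<open>Since w i is at most l - 1, fibre i would have negative size in every term.\<close>

lemma chi_neg:
  assumes "i < l" "b i + int l \<le> 0" shows "chi p l b \<sigma> = 0"
  unfolding chi_def alternating_sum_def
proof (rule sum.neutral, rule ballI)
  fix w assume "w \<in> perms l"
  then have "w i < l" using permutes_bound assms by blast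
  then have "tabl p l (\<lambda>i. b i + int (w i)) \<sigma> = 0" using assms by (intro tabl_neg[of i]) auto
  then show "real_of_int (sign w) * tabl p l (\<lambda>i. b i + int (w i)) \<sigma> = 0" by simp
qed

section \<open>Partitions as zero-padded functions, and their boxes\<close>

definition part :: "nat \<Rightarrow> nat \<Rightarrow> (nat \<Rightarrow> nat) set" where
  "part l p = {\<rho>. (\<forall>i. \<rho> (Suc i) \<le> \<rho> i) \<and> (\<forall>i\<ge>l. \<rho> i = 0) \<and> (\<Sum>i<l. \<rho> i) = p}"

text \<open>Row i of the Jacobi-Trudi determinant. With rows counted from 0, the value is also the
  content of a box appended to row i.\<close>

definition beta :: "(nat \<Rightarrow> nat) \<Rightarrow> nat \<Rightarrow> int" where
  "beta \<rho> i = int (\<rho> i) - int i"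

definition content_prod :: "nat \<Rightarrow> real \<Rightarrow> (nat \<Rightarrow> nat) \<Rightarrow> real" where
  "content_prod l N \<rho> = (\<Prod>i<l. \<Prod>j<\<rho> i. N + real j - real i)"

lemma finite_part: "finite (part l p)"
proof (rule finite_subset)
  show "part l p \<subseteq> {f. \<forall>x. (x \<in> {..<l} \<longrightarrow> f x \<in> {..p}) \<and> (x \<notin> {..<l} \<longrightarrow> f x = 0)}"
  proof
    fix \<rho> assume r: "\<rho> \<in> part l p"
    have "\<rho> i \<le> p" if "i < l" for i
      using r that member_le_sum[of i "{..<l}" \<rho>] by (auto simp: part_def)
    then show "\<rho> \<in> {f. \<forall>x. (x \<in> {..<l} \<longrightarrow> f x \<in> {..p}) \<and> (x \<notin> {..<l} \<longrightarrow> f x = 0)}"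
      using r by (auto simp: part_def)
  qed
  show "finite {f. \<forall>x. (x \<in> {..<l} \<longrightarrow> f x \<in> {..p}) \<and> (x \<notin> {..<l} \<longrightarrow> f x = (0::nat))}"
    by (rule finite_set_of_finite_funs) auto
qed

lemma sum_fun_upd_lessThan:
  fixes \<rho> :: "nat \<Rightarrow> nat"
  assumes "i < l" shows "(\<Sum>m<l. (\<rho>(i := c)) m) + \<rho> i = (\<Sum>m<l. \<rho> m) + c"
  using assms by (simp add: sum.remove[of "{..<l}" i])

lemma part_remove:
  assumes r: "\<rho> \<in> part l (Suc p)" and i: "i < l" "\<rho> (Suc i) < \<rho> i"
  shows "\<rho>(i := \<rho> i - 1) \<in> part l p"
proof -
  have "(\<rho>(i := \<rho> i - 1)) (Suc m) \<le> (\<rho>(i := \<rho> i - 1)) m" for m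
    using r i spec[of _ m] by (auto simp: part_def intro: le_trans diff_le_self)
  then show ?thesis using r i sum_fun_upd_lessThan[of i l \<rho> "\<rho> i - 1"] by (auto simp: part_def)
qed

lemma part_add:
  assumes r: "\<rho> \<in> part l p" and i: "i < l" "i = 0 \<or> \<rho> i < \<rho> (i - 1)"
  shows "\<rho>(i := \<rho> i + 1) \<in> part l (Suc p)"
proof -
  have "(\<rho>(i := \<rho> i + 1)) (Suc m) \<le> (\<rho>(i := \<rho> i + 1)) m" for m
    using r i by (auto simp: part_def le_SucI)
  then show ?thesis using r i sum_fun_upd_lessThan[of i l \<rho> "\<rho> i + 1"] by (auto simp: part_def)
qed

lemma beta_remove: "\<rho> i > 0 \<Longrightarrow> beta (\<rho>(i := \<rho> i - 1)) = (beta \<rho>)(i := beta \<rho> i - 1)"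
  by (auto simp: beta_def fun_eq_iff of_nat_diff)

text \<open>The removed box is the last of row i, with content
  \<open>beta \<rho> i - 1\<close>.\<close>

lemma content_prod_remove:
  assumes "i < l" "\<rho> i > 0"
  shows "content_prod l N \<rho> = (N + of_int (beta \<rho> i) - 1) * content_prod l N (\<rho>(i := \<rho> i - 1))"
proof -
  obtain r where r: "\<rho> i = Suc r" using assms by (cases "\<rho> i") auto
  show ?thesis using assms(1) unfolding content_prod_def beta_def r
    by (subst (1 2) prod.remove[of "{..<l}" i]) (auto simp: r)
qed

text \<open>If row i + 1 is as long as row i, lowering entry i makes it equal to the next entry. In
  the last row the condition means that the row is empty, and the lowered entry is -l, too small for
  any colouring.\<close>

lemma chi_remove_zero:
  assumes \<tau>: "\<tau> permutes {..<p}" and r: "\<rho> \<in> part l (Suc p)" and i: "i < l" "\<not> \<rho> (Suc i) < \<rho> i"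
  shows "chi p l ((beta \<rho>)(i := beta \<rho> i - 1)) \<tau> = 0"
proof -
  have e: "\<rho> (Suc i) = \<rho> i" using r i by (auto simp: part_def intro: le_antisym)
  show ?thesis
  proof (cases "Suc i < l")
    case True
    then show ?thesis using e by (intro chi_eq_zero[OF \<tau>, of i l "Suc i"]) (auto simp: beta_def)
  next
    case False
    then have "Suc i = l" using i by simp
    then show ?thesis using r e i by (intro chi_neg[of i]) (auto simp: part_def beta_def)
  qed
qed

lemma chi_add_zero:
  assumes \<tau>: "\<tau> permutes {..<p'}" and r: "\<rho> \<in> part l p" and i: "i < l" "\<not> (i = 0 \<or> \<rho> i < \<rho> (i - 1))"
  shows "chi p' l ((beta \<rho>)(i := beta \<rho> i + 1)) \<tau> = 0"
proof -
  obtain m where m: "i = Suc m" using i by (cases i) auto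
  have e: "\<rho> (Suc m) = \<rho> m" using r i m by (auto simp: part_def intro: le_antisym)
  then show ?thesis using i m by (intro chi_eq_zero[OF \<tau>, of i l m]) (auto simp: beta_def)
qed

section \<open>Convolution of the characters with the Gram function\<close>

lemma sum_perms_Suc:
  fixes F :: "(nat \<Rightarrow> nat) \<Rightarrow> real"
  shows "sum F (perms (Suc p)) = (\<Sum>h\<in>perms p. F h + (\<Sum>y<p. F (swp p y \<circ> h)))"
proof -
  have "sum F (perms (Suc p)) = (\<Sum>y\<in>insert p {..<p}. \<Sum>h\<in>perms p. F (swp p y \<circ> h))"
    unfolding lessThan_Suc by (rule sum_over_permutations_insert) auto
  also have "\<dots> = (\<Sum>h\<in>perms p. F h + (\<Sum>y<p. F (swp p y \<circ> h)))"
    by (simp add: sum.distrib sum.swap[of _ "perms p"])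
  finally show ?thesis .
qed

lemma sum_chi_swp_comp:
  assumes u: "u permutes {..<p}"
  shows "(\<Sum>y<p. chi (Suc p) l b (swp p y \<circ> u)) = (\<Sum>i<l. (of_int (b i) - 1) * chi p l (b(i := b i - 1)) u)"
proof -
  have "chi (Suc p) l b (swp p y \<circ> u) = chi (Suc p) l b (u \<circ> swp p y)" if "y < p" for y
    using chi_conj[OF swp_permutes[of p "Suc p" y], of l b "u \<circ> swp p y"] that
    by (simp add: comp_assoc)
  then show ?thesis using chi_jucys[OF u] by simp
qed

text \<open>On permutations that fix p, coset decomposition reduces the convolution to degree p. The
  trivial coset contributes N because p is a free letter, the others contribute the Jucys-Murphy
  eigenvalue, and N plus the content is exactly the factor that \<open>content_prod\<close> gains
  with the box.\<close>

theorem sum_fixc_chi: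
  assumes A: "finite A" and \<rho>: "\<rho> \<in> part l p" and z: "z permutes {..<p}"
  shows "(\<Sum>g\<in>perms p. fixc A p g * chi p l (beta \<rho>) (g \<circ> z))
       = content_prod l (real (card A)) \<rho> * chi p l (beta \<rho>) z"
  using \<rho> z
proof (induction p arbitrary: \<rho> z)
  case 0
  have "\<rho> i = 0" for i using 0(1) by (cases "i < l") (auto simp: part_def)
  then have "content_prod l (real (card A)) \<rho> = 1" by (simp add: content_prod_def)
  moreover have "{c \<in> {..<0::nat} \<rightarrow>\<^sub>E A. \<forall>x<0. c (id x) = c x} = {\<lambda>_. undefined}" by auto
  ultimately show ?case using 0 by (simp add: fixc_def)
next
  case (Suc p)
  let ?N = "real (card A)" and ?b = "beta \<rho>" and ?C = "content_prod l (real (card A)) \<rho>"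
  let ?G = "fixc A (Suc p)" and ?X = "chi (Suc p) l (beta \<rho>)"
  let ?x = "\<lambda>i. chi p l ((beta \<rho>)(i := beta \<rho> i - 1))"
  define f where "f = (\<lambda>z. (\<Sum>g\<in>perms (Suc p). ?G g * ?X (g \<circ> z)) - ?C * ?X z)"
  have zero: "f \<tau> = 0" if \<tau>: "\<tau> permutes {..<p}" for \<tau>
  proof -
    have "(\<Sum>g\<in>perms (Suc p). ?G g * ?X (g \<circ> \<tau>))
       = (\<Sum>h\<in>perms p. ?G h * ?X (h \<circ> \<tau>) + (\<Sum>y<p. ?G (swp p y \<circ> h) * ?X (swp p y \<circ> h \<circ> \<tau>)))"
      by (rule sum_perms_Suc)
    also have "\<dots> = (\<Sum>h\<in>perms p. \<Sum>i<l. (?N + of_int (?b i) - 1) * (fixc A p h * ?x i (h \<circ> \<tau>)))"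
    proof (rule sum.cong[OF refl])
      fix h assume "h \<in> perms p"
      then have h: "h permutes {..<p}" and h\<tau>: "h \<circ> \<tau> permutes {..<p}" using \<tau> by (auto intro: permutes_compose)
      have "(\<Sum>y<p. ?G (swp p y \<circ> h) * ?X (swp p y \<circ> h \<circ> \<tau>)) = (\<Sum>y<p. fixc A p h * ?X (swp p y \<circ> (h \<circ> \<tau>)))"
        by (intro sum.cong refl) (simp only: fixc_swp_comp[OF h] comp_assoc lessThan_iff)
      also have "\<dots> = fixc A p h * (\<Sum>i<l. (of_int (?b i) - 1) * ?x i (h \<circ> \<tau>))"
        by (simp only: sum_chi_swp_comp[OF h\<tau>] sum_distrib_left[symmetric])
      finally show "?G h * ?X (h \<circ> \<tau>) + (\<Sum>y<p. ?G (swp p y \<circ> h) * ?X (swp p y \<circ> h \<circ> \<tau>))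
         = (\<Sum>i<l. (?N + of_int (?b i) - 1) * (fixc A p h * ?x i (h \<circ> \<tau>)))"
        by (simp only: fixc_Suc[OF h A] chi_branch[OF h\<tau>] sum_distrib_left sum.distrib[symmetric])
           (intro sum.cong refl, simp add: algebra_simps)
    qed
    also have "\<dots> = (\<Sum>i<l. (?N + of_int (?b i) - 1) * (\<Sum>h\<in>perms p. fixc A p h * ?x i (h \<circ> \<tau>)))"
      by (subst sum.swap) (simp only: sum_distrib_left)
    also have "\<dots> = (\<Sum>i<l. ?C * ?x i \<tau>)"
    proof (rule sum.cong[OF refl])
      fix i assume "i \<in> {..<l}"
      then have i: "i < l" by simp
      show "(?N + of_int (?b i) - 1) * (\<Sum>h\<in>perms p. fixc A p h * ?x i (h \<circ> \<tau>)) = ?C * ?x i \<tau>"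
      proof (cases "\<rho> (Suc i) < \<rho> i")
        case True
        note r' = part_remove[OF Suc.prems(1) i True]
        have e: "beta (\<rho>(i := \<rho> i - 1)) = (beta \<rho>)(i := beta \<rho> i - 1)" using True by (intro beta_remove) auto
        have "?C = (?N + of_int (?b i) - 1) * content_prod l ?N (\<rho>(i := \<rho> i - 1))"
          using i True by (intro content_prod_remove) auto
        moreover have "(\<Sum>h\<in>perms p. fixc A p h * ?x i (h \<circ> \<tau>)) = content_prod l ?N (\<rho>(i := \<rho> i - 1)) * ?x i \<tau>"
          using Suc.IH[OF r' \<tau>] unfolding e .
        ultimately show ?thesis by (simp only: mult.assoc)
      next
        case False
        have "?x i (h \<circ> \<tau>) = 0" if "h \<in> perms p" for h
          using that \<tau> by (intro chi_remove_zero[OF _ Suc.prems(1) i False]) (auto intro: permutes_compose)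
        then show ?thesis using chi_remove_zero[OF \<tau> Suc.prems(1) i False] by simp
      qed
    qed
    also have "\<dots> = ?C * ?X \<tau>" by (simp add: chi_branch[OF \<tau>] sum_distrib_left)
    finally show ?thesis by (simp add: f_def)
  qed
  have "f z = 0"
  proof (rule class_function_zero[of p f])
    fix \<sigma> \<pi> :: "nat \<Rightarrow> nat" assume \<sigma>: "\<sigma> permutes {..<Suc p}" and \<pi>: "\<pi> permutes {..<Suc p}"
    have "(\<Sum>g\<in>perms (Suc p). ?G g * ?X (g \<circ> (\<pi> \<circ> \<sigma> \<circ> inv \<pi>))) = (\<Sum>g\<in>perms (Suc p). ?G g * ?X (g \<circ> \<sigma>))"
    proof (rule sum.reindex_bij_witness[of _ "\<lambda>g. \<pi> \<circ> g \<circ> inv \<pi>" "\<lambda>g. inv \<pi> \<circ> g \<circ> \<pi>"], goal_cases)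
      case (5 g)
      have "\<pi> \<circ> (inv \<pi> \<circ> g \<circ> \<pi> \<circ> \<sigma>) \<circ> inv \<pi> = g \<circ> (\<pi> \<circ> \<sigma> \<circ> inv \<pi>)"
        using permutes_inverses[OF \<pi>] by (auto simp: fun_eq_iff)
      then have "?X (g \<circ> (\<pi> \<circ> \<sigma> \<circ> inv \<pi>)) = ?X (inv \<pi> \<circ> g \<circ> \<pi> \<circ> \<sigma>)"
        using chi_conj[OF \<pi>, of l "beta \<rho>" "inv \<pi> \<circ> g \<circ> \<pi> \<circ> \<sigma>"] by simp
      moreover have "?G (inv \<pi> \<circ> g \<circ> \<pi>) = ?G g"
        using fixc_conj[OF permutes_inv[OF \<pi>], of A g] permutes_inv_inv[OF \<pi>] by simp
      ultimately show ?case by simp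
    qed (use \<pi> permutes_inverses[OF \<pi>] in \<open>auto simp: fun_eq_iff intro!: permutes_compose permutes_inv\<close>)
    then show "f (\<pi> \<circ> \<sigma> \<circ> inv \<pi>) = f \<sigma>" by (simp only: f_def chi_conj[OF \<pi>])
  next
    fix \<tau> assume \<tau>: "\<tau> permutes {..<p}"
    let ?E = "(\<Sum>i<l. (of_int (?b i))\<^sup>2 - (real i)\<^sup>2)"
    note \<tau>S = permutes_Suc[OF \<tau>]
    \<comment> \<open>The convolution acts on the left and the transpositions on the right, so f
      inherits the eigenvalue of the character and the full sum is a multiple of f \<tau> = 0. The
      pairs below p and the pair (p, p) only involve permutations fixing p, where f vanishes; what
      remains is twice the Jucys-Murphy sum.\<close>
    have "(\<Sum>x<Suc p. \<Sum>y<Suc p. f (\<tau> \<circ> swp x y))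
       = (\<Sum>g\<in>perms (Suc p). ?G g * (\<Sum>x<Suc p. \<Sum>y<Suc p. ?X (g \<circ> \<tau> \<circ> swp x y))) - ?C * (\<Sum>x<Suc p. \<Sum>y<Suc p. ?X (\<tau> \<circ> swp x y))"
      unfolding f_def
      by (simp only: sum_subtractf sum_distrib_left sum.swap[of _ "perms (Suc p)" "{..<Suc p}"] comp_assoc)
    also have "\<dots> = (\<Sum>g\<in>perms (Suc p). ?G g * (?E * ?X (g \<circ> \<tau>))) - ?C * (?E * ?X \<tau>)"
    proof -
      have "(\<Sum>x<Suc p. \<Sum>y<Suc p. ?X (g \<circ> \<tau> \<circ> swp x y)) = ?E * ?X (g \<circ> \<tau>)" if "g \<in> perms (Suc p)" for g
        by (rule sum_chi_comp_swp, rule permutes_compose[OF \<tau>S]) (use that in simp)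
      then show ?thesis unfolding sum_chi_comp_swp[OF \<tau>S]
        by (intro arg_cong2[where f = "(-)"] sum.cong refl) (simp only:)
    qed
    also have "\<dots> = ?E * f \<tau>" by (simp add: f_def sum_distrib_left right_diff_distrib mult_ac)
    also have "\<dots> = 0" using zero[OF \<tau>] by simp
    finally have S: "(\<Sum>x<Suc p. \<Sum>y<Suc p. f (\<tau> \<circ> swp x y)) = 0" .
    have "(\<Sum>x<p. \<Sum>y<p. f (\<tau> \<circ> swp x y)) = 0"
      by (intro sum.neutral ballI zero permutes_compose[OF swp_permutes \<tau>]) auto
    moreover have "f (\<tau> \<circ> swp p p) = 0" using zero[OF \<tau>] by simp
    moreover have "(\<Sum>x<p. f (\<tau> \<circ> swp x p)) = (\<Sum>x<p. f (\<tau> \<circ> swp p x))" by (simp add: transpose_commute)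
    ultimately show "(\<Sum>y<p. f (\<tau> \<circ> swp p y)) = 0" using S unfolding sum_lessThan_Suc_square by linarith
  qed (use zero Suc.prems in auto)
  then show ?case by (simp only: f_def right_minus_eq)
qed

section \<open>Dimensions of shapes with one box added\<close>

lemma card_colorings_color:
  assumes i: "i < l" and x: "x < Suc p"
  shows "real (card {g \<in> colorings (Suc p) l \<alpha>. g x = i}) = tabl p l (\<alpha>(i := \<alpha> i - 1)) id"
proof -
  have sw: "swp x p permutes {..<Suc p}" using x by (intro swp_permutes) auto
  have "bij_betw (\<lambda>g. g \<circ> swp x p) {g \<in> colorings (Suc p) l \<alpha>. g x = i} {g \<in> colorings (Suc p) l \<alpha>. g p = i}"
    by (rule bij_betw_byWitness[where f' = "\<lambda>g. g \<circ> swp x p"])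
       (auto intro: colorings_comp_perm[OF sw])
  then show ?thesis
    using card_fixed_colorings_last[of id p i l \<alpha>] i by (simp add: bij_betw_same_card permutes_id)
qed

text \<open>Double count of the colourings of p + 1 points with a marked point of colour i; deleting
  the mark leaves p points. The identity also holds at \<alpha> i = -1, where both sides are
  zero.\<close>

lemma tabl_id_rec:
  assumes i: "i < l"
  shows "(of_int (\<alpha> i) + 1) * tabl (Suc p) l (\<alpha>(i := \<alpha> i + 1)) id = real (Suc p) * tabl p l \<alpha> id"
proof -
  let ?\<beta> = "\<alpha>(i := \<alpha> i + 1)"
  let ?S = "colorings (Suc p) l ?\<beta>"
  have "(\<Sum>x<Suc p. real (card {g \<in> ?S. g x = i})) = (\<Sum>x<Suc p. \<Sum>g\<in>?S. if g x = i then 1 else 0)"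
    by (simp only: real_of_card sum.inter_filter finite_colorings)
  also have "\<dots> = (\<Sum>g\<in>?S. \<Sum>x<Suc p. if g x = i then 1 else 0)" by (rule sum.swap)
  also have "\<dots> = (\<Sum>g\<in>?S. of_int (?\<beta> i))"
  proof (rule sum.cong[OF refl])
    fix g assume "g \<in> ?S"
    then have a: "int (card {x. x < Suc p \<and> g x = i}) = ?\<beta> i" using i unfolding colorings_def by blast
    have "(\<Sum>x<Suc p. if g x = i then 1 else (0::real)) = real (card {x \<in> {..<Suc p}. g x = i})"
      by (simp only: real_of_card sum.inter_filter finite_lessThan)
    also have "\<dots> = real_of_int (?\<beta> i)" by (simp only: a[symmetric] of_int_of_nat_eq lessThan_iff)
    finally show "(\<Sum>x<Suc p. if g x = i then 1 else 0) = real_of_int (?\<beta> i)" .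
  qed
  also have "\<dots> = (of_int (\<alpha> i) + 1) * tabl (Suc p) l ?\<beta> id" by (simp add: tabl_def)
  finally have 1: "(\<Sum>x<Suc p. real (card {g \<in> ?S. g x = i})) = \<dots>" .
  have 2: "(\<Sum>x<Suc p. real (card {g \<in> ?S. g x = i})) = (\<Sum>x<Suc p. tabl p l (?\<beta>(i := ?\<beta> i - 1)) id)"
    by (intro sum.cong refl card_colorings_color i) simp
  have "?\<beta>(i := ?\<beta> i - 1) = \<alpha>" by auto
  then show ?thesis unfolding 1[symmetric] 2 by simp
qed

text \<open>As long as w i + 1 is below l it is the value of w at some other k, and raising entry i
  makes entries i and k equal. The pair (i, w) then cancels against k together with w after
  exchanging i and k. Only the position with w i = l - 1 survives.\<close>

lemma shift_color:
  fixes Y :: "(nat \<Rightarrow> nat) \<Rightarrow> real" and h :: "nat \<Rightarrow> real"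
  assumes l: "0 < l"
  shows "(\<Sum>i<l. alternating_sum l (\<lambda>w. h (w i) * Y (w(i := Suc (w i)))))
       = alternating_sum l (\<lambda>w. h (l - 1) * Y (w(inv w (l - 1) := l)))"
proof -
  let ?f = "\<lambda>(i, w). of_int (sign w) * (h (w i) * Y (w(i := Suc (w i))))"
  let ?S = "{..<l} \<times> perms l"
  let ?A = "{x \<in> ?S. Suc (snd x (fst x)) < l}" and ?B = "{x \<in> ?S. Suc (snd x (fst x)) = l}"
  have "(\<Sum>i<l. alternating_sum l (\<lambda>w. h (w i) * Y (w(i := Suc (w i))))) = sum ?f ?S"
    by (simp add: alternating_sum_def sum.cartesian_product)
  also have "\<dots> = sum ?f (?A \<union> ?B)"
  proof (rule sum.cong[OF _ refl])
    have "Suc (w i) < l" if "i < l" "w permutes {..<l}" "Suc (w i) \<noteq> l" for i w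
      using permutes_bound[OF that(2,1)] that(3) by auto
    then show "?S = ?A \<union> ?B" by auto
  qed
  also have "\<dots> = sum ?f ?A + sum ?f ?B" by (rule sum.union_disjoint) auto
  also have "sum ?f ?A = 0"
  proof (rule sum_antisym_zero[of _ "\<lambda>(i, w). (inv w (Suc (w i)), w \<circ> swp i (inv w (Suc (w i))))"])
    fix x assume x0: "x \<in> ?A"
    obtain i w where x: "x = (i, w)" by (cases x)
    have i: "i < l" and w: "w permutes {..<l}" and c: "Suc (w i) < l" using x0 unfolding x by auto
    define k where "k = inv w (Suc (w i))"
    have wk: "w k = Suc (w i)" unfolding k_def using permutes_inverses(1)[OF w] by simp
    have kl: "k < l" unfolding k_def using permutes_bound[OF permutes_inv[OF w]] c by simp
    have ki: "k \<noteq> i" using wk by auto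
    have w': "w \<circ> swp i k permutes {..<l}" by (rule permutes_compose[OF swp_permutes w]) (use i kl in auto)
    have k2: "inv (w \<circ> swp i k) (Suc ((w \<circ> swp i k) k)) = i"
      using permutes_inv_eq[OF w', of "Suc ((w \<circ> swp i k) k)" i] wk by simp
    let ?x' = "(k, w \<circ> swp i k)"
    have hx: "(case x of (i, w) \<Rightarrow> (inv w (Suc (w i)), w \<circ> swp i (inv w (Suc (w i))))) = ?x'"
      using x k_def by simp
    show "(case x of (i, w) \<Rightarrow> (inv w (Suc (w i)), w \<circ> swp i (inv w (Suc (w i))))) \<in> ?A"
      unfolding hx using kl w' c by simp
    show "(case case x of (i, w) \<Rightarrow> (inv w (Suc (w i)), w \<circ> swp i (inv w (Suc (w i)))) of
         (i, w) \<Rightarrow> (inv w (Suc (w i)), w \<circ> swp i (inv w (Suc (w i))))) = x"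
      unfolding hx using k2 x by (simp add: transpose_commute[of k i])
    have "(w \<circ> swp i k)(k := Suc (w i)) = w(i := Suc (w i))"
      using wk ki by (auto simp: fun_eq_iff Transposition.transpose_def)
    then show "?f (case x of (i, w) \<Rightarrow> (inv w (Suc (w i)), w \<circ> swp i (inv w (Suc (w i))))) = - ?f x"
      unfolding hx using x sign_comp_swp[OF w ki[symmetric]] by simp
  qed
  also have "sum ?f ?B = alternating_sum l (\<lambda>w. h (l - 1) * Y (w(inv w (l - 1) := l)))"
    unfolding alternating_sum_def
  proof (rule sum.reindex_bij_witness[of _ "\<lambda>w. (inv w (l - 1), w)" snd], goal_cases)
    case (1 x)
    then have w: "snd x permutes {..<l}" and "snd x (fst x) = l - 1" by auto
    then have "inv (snd x) (l - 1) = fst x" using permutes_inv_eq[OF w] by simp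
    then show ?case by (simp add: prod_eq_iff)
  next
    case (4 w)
    then have w: "w permutes {..<l}" by simp
    have "inv w (l - 1) < l" "w (inv w (l - 1)) = l - 1"
      using permutes_bound[OF permutes_inv[OF w], of "l - 1"] permutes_inverses(1)[OF w] l by simp_all
    then show ?case using 4 l by simp
  next
    case (5 x)
    then have w: "snd x permutes {..<l}" and xl: "snd x (fst x) = l - 1" by auto
    then have "inv (snd x) (l - 1) = fst x" using permutes_inv_eq[OF w] by simp
    then show ?case using xl l by (simp add: case_prod_beta)
  qed auto
  finally show ?thesis by (simp only: add_0)
qed

context
  fixes l p :: nat and \<kappa> :: "nat \<Rightarrow> nat"
  assumes pl: "p < l" and \<kappa>: "\<kappa> \<in> part l p"
begin

lemma part_last_zero: "\<kappa> (l - 1) = 0"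
proof (rule ccontr)
  assume "\<kappa> (l - 1) \<noteq> 0"
  have "\<kappa> (Suc i) \<le> \<kappa> i" for i using \<kappa> by (simp add: part_def)
  then have mono: "\<kappa> j \<le> \<kappa> i" if "i \<le> j" for i j
    using that by (rule lift_Suc_antimono_le)
  have "1 \<le> \<kappa> i" if "i < l" for i using mono[of i "l - 1"] that \<open>\<kappa> (l - 1) \<noteq> 0\<close> by linarith
  then have "(\<Sum>i<l. 1) \<le> (\<Sum>i<l. \<kappa> i)" by (intro sum_mono) auto
  then show False using \<kappa> pl by (auto simp: part_def)
qed

text \<open>As p < l, the last row of \<kappa> is empty and its entry in \<open>beta\<close> is -(l
  - 1). Unless w (l - 1) = l - 1, the last fibre size is negative in both degrees. In the remaining
  case it rises from 0 to 1, so \<open>tabl_id_rec\<close> applies with left factor 1.\<close>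

lemma alternating_sum_shift_last:
  "alternating_sum l (\<lambda>w. c * tabl (Suc p) l (\<lambda>m. beta \<kappa> m + int ((w(inv w (l - 1) := l)) m)) id)
   = c * (real (Suc p) * chi p l (beta \<kappa>) id)"
proof -
  have l: "l - 1 < l" using pl by simp
  have b: "beta \<kappa> (l - 1) = - int (l - 1)" unfolding beta_def part_last_zero by simp
  have "tabl (Suc p) l (\<lambda>m. beta \<kappa> m + int ((w(inv w (l - 1) := l)) m)) id
      = real (Suc p) * tabl p l (\<lambda>m. beta \<kappa> m + int (w m)) id" if w: "w permutes {..<l}" for w
  proof (cases "w (l - 1) = l - 1")
    case True
    then have i: "inv w (l - 1) = l - 1" using permutes_inv_eq[OF w] by simp
    let ?\<alpha> = "\<lambda>m. beta \<kappa> m + int (w m)"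
    have \<alpha>0: "?\<alpha> (l - 1) = 0" using b True by simp
    have e: "(\<lambda>m. beta \<kappa> m + int ((w(l - 1 := l)) m)) = ?\<alpha>(l - 1 := ?\<alpha> (l - 1) + 1)"
      using b True l by (auto simp: fun_eq_iff of_nat_diff)
    show ?thesis unfolding i e using tabl_id_rec[OF l, of ?\<alpha> p] unfolding \<alpha>0 by simp
  next
    case False
    then have i: "inv w (l - 1) \<noteq> l - 1" using permutes_inv_eq[OF w] by metis
    have "w (l - 1) < l - 1" using False permutes_bound[OF w l] by simp
    then have neg: "beta \<kappa> (l - 1) + int (w (l - 1)) < 0" using b by simp
    have "tabl (Suc p) l (\<lambda>m. beta \<kappa> m + int ((w(inv w (l - 1) := l)) m)) id = 0"
      using i neg by (intro tabl_neg[OF l]) simp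
    moreover have "tabl p l (\<lambda>m. beta \<kappa> m + int (w m)) id = 0"
      using neg by (intro tabl_neg[OF l]) simp
    ultimately show ?thesis by simp
  qed
  then show ?thesis unfolding alternating_sum_def chi_def by (simp add: sum_distrib_left mult_ac)
qed

lemma sum_chi_id_add: "(\<Sum>i<l. chi (Suc p) l ((beta \<kappa>)(i := beta \<kappa> i + 1)) id) = real (Suc p) * chi p l (beta \<kappa>) id"
proof -
  have e: "((beta \<kappa>)(i := beta \<kappa> i + 1)) m + int (w m) = beta \<kappa> m + int ((w(i := Suc (w i))) m)" for i w m
    by auto
  have l: "0 < l" using pl by simp
  show ?thesis
    using shift_color[OF l, of "\<lambda>_. 1" "\<lambda>v. tabl (Suc p) l (\<lambda>m. beta \<kappa> m + int (v m)) id"]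
      alternating_sum_shift_last[of 1]
    unfolding chi_def e by simp
qed

text \<open>Weighted by dimension, the contents of the addable boxes average to zero. By
  \<open>tabl_id_rec\<close>, content times the raised term is (p + 1) times the unraised term minus
  w i + 1 times the raised one. Over all i the first part gives l (p + 1) times the dimension, and
  so does the second, because w i + 1 = l at the only position left by
  \<open>shift_color\<close>.\<close>

lemma sum_content_chi_id_add: "(\<Sum>i<l. of_int (beta \<kappa> i) * chi (Suc p) l ((beta \<kappa>)(i := beta \<kappa> i + 1)) id) = 0"
proof -
  let ?Z = "\<lambda>v. tabl (Suc p) l (\<lambda>m. beta \<kappa> m + int (v m)) id"
  have e: "((beta \<kappa>)(i := beta \<kappa> i + 1)) m + int (w m) = beta \<kappa> m + int ((w(i := Suc (w i))) m)" for i w m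
    by auto
  have l: "0 < l" using pl by simp
  have "of_int (beta \<kappa> i) * chi (Suc p) l ((beta \<kappa>)(i := beta \<kappa> i + 1)) id
     = real (Suc p) * chi p l (beta \<kappa>) id - alternating_sum l (\<lambda>w. real (Suc (w i)) * ?Z (w(i := Suc (w i))))"
    if i: "i < l" for i
  proof -
    have "of_int (beta \<kappa> i) * ?Z (w(i := Suc (w i))) + real (Suc (w i)) * ?Z (w(i := Suc (w i)))
       = real (Suc p) * tabl p l (\<lambda>m. beta \<kappa> m + int (w m)) id" for w
    proof -
      let ?\<alpha> = "\<lambda>m. beta \<kappa> m + int (w m)"
      have e': "(\<lambda>m. beta \<kappa> m + int ((w(i := Suc (w i))) m)) = ?\<alpha>(i := ?\<alpha> i + 1)" by auto
      show ?thesis unfolding e' using tabl_id_rec[OF i, of ?\<alpha> p] by (simp add: algebra_simps)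
    qed
    then have "alternating_sum l (\<lambda>w. of_int (beta \<kappa> i) * ?Z (w(i := Suc (w i)))) + alternating_sum l (\<lambda>w. real (Suc (w i)) * ?Z (w(i := Suc (w i))))
      = alternating_sum l (\<lambda>w. real (Suc p) * tabl p l (\<lambda>m. beta \<kappa> m + int (w m)) id)"
      unfolding alternating_sum_add[symmetric] by simp
    then show ?thesis unfolding alternating_sum_cmult chi_def e by simp
  qed
  then have "(\<Sum>i<l. of_int (beta \<kappa> i) * chi (Suc p) l ((beta \<kappa>)(i := beta \<kappa> i + 1)) id)
     = real l * (real (Suc p) * chi p l (beta \<kappa>) id) - (\<Sum>i<l. alternating_sum l (\<lambda>w. real (Suc (w i)) * ?Z (w(i := Suc (w i)))))"
    by (simp add: sum_subtractf)
  also have "\<dots> = 0"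
    using shift_color[OF l, of "\<lambda>c. real (Suc c)" ?Z] alternating_sum_shift_last[of "real l"] l by simp
  finally show ?thesis .
qed

end

text \<open>Partitions with a removable box correspond to smaller partitions with an addable box,
  and all other rows contribute zero. The weight \<open>c\<close> sees the content of the box; c = 1
  yields the branching sum and c = \<open>of_int\<close> the Jucys-Murphy sum.\<close>

lemma sum_part_boxes:
  fixes c :: "int \<Rightarrow> real"
  assumes \<tau>: "\<tau> permutes {..<p}"
  shows "(\<Sum>\<rho>\<in>part l (Suc p). chi (Suc p) l (beta \<rho>) id * (\<Sum>i<l. c (beta \<rho> i - 1) * chi p l ((beta \<rho>)(i := beta \<rho> i - 1)) \<tau>))
       = (\<Sum>\<kappa>\<in>part l p. chi p l (beta \<kappa>) \<tau> * (\<Sum>i<l. c (beta \<kappa> i) * chi (Suc p) l ((beta \<kappa>)(i := beta \<kappa> i + 1)) id))"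
proof -
  let ?R = "{x \<in> part l (Suc p) \<times> {..<l}. fst x (Suc (snd x)) < fst x (snd x)}"
  let ?A = "{x \<in> part l p \<times> {..<l}. snd x = 0 \<or> fst x (snd x) < fst x (snd x - 1)}"
  let ?f = "\<lambda>(\<rho>, i). chi (Suc p) l (beta \<rho>) id * (c (beta \<rho> i - 1) * chi p l ((beta \<rho>)(i := beta \<rho> i - 1)) \<tau>)"
  let ?g = "\<lambda>(\<kappa>, i). chi p l (beta \<kappa>) \<tau> * (c (beta \<kappa> i) * chi (Suc p) l ((beta \<kappa>)(i := beta \<kappa> i + 1)) id)"
  have fin: "finite (part l q \<times> {..<l})" for q by (simp add: finite_part)
  have "(\<Sum>\<rho>\<in>part l (Suc p). chi (Suc p) l (beta \<rho>) id * (\<Sum>i<l. c (beta \<rho> i - 1) * chi p l ((beta \<rho>)(i := beta \<rho> i - 1)) \<tau>))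
     = sum ?f (part l (Suc p) \<times> {..<l})" by (simp add: sum_distrib_left sum.cartesian_product)
  also have "\<dots> = sum ?f ?R"
  proof (rule sum.mono_neutral_right[OF fin])
    show "\<forall>x\<in>part l (Suc p) \<times> {..<l} - ?R. ?f x = 0"
    proof
      fix x assume x: "x \<in> part l (Suc p) \<times> {..<l} - ?R"
      obtain \<rho> i where xe: "x = (\<rho>, i)" by (cases x)
      have "chi p l ((beta \<rho>)(i := beta \<rho> i - 1)) \<tau> = 0"
        by (rule chi_remove_zero[OF \<tau>]) (use x xe in auto)
      then show "?f x = 0" unfolding xe by simp
    qed
  qed auto
  also have "\<dots> = sum ?g ?A"
  proof (rule sum.reindex_bij_witness[of _ "\<lambda>(\<kappa>, i). (\<kappa>(i := \<kappa> i + 1), i)" "\<lambda>(\<rho>, i). (\<rho>(i := \<rho> i - 1), i)"], goal_cases)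
    case (2 x)
    obtain \<rho> i where x: "x = (\<rho>, i)" by (cases x)
    have r: "\<rho> \<in> part l (Suc p)" and i: "i < l" "\<rho> (Suc i) < \<rho> i" using 2 x by auto
    have "i = 0 \<or> \<rho> i \<le> \<rho> (i - 1)" using r by (cases i) (auto simp: part_def)
    then show ?case using part_remove[OF r i] i unfolding x by (cases i) (auto simp del: fun_upd_apply simp: fun_upd_same fun_upd_other)
  next
    case (4 x)
    obtain \<rho> i where x: "x = (\<rho>, i)" by (cases x)
    have r: "\<rho> \<in> part l p" and i: "i < l" "i = 0 \<or> \<rho> i < \<rho> (i - 1)" using 4 x by auto
    have "\<rho> (Suc i) \<le> \<rho> i" using r by (auto simp: part_def)
    then show ?case using part_add[OF r i] i unfolding x by simp
  next
    case (5 x)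
    obtain \<rho> i where x: "x = (\<rho>, i)" by (cases x)
    have i: "\<rho> i > 0" using 5 x by auto
    have e: "(beta (\<rho>(i := \<rho> i - 1)))(i := beta (\<rho>(i := \<rho> i - 1)) i + 1) = beta \<rho>"
      using i by (auto simp: beta_def fun_eq_iff of_nat_diff)
    show ?case unfolding x using beta_remove[of \<rho> i, OF i] e by simp
  qed auto
  also have "\<dots> = sum ?g (part l p \<times> {..<l})"
  proof (rule sum.mono_neutral_left[OF fin])
    show "\<forall>x\<in>part l p \<times> {..<l} - ?A. ?g x = 0"
    proof
      fix x assume x: "x \<in> part l p \<times> {..<l} - ?A"
      obtain \<rho> i where xe: "x = (\<rho>, i)" by (cases x)
      have "chi (Suc p) l ((beta \<rho>)(i := beta \<rho> i + 1)) id = 0"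
        by (rule chi_add_zero[OF permutes_id]) (use x xe in auto)
      then show "?g x = 0" unfolding xe by simp
    qed
  qed auto
  finally show ?thesis by (simp add: sum_distrib_left sum.cartesian_product)
qed

text \<open>Decomposition of the regular character. The bound p \<le> l gives room for every
  partition of p, and for a new row in the induction step. The Jucys-Murphy condition holds because
  the contents of added boxes average to zero, in agreement with the fact that no
  \<open>\<tau> \<circ> swp p y\<close> is the identity.\<close>

theorem sum_part_chi:
  assumes "p \<le> l" and "\<sigma> permutes {..<p}"
  shows "(\<Sum>\<rho>\<in>part l p. chi p l (beta \<rho>) id * chi p l (beta \<rho>) \<sigma>) = (if \<sigma> = id then fact p else 0)"
  using assms
proof (induction p arbitrary: \<sigma>)
  case 0
  have part0: "part l 0 = {\<lambda>_. 0}" 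
  proof -
    have "\<rho> i = 0" if "\<rho> \<in> part l 0" for \<rho> i using that by (cases "i < l") (simp_all add: part_def)
    then have "part l 0 \<subseteq> {\<lambda>_. 0}" by blast
    moreover have "(\<lambda>_. 0) \<in> part l 0" by (simp add: part_def)
    ultimately show ?thesis by blast
  qed
  have chi0: "chi 0 l (beta (\<lambda>_. 0)) id = 1"
  proof -
    have t0: "tabl 0 l \<alpha> id = (if \<forall>i<l. \<alpha> i = 0 then 1 else 0)" for \<alpha>
    proof -
      have "colorings 0 l \<alpha> = (if \<forall>i<l. \<alpha> i = 0 then {\<lambda>_. undefined} else {})"
        by (auto simp: colorings_def)
      then show ?thesis by (simp add: tabl_def)
    qed
    have "(\<forall>i<l. beta (\<lambda>_. 0) i + int (w i) = 0) \<longleftrightarrow> w = id" if "w permutes {..<l}" for w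
    proof
      assume a: "\<forall>i<l. beta (\<lambda>_. 0) i + int (w i) = 0"
      have "w i = i" for i using a that by (cases "i < l") (auto simp: beta_def permutes_def)
      then show "w = id" by auto
    qed (auto simp: beta_def)
    then have "chi 0 l (beta (\<lambda>_. 0)) id = (\<Sum>w\<in>perms l. if w = id then 1 else 0)"
      unfolding chi_def alternating_sum_def t0 by (intro sum.cong refl) auto
    also have "\<dots> = 1" by (subst sum.delta) (auto simp: permutes_id)
    finally show ?thesis .
  qed
  have "\<sigma> = id" using 0 by simp
  moreover have sg: "sum F {a} = F a" for F :: "(nat \<Rightarrow> nat) \<Rightarrow> real" and a by simp
  ultimately show ?case unfolding part0 sg by (simp only: chi0) simp
next
  case (Suc p)
  let ?d = "\<lambda>\<rho>. chi (Suc p) l (beta \<rho>) id"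
  define f where "f = (\<lambda>\<sigma>. (\<Sum>\<rho>\<in>part l (Suc p). ?d \<rho> * chi (Suc p) l (beta \<rho>) \<sigma>) - (if \<sigma> = id then fact (Suc p) else 0))"
  have pl: "p < l" using Suc.prems by simp
  have "f \<sigma> = 0"
  proof (rule class_function_zero[of p f])
    fix \<sigma> \<pi> :: "nat \<Rightarrow> nat" assume "\<sigma> permutes {..<Suc p}" and \<pi>: "\<pi> permutes {..<Suc p}"
    have "\<pi> \<circ> \<sigma> \<circ> inv \<pi> = id \<longleftrightarrow> \<sigma> = id"
    proof
      assume "\<pi> \<circ> \<sigma> \<circ> inv \<pi> = id"
      then have "inv \<pi> \<circ> (\<pi> \<circ> \<sigma> \<circ> inv \<pi>) \<circ> \<pi> = id" using permutes_inv_o[OF \<pi>] by simp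
      then show "\<sigma> = id" using permutes_inverses[OF \<pi>] by (auto simp: fun_eq_iff)
    qed (use permutes_inv_o[OF \<pi>] in simp)
    then show "f (\<pi> \<circ> \<sigma> \<circ> inv \<pi>) = f \<sigma>" by (simp only: f_def chi_conj[OF \<pi>])
  next
    fix \<tau> assume \<tau>: "\<tau> permutes {..<p}"
    have "(\<Sum>\<rho>\<in>part l (Suc p). ?d \<rho> * chi (Suc p) l (beta \<rho>) \<tau>)
       = (\<Sum>\<kappa>\<in>part l p. chi p l (beta \<kappa>) \<tau> * (real (Suc p) * chi p l (beta \<kappa>) id))"
      using sum_part_boxes[OF \<tau>, where c = "\<lambda>_. 1"] by (simp add: chi_branch[OF \<tau>] sum_chi_id_add[OF pl])
    also have "\<dots> = real (Suc p) * (\<Sum>\<kappa>\<in>part l p. chi p l (beta \<kappa>) id * chi p l (beta \<kappa>) \<tau>)"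
      by (simp add: sum_distrib_left mult_ac)
    also have "\<dots> = real (Suc p) * (if \<tau> = id then fact p else 0)" by (simp only: Suc.IH[OF less_imp_le[OF pl] \<tau>])
    finally show "f \<tau> = 0" by (simp add: f_def)
    have "(\<Sum>y<p. \<Sum>\<rho>\<in>part l (Suc p). ?d \<rho> * chi (Suc p) l (beta \<rho>) (\<tau> \<circ> swp p y))
      = (\<Sum>\<rho>\<in>part l (Suc p). ?d \<rho> * (\<Sum>y<p. chi (Suc p) l (beta \<rho>) (\<tau> \<circ> swp p y)))"
      by (simp only: sum.swap[of _ "part l (Suc p)" "{..<p}"] sum_distrib_left)
    also have "\<dots> = (\<Sum>\<kappa>\<in>part l p. chi p l (beta \<kappa>) \<tau> * (\<Sum>i<l. of_int (beta \<kappa> i) * chi (Suc p) l ((beta \<kappa>)(i := beta \<kappa> i + 1)) id))"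
      using sum_part_boxes[OF \<tau>, where c = of_int] by (simp add: chi_jucys[OF \<tau>])
    also have "\<dots> = 0" by (simp add: sum_content_chi_id_add[OF pl])
    finally have 1: "(\<Sum>y<p. \<Sum>\<rho>\<in>part l (Suc p). ?d \<rho> * chi (Suc p) l (beta \<rho>) (\<tau> \<circ> swp p y)) = 0" .
    have "\<tau> \<circ> swp p y \<noteq> id" if "y < p" for y
    proof
      assume "\<tau> \<circ> swp p y = id"
      then have "(\<tau> \<circ> swp p y) p = p" by simp
      then show False using permutes_bound[OF \<tau> that] by simp
    qed
    then have "f (\<tau> \<circ> swp p y) = (\<Sum>\<rho>\<in>part l (Suc p). ?d \<rho> * chi (Suc p) l (beta \<rho>) (\<tau> \<circ> swp p y))" if "y < p" for y
      using that unfolding f_def by simp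
    then show "(\<Sum>y<p. f (\<tau> \<circ> swp p y)) = 0" using 1 by simp
  qed (rule Suc.prems)
  then show ?case by (simp only: f_def right_minus_eq)
qed

section \<open>Comparison with partitions as lists\<close>

lemma tabl_pad:
  assumes "\<alpha> l = 0" shows "tabl p (Suc l) \<alpha> \<sigma> = tabl p l \<alpha> \<sigma>"
proof -
  have "colorings p (Suc l) \<alpha> = colorings p l \<alpha>"
  proof
    show "colorings p (Suc l) \<alpha> \<subseteq> colorings p l \<alpha>"
    proof
      fix g assume g: "g \<in> colorings p (Suc l) \<alpha>"
      then have "int (card {x. x < p \<and> g x = l}) = \<alpha> l" unfolding colorings_def by blast
      then have "{x. x < p \<and> g x = l} = {}" using assms by simp
      then have "g x \<noteq> l" if "x < p" for x using that by blast
      then have "g \<in> {..<p} \<rightarrow>\<^sub>E {..<l}" using g by (force simp: colorings_def PiE_iff less_Suc_eq)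
      then show "g \<in> colorings p l \<alpha>" using g by (simp add: colorings_def)
    qed
    show "colorings p l \<alpha> \<subseteq> colorings p (Suc l) \<alpha>"
    proof
      fix g assume g: "g \<in> colorings p l \<alpha>"
      then have "g x < l" if "x < p" for x using that by (auto simp: colorings_def)
      then have "{x. x < p \<and> g x = l} = {}" by (auto dest: less_imp_neq)
      then have "int (card {x. x < p \<and> g x = l}) = \<alpha> l" using assms by (simp only: card.empty)
      then show "g \<in> colorings p (Suc l) \<alpha>" using g by (auto simp: colorings_def PiE_iff less_Suc_eq)
    qed
  qed
  then show ?thesis by (simp add: tabl_def)
qed

lemma chi_pad:
  assumes b: "b l = - int l" shows "chi p (Suc l) b \<sigma> = chi p l b \<sigma>"
proof -
  let ?F = "\<lambda>w. of_int (sign w) * tabl p (Suc l) (\<lambda>i. b i + int (w i)) \<sigma>"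
  have "chi p (Suc l) b \<sigma> = (\<Sum>h\<in>perms l. ?F h + (\<Sum>y<l. ?F (swp l y \<circ> h)))"
    unfolding chi_def alternating_sum_def by (rule sum_perms_Suc)
  also have "\<dots> = (\<Sum>h\<in>perms l. of_int (sign h) * tabl p l (\<lambda>i. b i + int (h i)) \<sigma>)"
  proof (rule sum.cong[OF refl])
    fix h assume "h \<in> perms l"
    then have hl: "h l = l" by (auto simp: permutes_def)
    have "?F (swp l y \<circ> h) = 0" if "y < l" for y
      using that b hl by (simp add: tabl_neg[of l])
    then have "(\<Sum>y<l. ?F (swp l y \<circ> h)) = 0" by (intro sum.neutral ballI) (simp only: lessThan_iff)
    moreover have "tabl p (Suc l) (\<lambda>i. b i + int (h i)) \<sigma> = tabl p l (\<lambda>i. b i + int (h i)) \<sigma>"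
      using b hl by (intro tabl_pad) simp
    ultimately show "?F h + (\<Sum>y<l. ?F (swp l y \<circ> h)) = of_int (sign h) * tabl p l (\<lambda>i. b i + int (h i)) \<sigma>" by (simp only: add_0_right)
  qed
  finally show ?thesis by (simp only: chi_def alternating_sum_def)
qed

definition pad :: "nat list \<Rightarrow> nat \<Rightarrow> nat" where
  "pad r i = (if i < length r then r ! i else 0)"

lemma partitions_of_length: "r \<in> partitions_of p \<Longrightarrow> length r \<le> p"
proof -
  assume r: "r \<in> partitions_of p"
  then have "\<forall>x\<in>set r. 1 \<le> x" by (auto simp: partitions_of_def Suc_le_eq intro: gr0I)
  then have "length r \<le> sum_list r" by (induction r) auto
  then show ?thesis using r by (simp add: partitions_of_def)
qed

lemma chi_pad_le:
  assumes "length r \<le> l" shows "chi p l (beta (pad r)) \<sigma> = chi p (length r) (beta (pad r)) \<sigma>"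
  using assms
proof (induction l rule: dec_induct)
  case (step l)
  have "beta (pad r) l = - int l" using step.hyps by (simp add: beta_def pad_def)
  then show ?case using step.IH by (simp add: chi_pad)
qed simp

lemma irr_char_eq_chi:
  assumes "r \<in> partitions_of p" "p \<le> l"
  shows "real_of_int (irr_char p r \<sigma>) = chi p l (beta (pad r)) \<sigma>"
proof -
  have "length r \<le> l" using partitions_of_length[OF assms(1)] assms(2) by simp
  then have "chi p l (beta (pad r)) \<sigma> = chi p (length r) (beta (pad r)) \<sigma>" by (rule chi_pad_le)
  also have "\<dots> = real_of_int (irr_char p r \<sigma>)"
  proof -
    have "{g \<in> colorings p (length r) (\<lambda>i. beta (pad r) i + int (w i)). \<forall>x<p. g (\<sigma> x) = g x}
      = {g\<in>{..<p} \<rightarrow>\<^sub>E {..<length r}. (\<forall>x<p. g (\<sigma> x) = g x) \<and>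
              (\<forall>i<length r. int (card {x. x < p \<and> g x = i}) = int (r ! i) - int i + int (w i))}" for w
      by (auto simp: colorings_def beta_def pad_def)
    then show ?thesis unfolding chi_def alternating_sum_def tabl_def irr_char_def by simp
  qed
  finally show ?thesis ..
qed

lemma Cpoly_eq_content_prod:
  assumes "r \<in> partitions_of p" "p \<le> l"
  shows "real_of_int (Cpoly r N) = content_prod l (real N) (pad r)"
proof -
  have "length r \<le> l" using partitions_of_length[OF assms(1)] assms(2) by simp
  then have "content_prod l (real N) (pad r) = (\<Prod>i<length r. \<Prod>j<pad r i. real N + real j - real i)"
    unfolding content_prod_def by (intro prod.mono_neutral_right) (auto simp: pad_def)
  also have "\<dots> = real_of_int (Cpoly r N)" by (simp add: Cpoly_def pad_def)
  finally show ?thesis ..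
qed

lemma bij_betw_pad:
  assumes pl: "p \<le> l" shows "bij_betw pad (partitions_of p) (part l p)"
  unfolding bij_betw_def
proof
  show "inj_on pad (partitions_of p)"
  proof
    fix r r' assume r: "r \<in> partitions_of p" "r' \<in> partitions_of p" and e: "pad r = pad r'"
    have pos: "pad s i > 0 \<longleftrightarrow> i < length s" if "s \<in> partitions_of p" for s i
      using that by (auto simp: pad_def partitions_of_def intro!: gr0I) (metis nth_mem)
    have len: "length r = length r'"
      using pos[OF r(1)] pos[OF r(2)] unfolding e by (metis nat_neq_iff)
    show "r = r'"
    proof (rule nth_equalityI[OF len])
      fix i assume "i < length r"
      then show "r ! i = r' ! i" using fun_cong[OF e, of i] len by (simp add: pad_def)
    qed
  qed
  show "pad ` partitions_of p = part l p"
  proof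
    show "pad ` partitions_of p \<subseteq> part l p"
    proof (rule image_subsetI)
      fix r assume r: "r \<in> partitions_of p"
      have len: "length r \<le> l" using partitions_of_length[OF r] pl by simp
      have s: "sorted_wrt (\<ge>) r" using r by (simp add: partitions_of_def)
      have dec: "pad r (Suc i) \<le> pad r i" for i
        using sorted_wrt_nth_less[OF s, of i "Suc i"] by (simp add: pad_def)
      have "(\<Sum>i<l. pad r i) = (\<Sum>i<length r. pad r i)"
        using len by (intro sum.mono_neutral_right) (auto simp: pad_def)
      also have "\<dots> = sum_list r" by (simp add: sum_list_sum_nth pad_def atLeast0LessThan)
      finally have "(\<Sum>i<l. pad r i) = p" using r by (simp add: partitions_of_def)
      then show "pad r \<in> part l p" using dec len by (simp add: part_def) (simp add: pad_def)
    qed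
    show "part l p \<subseteq> pad ` partitions_of p"
    proof
      fix \<rho> assume \<rho>: "\<rho> \<in> part l p"
      have "\<rho> (Suc i) \<le> \<rho> i" for i using \<rho> by (simp add: part_def)
      then have mono: "\<rho> j \<le> \<rho> i" if "i \<le> j" for i j using that by (rule lift_Suc_antimono_le)
      define m where "m = (LEAST i. \<rho> i = 0)"
      have \<rho>l: "\<rho> l = 0" using \<rho> by (simp add: part_def)
      have m0: "\<rho> m = 0" unfolding m_def using \<rho>l by (rule LeastI)
      have ml: "m \<le> l" unfolding m_def using \<rho>l by (rule Least_le)
      have mz: "\<rho> i = 0" if "m \<le> i" for i using mono[OF that] m0 by simp
      have mp: "\<rho> i > 0" if "i < m" for i using not_less_Least[of i "\<lambda>i. \<rho> i = 0"] that unfolding m_def by auto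
      define r where "r = map \<rho> [0..<m]"
      have pr: "pad r = \<rho>" using mz by (auto simp: pad_def r_def fun_eq_iff)
      have "sum_list r = (\<Sum>i<m. \<rho> i)" by (simp add: r_def sum_list_sum_nth atLeast0LessThan)
      also have "\<dots> = (\<Sum>i<l. \<rho> i)" using ml mz by (intro sum.mono_neutral_left) auto
      also have "\<dots> = p" using \<rho> by (simp add: part_def)
      finally have "sum_list r = p" .
      moreover have "0 \<notin> set r" using mp by (fastforce simp: r_def)
      moreover have "sorted_wrt (\<ge>) r" by (auto simp: r_def sorted_wrt_iff_nth_less intro: mono)
      ultimately have "r \<in> partitions_of p" by (simp add: partitions_of_def)
      then show "\<rho> \<in> pad ` partitions_of p" using pr by blast
    qed
  qed
qed

lemma Wg_eq:
  "Wg N p \<sigma> = (\<Sum>\<rho>\<in>{\<rho> \<in> part p p. content_prod p (real N) \<rho> \<noteq> 0}.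
     chi p p (beta \<rho>) id * chi p p (beta \<rho>) \<sigma> / content_prod p (real N) \<rho>) / fact p"
proof -
  let ?g = "\<lambda>\<rho>. chi p p (beta \<rho>) id * chi p p (beta \<rho>) \<sigma> / content_prod p (real N) \<rho>"
  let ?S = "{r \<in> partitions_of p. Cpoly r N \<noteq> 0}"
  have C: "real_of_int (Cpoly r N) = content_prod p (real N) (pad r)" if "r \<in> partitions_of p" for r
    using Cpoly_eq_content_prod[OF that] by simp
  have C0: "Cpoly r N \<noteq> 0 \<longleftrightarrow> content_prod p (real N) (pad r) \<noteq> 0" if "r \<in> partitions_of p" for r
    unfolding C[OF that, symmetric] by simp
  have inj: "inj_on pad (partitions_of p)" and im: "pad ` partitions_of p = part p p"
    using bij_betw_pad[of p p] by (simp_all add: bij_betw_def)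
  have "inj_on pad ?S" by (rule inj_on_subset[OF inj]) auto
  moreover have "pad ` ?S = {\<rho> \<in> part p p. content_prod p (real N) \<rho> \<noteq> 0}"
    unfolding im[symmetric] using C0 by auto
  ultimately have "bij_betw pad ?S {\<rho> \<in> part p p. content_prod p (real N) \<rho> \<noteq> 0}"
    by (simp only: bij_betw_def)
  then have "(\<Sum>\<rho>\<in>{\<rho> \<in> part p p. content_prod p (real N) \<rho> \<noteq> 0}. ?g \<rho>) = (\<Sum>r\<in>?S. ?g (pad r))"
    by (rule sum.reindex_bij_betw[symmetric])
  also have "\<dots> = (\<Sum>r\<in>?S. real_of_int (irr_char p r id) * real_of_int (irr_char p r \<sigma>) / real_of_int (Cpoly r N))"
    by (intro sum.cong refl) (simp only: mem_Collect_eq irr_char_eq_chi[OF _ order_refl] C)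
  finally show ?thesis by (simp only: Wg_def) simp
qed

text \<open>The Weingarten function inverts the Gram matrix of the permutation operators up to its kernel.\<close>
lemma sum_Wg_fixc:
  fixes A :: "'a set" and N p :: nat
  assumes A: "finite A" "card A = N"
  defines "E \<equiv> \<lambda>\<sigma>. (if \<sigma> = id then 1 else 0) - (\<Sum>\<tau>\<in>perms p. Wg N p (inv \<sigma> \<circ> \<tau>) * fixc A p \<tau>)"
  assumes z: "z permutes {..<p}"
  shows "(\<Sum>g\<in>perms p. fixc A p g * E (g \<circ> z)) = 0"
proof -
  let ?C = "content_prod p (real N)" and ?X = "\<lambda>\<rho>. chi p p (beta \<rho>)"
  let ?P = "{\<rho> \<in> part p p. ?C \<rho> \<noteq> 0}" and ?Q = "{\<rho> \<in> part p p. ?C \<rho> = 0}"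
  have conv: "(\<Sum>g\<in>perms p. fixc A p g * ?X \<rho> (g \<circ> z)) = ?C \<rho> * ?X \<rho> z"
    if "\<rho> \<in> part p p" "z permutes {..<p}" for \<rho> z
    using sum_fixc_chi[OF A(1) that] A(2) by simp
  \<comment> \<open>\<open>E\<close> is the part of the delta function carried by the characters
    that \<open>Wg\<close> leaves out; on the others, the factor from the convolution cancels the
    denominator in \<open>Wg\<close>.\<close>
  have E: "E \<sigma> = (\<Sum>\<rho>\<in>?Q. ?X \<rho> id * ?X \<rho> \<sigma>) / fact p" if \<sigma>: "\<sigma> permutes {..<p}" for \<sigma>
  proof -
    have sw: "?X \<rho> (inv \<sigma> \<circ> \<tau>) = ?X \<rho> (\<tau> \<circ> inv \<sigma>)" for \<rho> \<tau>
    proof -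
      have "\<sigma> \<circ> (inv \<sigma> \<circ> \<tau>) \<circ> inv \<sigma> = \<tau> \<circ> inv \<sigma>" using permutes_inverses[OF \<sigma>] by (auto simp: fun_eq_iff)
      then show ?thesis using chi_conj[OF \<sigma>, of p "beta \<rho>" "inv \<sigma> \<circ> \<tau>"] by simp
    qed
    have "(\<Sum>\<tau>\<in>perms p. Wg N p (inv \<sigma> \<circ> \<tau>) * fixc A p \<tau>)
       = (\<Sum>\<tau>\<in>perms p. \<Sum>\<rho>\<in>?P. ?X \<rho> id / ?C \<rho> / fact p * (fixc A p \<tau> * ?X \<rho> (\<tau> \<circ> inv \<sigma>)))"
      unfolding Wg_eq sw by (intro sum.cong refl) (simp add: sum_distrib_right sum_distrib_left sum_divide_distrib mult_ac)
    also have "\<dots> = (\<Sum>\<rho>\<in>?P. ?X \<rho> id / ?C \<rho> / fact p * (\<Sum>\<tau>\<in>perms p. fixc A p \<tau> * ?X \<rho> (\<tau> \<circ> inv \<sigma>)))"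
      by (subst sum.swap) (simp only: sum_distrib_left)
    also have "\<dots> = (\<Sum>\<rho>\<in>?P. ?X \<rho> id * ?X \<rho> \<sigma> / fact p)"
    proof (rule sum.cong[OF refl])
      fix \<rho> assume r: "\<rho> \<in> ?P"
      have "(\<Sum>\<tau>\<in>perms p. fixc A p \<tau> * ?X \<rho> (\<tau> \<circ> inv \<sigma>)) = ?C \<rho> * ?X \<rho> \<sigma>"
        using conv[of \<rho> "inv \<sigma>"] r \<sigma> by (simp only: permutes_inv chi_inv mem_Collect_eq)
      then show "?X \<rho> id / ?C \<rho> / fact p * (\<Sum>\<tau>\<in>perms p. fixc A p \<tau> * ?X \<rho> (\<tau> \<circ> inv \<sigma>)) = ?X \<rho> id * ?X \<rho> \<sigma> / fact p"
        using r by (simp only: mem_Collect_eq) (simp add: field_simps)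
    qed
    finally have 1: "(\<Sum>\<tau>\<in>perms p. Wg N p (inv \<sigma> \<circ> \<tau>) * fixc A p \<tau>) = (\<Sum>\<rho>\<in>?P. ?X \<rho> id * ?X \<rho> \<sigma>) / fact p"
      by (simp only: sum_divide_distrib)
    have u: "part p p = ?P \<union> ?Q" by auto
    have "(\<Sum>\<rho>\<in>part p p. ?X \<rho> id * ?X \<rho> \<sigma>) = (\<Sum>\<rho>\<in>?P. ?X \<rho> id * ?X \<rho> \<sigma>) + (\<Sum>\<rho>\<in>?Q. ?X \<rho> id * ?X \<rho> \<sigma>)"
      by (subst u, rule sum.union_disjoint) (auto simp: finite_part)
    then have "(\<Sum>\<rho>\<in>?P. ?X \<rho> id * ?X \<rho> \<sigma>) + (\<Sum>\<rho>\<in>?Q. ?X \<rho> id * ?X \<rho> \<sigma>) = (if \<sigma> = id then fact p else 0)"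
      using sum_part_chi[OF order_refl \<sigma>] by simp
    then show ?thesis unfolding E_def 1 by (simp add: field_simps split: if_splits)
  qed
  have "(\<Sum>g\<in>perms p. fixc A p g * E (g \<circ> z)) = (\<Sum>g\<in>perms p. \<Sum>\<rho>\<in>?Q. ?X \<rho> id / fact p * (fixc A p g * ?X \<rho> (g \<circ> z)))"
  proof (rule sum.cong[OF refl])
    fix g assume "g \<in> perms p"
    then have "E (g \<circ> z) = (\<Sum>\<rho>\<in>?Q. ?X \<rho> id * ?X \<rho> (g \<circ> z)) / fact p" using z by (intro E permutes_compose) auto
    then show "fixc A p g * E (g \<circ> z) = (\<Sum>\<rho>\<in>?Q. ?X \<rho> id / fact p * (fixc A p g * ?X \<rho> (g \<circ> z)))"
      by (simp add: sum_divide_distrib sum_distrib_left mult_ac)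
  qed
  also have "\<dots> = (\<Sum>\<rho>\<in>?Q. ?X \<rho> id / fact p * (\<Sum>g\<in>perms p. fixc A p g * ?X \<rho> (g \<circ> z)))"
    by (subst sum.swap) (simp only: sum_distrib_left)
  also have "\<dots> = 0"
    by (intro sum.neutral ballI) (use conv[OF _ z] in simp)
  finally show ?thesis .
qed

section \<open>Operators commuting with tensor powers\<close>

definition site :: "'a set \<Rightarrow> ('a \<Rightarrow> 'a \<Rightarrow> complex) \<Rightarrow> nat \<Rightarrow> ((nat \<Rightarrow> 'a) \<Rightarrow> complex) \<Rightarrow> (nat \<Rightarrow> 'a) \<Rightarrow> complex" where
  "site A X s \<phi> a = (\<Sum>\<beta>\<in>A. X (a s) \<beta> * \<phi> (a(s := \<beta>)))"

definition matprod :: "'a set \<Rightarrow> ('a \<Rightarrow> 'a \<Rightarrow> complex) \<Rightarrow> ('a \<Rightarrow> 'a \<Rightarrow> complex) \<Rightarrow> 'a \<Rightarrow> 'a \<Rightarrow> complex" where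
  "matprod A X Y x y = (\<Sum>c\<in>A. X x c * Y c y)"

text \<open>The Lie algebra action of \<open>X\<close> on the tensor power: \<open>X\<close> at one
  site, summed over the sites.\<close>

definition deriv_op :: "'a set \<Rightarrow> nat set \<Rightarrow> ('a \<Rightarrow> 'a \<Rightarrow> complex) \<Rightarrow> ((nat \<Rightarrow> 'a) \<Rightarrow> complex) \<Rightarrow> (nat \<Rightarrow> 'a) \<Rightarrow> complex" where
  "deriv_op A S X \<phi> a = (\<Sum>s\<in>S. site A X s \<phi> a)"

text \<open>The matrices of the list are placed at pairwise distinct sites in all possible ways;
  removing the used site from \<open>S\<close> enforces distinctness.\<close>

fun symop :: "'a set \<Rightarrow> ('a \<Rightarrow> 'a \<Rightarrow> complex) list \<Rightarrow> nat set \<Rightarrow> ((nat \<Rightarrow> 'a) \<Rightarrow> complex) \<Rightarrow> (nat \<Rightarrow> 'a) \<Rightarrow> complex" where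
  "symop A [] S \<phi> a = \<phi> a"
| "symop A (X # zs) S \<phi> a = (\<Sum>s\<in>S. site A X s (symop A zs (S - {s}) \<phi>) a)"

lemma site_sum: "site A X s (\<lambda>a. \<Sum>i\<in>I. \<phi> i a) a = (\<Sum>i\<in>I. site A X s (\<phi> i) a)"
  unfolding site_def by (subst sum.swap) (simp add: sum_distrib_left)

lemma site_add: "site A X s (\<lambda>a. \<phi> a + \<psi> a) a = site A X s \<phi> a + site A X s \<psi> a"
  unfolding site_def by (simp add: distrib_left sum.distrib)

lemma site_same: "site A X s (site A Y s \<phi>) a = site A (matprod A X Y) s \<phi> a"
  unfolding site_def matprod_def
  by (simp add: sum_distrib_left sum_distrib_right mult.assoc) (rule sum.swap)

lemma site_commute:
  assumes "s \<noteq> t" shows "site A X s (site A Y t \<phi>) a = site A Y t (site A X s \<phi>) a"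
proof -
  have "a(s := \<beta>, t := \<gamma>) = a(t := \<gamma>, s := \<beta>)" for \<beta> \<gamma> using assms by auto
  then show ?thesis using assms unfolding site_def
    by (simp add: sum_distrib_left mult_ac) (rule sum.swap)
qed

lemma site_cong_fun: "(\<And>b. \<phi> b = \<psi> b) \<Longrightarrow> site A X s \<phi> a = site A X s \<psi> a"
  by (simp add: site_def)

lemma deriv_op_symop:
  assumes "finite S"
  shows "deriv_op A S X (symop A zs S \<phi>) a
     = symop A (X # zs) S \<phi> a + (\<Sum>r<length zs. symop A (zs[r := matprod A X (zs ! r)]) S \<phi> a)"
  using assms
proof (induction zs arbitrary: S a)
  case Nil
  then show ?case by (simp add: deriv_op_def site_def)
next
  case (Cons Y zs)
  let ?\<psi> = "\<lambda>t. symop A zs (S - {t}) \<phi>"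
  have "deriv_op A S X (symop A (Y # zs) S \<phi>) a = (\<Sum>s\<in>S. \<Sum>t\<in>S. site A X s (site A Y t (?\<psi> t)) a)"
    unfolding deriv_op_def symop.simps site_sum ..
  also have "\<dots> = (\<Sum>t\<in>S. \<Sum>s\<in>S. site A X s (site A Y t (?\<psi> t)) a)" by (rule sum.swap)
  also have "\<dots> = (\<Sum>t\<in>S. site A (matprod A X Y) t (?\<psi> t) a + site A Y t (deriv_op A (S - {t}) X (?\<psi> t)) a)"
  proof (rule sum.cong[OF refl])
    fix t assume t: "t \<in> S"
    have "(\<Sum>s\<in>S. site A X s (site A Y t (?\<psi> t)) a)
       = site A X t (site A Y t (?\<psi> t)) a + (\<Sum>s\<in>S - {t}. site A X s (site A Y t (?\<psi> t)) a)"
      by (rule sum.remove[OF Cons.prems t])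
    also have "(\<Sum>s\<in>S - {t}. site A X s (site A Y t (?\<psi> t)) a) = (\<Sum>s\<in>S - {t}. site A Y t (site A X s (?\<psi> t)) a)"
      by (intro sum.cong refl site_commute) auto
    also have "\<dots> = site A Y t (deriv_op A (S - {t}) X (?\<psi> t)) a"
      unfolding deriv_op_def site_sum ..
    finally show "(\<Sum>s\<in>S. site A X s (site A Y t (?\<psi> t)) a)
      = site A (matprod A X Y) t (?\<psi> t) a + site A Y t (deriv_op A (S - {t}) X (?\<psi> t)) a"
      by (simp only: site_same)
  qed
  also have "\<dots> = symop A (matprod A X Y # zs) S \<phi> a + (\<Sum>t\<in>S. site A Y t (symop A (X # zs) (S - {t}) \<phi>) a)
     + (\<Sum>t\<in>S. \<Sum>r<length zs. site A Y t (symop A (zs[r := matprod A X (zs ! r)]) (S - {t}) \<phi>) a)"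
  proof -
    have "deriv_op A (S - {t}) X (?\<psi> t) = (\<lambda>b. symop A (X # zs) (S - {t}) \<phi> b
       + (\<Sum>r<length zs. symop A (zs[r := matprod A X (zs ! r)]) (S - {t}) \<phi> b))" for t
      using Cons.IH[of "S - {t}"] Cons.prems by (intro ext) simp
    then show ?thesis by (simp only: site_add site_sum sum.distrib symop.simps(2)[of A "matprod A X Y" zs S \<phi> a] add.assoc)
  qed
  also have "(\<Sum>t\<in>S. site A Y t (symop A (X # zs) (S - {t}) \<phi>) a) = symop A (X # Y # zs) S \<phi> a"
  proof -
    have off_diag: "(\<Sum>s\<in>S - {t}. f s) = (\<Sum>s\<in>S. if s \<noteq> t then f s else 0)" for f :: "nat \<Rightarrow> complex" and t
      unfolding sum.inter_filter[OF Cons.prems, symmetric] by (rule sum.cong) auto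
    have "(\<Sum>t\<in>S. site A Y t (symop A (X # zs) (S - {t}) \<phi>) a)
      = (\<Sum>t\<in>S. \<Sum>s\<in>S - {t}. site A X s (site A Y t (symop A zs (S - {t} - {s}) \<phi>)) a)"
      unfolding symop.simps site_sum by (intro sum.cong refl site_commute) auto
    also have "\<dots> = (\<Sum>t\<in>S. \<Sum>s\<in>S. if s \<noteq> t then site A X s (site A Y t (symop A zs (S - {t} - {s}) \<phi>)) a else 0)"
      by (simp only: off_diag)
    also have "\<dots> = (\<Sum>s\<in>S. \<Sum>t\<in>S. if s \<noteq> t then site A X s (site A Y t (symop A zs (S - {t} - {s}) \<phi>)) a else 0)"
      by (rule sum.swap)
    also have "\<dots> = (\<Sum>s\<in>S. \<Sum>t\<in>S. if t \<noteq> s then site A X s (site A Y t (symop A zs (S - {s} - {t}) \<phi>)) a else 0)"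
    proof (intro sum.cong refl)
      fix s t
      have "S - {t} - {s} = S - {s} - {t}" by blast
      then show "(if s \<noteq> t then site A X s (site A Y t (symop A zs (S - {t} - {s}) \<phi>)) a else 0)
        = (if t \<noteq> s then site A X s (site A Y t (symop A zs (S - {s} - {t}) \<phi>)) a else 0)"
        by (simp add: eq_commute)
    qed
    also have "\<dots> = symop A (X # Y # zs) S \<phi> a"
      unfolding symop.simps site_sum
      by (simp only: off_diag)
    finally show ?thesis .
  qed
  also have "(\<Sum>t\<in>S. \<Sum>r<length zs. site A Y t (symop A (zs[r := matprod A X (zs ! r)]) (S - {t}) \<phi>) a)
     = (\<Sum>r<length zs. symop A ((Y # zs)[Suc r := matprod A X ((Y # zs) ! Suc r)]) S \<phi> a)"
    by (subst sum.swap) simp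
  finally show ?case
    unfolding length_Cons sum.lessThan_Suc_shift by (simp add: add_ac del: symop.simps)
qed

lemma pderiv_sum: "pderiv (\<Sum>i\<in>I. f i) = (\<Sum>i\<in>I. pderiv (f i))"
  by (induction I rule: infinite_finite_induct) (simp_all add: pderiv_add)

locale kernel_on_words =
  fixes A :: "'a set" and p :: nat and T :: "(nat \<Rightarrow> 'a) \<Rightarrow> (nat \<Rightarrow> 'a) \<Rightarrow> complex"
  assumes finA: "finite A"
begin

abbreviation words :: "(nat \<Rightarrow> 'a) set" where
  "words \<equiv> {..<p} \<rightarrow>\<^sub>E A"

lemma finite_words [simp]: "finite words"
  using finA by (simp add: finite_PiE)

definition op :: "((nat \<Rightarrow> 'a) \<Rightarrow> complex) \<Rightarrow> (nat \<Rightarrow> 'a) \<Rightarrow> complex" where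
  "op \<phi> a = (\<Sum>b\<in>words. T a b * \<phi> b)"

definition commutes :: "(((nat \<Rightarrow> 'a) \<Rightarrow> complex) \<Rightarrow> (nat \<Rightarrow> 'a) \<Rightarrow> complex) \<Rightarrow> bool" where
  "commutes F \<longleftrightarrow> (\<forall>a\<in>words. \<forall>\<phi>. op (F \<phi>) a = F (op \<phi>) a)"

lemma words_upd: "a \<in> words \<Longrightarrow> s < p \<Longrightarrow> \<beta> \<in> A \<Longrightarrow> a(s := \<beta>) \<in> words"
  by (auto simp: PiE_iff extensional_def)

lemma deriv_op_cong:
  assumes "\<And>b. b \<in> words \<Longrightarrow> \<phi> b = \<psi> b" "a \<in> words"
  shows "deriv_op A {..<p} X \<phi> a = deriv_op A {..<p} X \<psi> a"
  unfolding deriv_op_def site_def using assms words_upd by (intro sum.cong refl) simp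

lemma op_add: "op (\<lambda>a. \<phi> a + \<psi> a) a = op \<phi> a + op \<psi> a"
  by (simp add: op_def distrib_left sum.distrib)

lemma op_sum: "op (\<lambda>a. \<Sum>i\<in>I. \<phi> i a) a = (\<Sum>i\<in>I. op (\<phi> i) a)"
  unfolding op_def by (subst sum.swap) (simp add: sum_distrib_left)

lemma op_cmult: "op (\<lambda>a. c * \<phi> a) a = c * op \<phi> a"
  by (simp add: op_def sum_distrib_left mult_ac)

text \<open>\<open>deriv_op_symop\<close> solved for its longest term: one more matrix costs one
  derivation, minus terms whose lists are no longer than before.\<close>

lemma commutes_symop:
  assumes D: "\<And>X. commutes (deriv_op A {..<p} X)"
  shows "commutes (symop A zs {..<p})"
proof (induction "length zs" arbitrary: zs)
  case 0
  then show ?case by (simp add: commutes_def)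
next
  case (Suc m)
  then obtain X ys where zs: "zs = X # ys" and m: "length ys = m" by (cases zs) auto
  let ?S = "symop A" and ?m = "\<lambda>r. ys[r := matprod A X (ys ! r)]"
  have com: "commutes (symop A ys {..<p})" "\<And>r. commutes (symop A (?m r) {..<p})"
    using Suc.hyps(1) m by simp_all
  have rec: "symop A zs {..<p} \<phi> = (\<lambda>a. deriv_op A {..<p} X (symop A ys {..<p} \<phi>) a + (-1) * (\<Sum>r<length ys. symop A (?m r) {..<p} \<phi> a))" for \<phi>
    unfolding zs deriv_op_symop[OF finite_lessThan] by (intro ext) simp
  show ?case unfolding commutes_def
  proof (intro ballI allI)
    fix a \<phi> assume a: "a \<in> words"
    have "op (symop A zs {..<p} \<phi>) a = op (deriv_op A {..<p} X (symop A ys {..<p} \<phi>)) a + (-1) * (\<Sum>r<length ys. op (symop A (?m r) {..<p} \<phi>) a)"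
      unfolding rec op_add op_cmult op_sum ..
    also have "op (deriv_op A {..<p} X (symop A ys {..<p} \<phi>)) a = deriv_op A {..<p} X (op (symop A ys {..<p} \<phi>)) a"
      using D a by (simp add: commutes_def)
    also have "\<dots> = deriv_op A {..<p} X (symop A ys {..<p} (op \<phi>)) a"
      by (rule deriv_op_cong[OF _ a]) (use com(1) in \<open>simp add: commutes_def\<close>)
    also have "(\<Sum>r<length ys. op (symop A (?m r) {..<p} \<phi>) a) = (\<Sum>r<length ys. symop A (?m r) {..<p} (op \<phi>) a)"
      using com(2) a by (intro sum.cong refl) (simp add: commutes_def)
    finally show "op (symop A zs {..<p} \<phi>) a = symop A zs {..<p} (op \<phi>) a" unfolding rec .
  qed
qed

end

section \<open>Tensor powers of arbitrary matrices\<close>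

definition tensor_op :: "'a set \<Rightarrow> ('a \<Rightarrow> 'a \<Rightarrow> complex) \<Rightarrow> nat set \<Rightarrow> ((nat \<Rightarrow> 'a) \<Rightarrow> complex) \<Rightarrow> (nat \<Rightarrow> 'a) \<Rightarrow> complex" where
  "tensor_op A W S \<phi> a = (\<Sum>b\<in>S \<rightarrow>\<^sub>E A. (\<Prod>s\<in>S. W (a s) (b s)) * \<phi> (\<lambda>x. if x \<in> S then b x else a x))"

lemma sum_PiE_insert:
  fixes g :: "('i \<Rightarrow> 'a) \<Rightarrow> complex"
  assumes "x \<notin> S"
  shows "(\<Sum>f\<in>insert x S \<rightarrow>\<^sub>E A. g f) = (\<Sum>y\<in>A. \<Sum>f\<in>S \<rightarrow>\<^sub>E A. g (f(x := y)))"
  unfolding PiE_insert_eq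
  by (subst sum.reindex[OF inj_combinator[OF assms]]) (simp add: sum.cartesian_product case_prod_beta)

lemma site_tensor_op:
  assumes S: "finite S" "s \<in> S"
  shows "site A W s (tensor_op A W (S - {s}) \<phi>) a = tensor_op A W S \<phi> a"
proof -
  let ?S = "S - {s}"
  have ins: "insert s ?S = S" using S by auto
  have "tensor_op A W S \<phi> a = (\<Sum>y\<in>A. \<Sum>b\<in>?S \<rightarrow>\<^sub>E A. (\<Prod>t\<in>S. W (a t) ((b(s := y)) t)) * \<phi> (\<lambda>x. if x \<in> S then (b(s := y)) x else a x))"
    unfolding tensor_op_def using sum_PiE_insert[of s ?S _ A] unfolding ins by simp
  also have "\<dots> = (\<Sum>y\<in>A. \<Sum>b\<in>?S \<rightarrow>\<^sub>E A. W (a s) y * ((\<Prod>t\<in>?S. W ((a(s := y)) t) (b t)) * \<phi> (\<lambda>x. if x \<in> ?S then b x else (a(s := y)) x)))"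
  proof (intro sum.cong refl)
    fix y b
    have "(\<Prod>t\<in>S. W (a t) ((b(s := y)) t)) = W (a s) y * (\<Prod>t\<in>?S. W ((a(s := y)) t) (b t))"
      by (subst prod.remove[OF S]) (auto intro!: prod.cong)
    moreover have "(\<lambda>x. if x \<in> S then (b(s := y)) x else a x) = (\<lambda>x. if x \<in> ?S then b x else (a(s := y)) x)"
      using S by auto
    ultimately show "(\<Prod>t\<in>S. W (a t) ((b(s := y)) t)) * \<phi> (\<lambda>x. if x \<in> S then (b(s := y)) x else a x)
      = W (a s) y * ((\<Prod>t\<in>?S. W ((a(s := y)) t) (b t)) * \<phi> (\<lambda>x. if x \<in> ?S then b x else (a(s := y)) x))"
      by (simp only: mult.assoc)
  qed
  finally show ?thesis by (simp only: site_def tensor_op_def sum_distrib_left)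
qed

text \<open>With as many matrices as sites, distinct placement fills all of \<open>S\<close>, once
  for each of the m! orders.\<close>

lemma symop_replicate:
  "finite S \<Longrightarrow> card S = m \<Longrightarrow> symop A (replicate m W) S \<phi> a = fact m * tensor_op A W S \<phi> a"
proof (induction m arbitrary: S a)
  case 0
  then show ?case by (simp add: tensor_op_def)
next
  case (Suc m)
  have "symop A (replicate (Suc m) W) S \<phi> a = (\<Sum>s\<in>S. site A W s (\<lambda>b. fact m * tensor_op A W (S - {s}) \<phi> b) a)"
    using Suc.IH Suc.prems by (simp cong: site_cong_fun sum.cong)
  also have "\<dots> = (\<Sum>s\<in>S. fact m * site A W s (tensor_op A W (S - {s}) \<phi>) a)"
    by (simp add: site_def sum_distrib_left mult_ac)
  also have "\<dots> = (\<Sum>s\<in>S. fact m * tensor_op A W S \<phi> a)"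
    using site_tensor_op[OF Suc.prems(1)] by (intro sum.cong refl) simp
  finally show ?case using Suc.prems(2) by simp
qed

context kernel_on_words
begin

lemma tensor_op_words:
  assumes a: "a \<in> words"
  shows "tensor_op A W {..<p} \<phi> a = (\<Sum>b\<in>words. (\<Prod>s<p. W (a s) (b s)) * \<phi> b)"
  unfolding tensor_op_def
proof (intro sum.cong refl)
  fix b assume b: "b \<in> words"
  have "(\<lambda>x. if x \<in> {..<p} then b x else a x) = b"
    using a b by (auto simp: PiE_iff extensional_def fun_eq_iff)
  then show "(\<Prod>s<p. W (a s) (b s)) * \<phi> (\<lambda>x. if x \<in> {..<p} then b x else a x) = (\<Prod>s<p. W (a s) (b s)) * \<phi> b"
    by simp
qed

text \<open>This is where unitarity is left behind: \<open>W\<close> is any matrix, in particular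
  one of the singular 0-1 matrices needed for polarization.\<close>

lemma commutes_tensor:
  assumes D: "\<And>X. commutes (deriv_op A {..<p} X)" and a: "a \<in> words" and b: "b \<in> words"
  shows "(\<Sum>c\<in>words. T a c * (\<Prod>s<p. W (c s) (b s))) = (\<Sum>c\<in>words. (\<Prod>s<p. W (a s) (c s)) * T c b)"
proof -
  let ?\<phi> = "\<lambda>c. if c = b then 1 else (0::complex)"
  have sym: "symop A (replicate p W) {..<p} \<phi> = (\<lambda>a. fact p * tensor_op A W {..<p} \<phi> a)" for \<phi>
    by (intro ext symop_replicate) auto
  have "op (symop A (replicate p W) {..<p} ?\<phi>) a = symop A (replicate p W) {..<p} (op ?\<phi>) a"
    using commutes_symop[OF D] a by (simp add: commutes_def)
  then have "op (tensor_op A W {..<p} ?\<phi>) a = tensor_op A W {..<p} (op ?\<phi>) a"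
    unfolding sym op_cmult by simp
  moreover have "tensor_op A W {..<p} ?\<phi> c = (\<Prod>s<p. W (c s) (b s))" if "c \<in> words" for c
    unfolding tensor_op_words[OF that] using b by (simp add: if_distrib[of "(*) _"] cong: if_cong)
  moreover have "op ?\<phi> c = T c b" for c
    unfolding op_def using b by (simp add: if_distrib[of "(*) _"] cong: if_cong)
  ultimately show ?thesis unfolding tensor_op_words[OF a] by (simp add: op_def)
qed

end

section \<open>Polarization to symmetrized matrix units\<close>

text \<open>Ryser's formula for the permanent. Expanding the product gives the maps whose image
  avoids \<open>I\<close>; inclusion-exclusion over \<open>I\<close> keeps the surjective maps,
  which are the permutations.\<close>

lemma sum_Pow_prod_sum:
  fixes m :: "nat \<Rightarrow> nat \<Rightarrow> complex"
  shows "(\<Sum>I\<in>Pow {..<p}. (-1) ^ card I * (\<Prod>s<p. \<Sum>r\<in>{..<p} - I. m r s)) = (\<Sum>\<sigma>\<in>perms p. \<Prod>s<p. m (\<sigma> s) s)"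
proof -
  let ?F = "{..<p} \<rightarrow>\<^sub>E {..<p}"
  let ?one = "\<lambda>b. if b then 1 else (0::complex)"
  have if_mult: "(if b then x else 0) = ?one b * x" for b and x :: complex by simp
  have 1: "(\<Prod>s<p. \<Sum>r\<in>{..<p} - I. m r s) = (\<Sum>f\<in>?F. (\<Prod>x\<in>I. ?one (x \<notin> f ` {..<p})) * (\<Prod>s<p. m (f s) s))"
    if I: "I \<subseteq> {..<p}" for I
  proof -
    have "(\<Prod>s<p. \<Sum>r\<in>{..<p} - I. m r s) = (\<Sum>f\<in>{..<p} \<rightarrow>\<^sub>E ({..<p} - I). \<Prod>s<p. m (f s) s)"
      by (rule prod_sum_PiE) auto
    also have "\<dots> = (\<Sum>f\<in>{f \<in> ?F. \<forall>s<p. f s \<notin> I}. \<Prod>s<p. m (f s) s)"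
      by (rule sum.cong) (simp_all add: PiE_iff set_eq_iff, blast)
    also have "\<dots> = (\<Sum>f\<in>?F. if \<forall>s<p. f s \<notin> I then \<Prod>s<p. m (f s) s else 0)"
      by (rule sum.inter_filter) (simp add: finite_PiE)
    also have "\<dots> = (\<Sum>f\<in>?F. (\<Prod>x\<in>I. ?one (x \<notin> f ` {..<p})) * (\<Prod>s<p. m (f s) s))"
    proof (intro sum.cong refl)
      fix f :: "nat \<Rightarrow> nat"
      have e: "(\<Prod>x\<in>I. ?one (x \<notin> f ` {..<p})) = ?one (\<forall>s<p. f s \<notin> I)"
      proof (cases "\<forall>s<p. f s \<notin> I")
        case True
        then have "x \<notin> f ` {..<p}" if "x \<in> I" for x using that by blast
        then show ?thesis using True by simp
      next
        case False
        then obtain s where "s < p" "f s \<in> I" by blast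
        then have "\<exists>x\<in>I. ?one (x \<notin> f ` {..<p}) = 0" by force
        then have "(\<Prod>x\<in>I. ?one (x \<notin> f ` {..<p})) = 0" by (rule prod_zero[OF finite_subset[OF I finite_lessThan]])
        then show ?thesis unfolding if_not_P[OF False] .
      qed
      show "(if \<forall>s<p. f s \<notin> I then \<Prod>s<p. m (f s) s else 0) = (\<Prod>x\<in>I. ?one (x \<notin> f ` {..<p})) * (\<Prod>s<p. m (f s) s)"
        unfolding e by (rule if_mult)
    qed
    finally show ?thesis .
  qed
  have "(\<Sum>I\<in>Pow {..<p}. (-1) ^ card I * (\<Prod>s<p. \<Sum>r\<in>{..<p} - I. m r s))
     = (\<Sum>I\<in>Pow {..<p}. \<Sum>f\<in>?F. (-1) ^ card I * (\<Prod>x\<in>I. ?one (x \<notin> f ` {..<p})) * (\<Prod>x\<in>{..<p} - I. 1) * (\<Prod>s<p. m (f s) s))"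
    by (intro sum.cong refl) (simp add: 1 sum_distrib_left mult.assoc)
  also have "\<dots> = (\<Sum>f\<in>?F. (\<Sum>I\<in>Pow {..<p}. (-1) ^ card I * (\<Prod>x\<in>I. ?one (x \<notin> f ` {..<p})) * (\<Prod>x\<in>{..<p} - I. 1)) * (\<Prod>s<p. m (f s) s))"
    by (subst sum.swap) (simp only: sum_distrib_right)
  also have "\<dots> = (\<Sum>f\<in>?F. (\<Prod>x<p. 1 - ?one (x \<notin> f ` {..<p})) * (\<Prod>s<p. m (f s) s))"
    by (simp only: prod_diff_conv_sum[OF finite_lessThan])
  also have "\<dots> = (\<Sum>f\<in>?F. if {..<p} \<subseteq> f ` {..<p} then \<Prod>s<p. m (f s) s else 0)"
  proof (intro sum.cong refl)
    fix f
    have "(\<Prod>x<p. 1 - ?one (x \<notin> f ` {..<p})) = ?one ({..<p} \<subseteq> f ` {..<p})"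
      by (cases "{..<p} \<subseteq> f ` {..<p}") (auto intro!: prod.neutral)
    then show "(\<Prod>x<p. 1 - ?one (x \<notin> f ` {..<p})) * (\<Prod>s<p. m (f s) s) = (if {..<p} \<subseteq> f ` {..<p} then \<Prod>s<p. m (f s) s else 0)"
      by simp
  qed
  also have "\<dots> = (\<Sum>f\<in>{f \<in> ?F. {..<p} \<subseteq> f ` {..<p}}. \<Prod>s<p. m (f s) s)"
    by (rule sum.inter_filter[symmetric]) (simp add: finite_PiE)
  also have "\<dots> = (\<Sum>\<sigma>\<in>perms p. \<Prod>s<p. m (\<sigma> s) s)"
  proof (rule sum.reindex_bij_witness[of _ "\<lambda>\<sigma>. restrict \<sigma> {..<p}" "\<lambda>f x. if x < p then f x else x"], goal_cases)
    case (2 f)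
    then have f: "f \<in> {..<p} \<rightarrow> {..<p}" and s: "f ` {..<p} = {..<p}" by auto
    have "inj_on f {..<p}" using s by (simp add: eq_card_imp_inj_on)
    then have "bij_betw f {..<p} {..<p}" using s by (simp add: bij_betw_def)
    then have "bij_betw (\<lambda>x. if x < p then f x else x) {..<p} {..<p}"
      by (subst bij_betw_cong[of _ _ f]) auto
    then show ?case by (auto intro!: bij_imp_permutes split: if_splits)
  next
    case (4 \<sigma>)
    then have "\<sigma> permutes {..<p}" by simp
    then show ?case using permutes_bound permutes_image[of \<sigma> "{..<p}"] by auto
  next
    case (3 \<sigma>)
    then show ?case by (auto simp: fun_eq_iff permutes_def)
  qed (auto simp: PiE_iff extensional_def fun_eq_iff)
  finally show ?thesis .
qed


context kernel_on_words
begin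

text \<open>The (d, e) entry of the symmetrized matrix unit is the permanent of the matrix with a 1
  where d s = c r and e s = c' r. Ryser's formula makes it a signed sum of tensor powers of the
  matrices \<open>?W I\<close>, the sums of the matrix units at (c r, c' r) over r outside
  \<open>I\<close>.\<close>

theorem commutes_symmetrized_unit:
  assumes D: "\<And>X. commutes (deriv_op A {..<p} X)" and a: "a \<in> words" and b: "b \<in> words"
    and c: "c \<in> words" "c' \<in> words"
  shows "(\<Sum>d\<in>words. T a d * (\<Sum>\<sigma>\<in>perms p. if d = c \<circ> \<sigma> \<and> b = c' \<circ> \<sigma> then 1 else 0))
       = (\<Sum>d\<in>words. (\<Sum>\<sigma>\<in>perms p. if a = c \<circ> \<sigma> \<and> d = c' \<circ> \<sigma> then 1 else 0) * T d b)"
proof -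
  let ?m = "\<lambda>d e r s. if d s = c r \<and> e s = c' r then 1 else (0::complex)"
  have K: "(\<Sum>I\<in>Pow {..<p}. (-1) ^ card I * (\<Prod>s<p. \<Sum>r\<in>{..<p} - I. ?m d e r s))
      = (\<Sum>\<sigma>\<in>perms p. if d = c \<circ> \<sigma> \<and> e = c' \<circ> \<sigma> then 1 else 0)" if de: "d \<in> words" "e \<in> words" for d e
  proof -
    have "(\<Sum>I\<in>Pow {..<p}. (-1) ^ card I * (\<Prod>s<p. \<Sum>r\<in>{..<p} - I. ?m d e r s))
       = (\<Sum>\<sigma>\<in>perms p. \<Prod>s<p. ?m d e (\<sigma> s) s)" by (rule sum_Pow_prod_sum)
    also have "\<dots> = (\<Sum>\<sigma>\<in>perms p. if d = c \<circ> \<sigma> \<and> e = c' \<circ> \<sigma> then 1 else 0)"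
    proof (intro sum.cong refl)
      fix \<sigma> assume "\<sigma> \<in> perms p"
      then have \<sigma>: "\<sigma> permutes {..<p}" by simp
      have ext: "f = g \<circ> \<sigma> \<longleftrightarrow> (\<forall>s<p. f s = g (\<sigma> s))" if "f \<in> words" "g \<in> words" for f g
      proof
        assume "\<forall>s<p. f s = g (\<sigma> s)"
        then show "f = g \<circ> \<sigma>"
          using PiE_ext[OF that(1) extensional_comp_perm[OF \<sigma> that(2)]] by simp
      qed auto
      have "(\<Prod>s<p. ?m d e (\<sigma> s) s) = (if \<forall>s<p. d s = c (\<sigma> s) \<and> e s = c' (\<sigma> s) then 1 else 0)"
        by (auto intro!: prod.neutral)
      then show "(\<Prod>s<p. ?m d e (\<sigma> s) s) = (if d = c \<circ> \<sigma> \<and> e = c' \<circ> \<sigma> then 1 else 0)"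
        unfolding ext[OF de(1) c(1)] ext[OF de(2) c(2)] by (simp only: all_conj_distrib imp_conjR)
    qed
    finally show ?thesis .
  qed
  let ?W = "\<lambda>I x y. \<Sum>r\<in>{..<p} - I. if x = c r \<and> y = c' r then 1 else (0::complex)"
  have "(\<Sum>d\<in>words. T a d * (\<Sum>I\<in>Pow {..<p}. (-1) ^ card I * (\<Prod>s<p. ?W I (d s) (b s))))
      = (\<Sum>I\<in>Pow {..<p}. (-1) ^ card I * (\<Sum>d\<in>words. T a d * (\<Prod>s<p. ?W I (d s) (b s))))"
    unfolding sum_distrib_left by (subst sum.swap) (simp only: mult_ac)
  also have "\<dots> = (\<Sum>I\<in>Pow {..<p}. (-1) ^ card I * (\<Sum>d\<in>words. (\<Prod>s<p. ?W I (a s) (d s)) * T d b))"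
  proof (rule sum.cong[OF refl])
    fix I
    show "(-1) ^ card I * (\<Sum>d\<in>words. T a d * (\<Prod>s<p. ?W I (d s) (b s)))
        = (-1) ^ card I * (\<Sum>d\<in>words. (\<Prod>s<p. ?W I (a s) (d s)) * T d b)"
      using commutes_tensor[OF D a b, of "?W I"] by (simp only:)
  qed
  also have "\<dots> = (\<Sum>d\<in>words. (\<Sum>I\<in>Pow {..<p}. (-1) ^ card I * (\<Prod>s<p. ?W I (a s) (d s))) * T d b)"
    unfolding sum_distrib_left sum_distrib_right by (subst sum.swap) (simp only: mult_ac)
  finally show ?thesis using K a b by (simp cong: sum.cong)
qed

section \<open>Derivations obtained from unitary matrices\<close>

lemma commutes_deriv_lincomb:
  assumes "commutes (deriv_op A {..<p} X)" "commutes (deriv_op A {..<p} Y)"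
  shows "commutes (deriv_op A {..<p} (\<lambda>x y. c * X x y + d * Y x y))"
proof -
  have "deriv_op A {..<p} (\<lambda>x y. c * X x y + d * Y x y) \<phi> = (\<lambda>a. c * deriv_op A {..<p} X \<phi> a + d * deriv_op A {..<p} Y \<phi> a)" for \<phi>
    by (intro ext) (simp add: deriv_op_def site_def sum_distrib_left sum.distrib algebra_simps)
  then show ?thesis using assms by (simp add: commutes_def op_add op_cmult)
qed

lemma deriv_op_cong_mat:
  assumes "\<And>x y. x \<in> A \<Longrightarrow> y \<in> A \<Longrightarrow> X x y = Y x y" "a \<in> words"
  shows "deriv_op A {..<p} X \<phi> a = deriv_op A {..<p} Y \<phi> a"
  unfolding deriv_op_def site_def using assms by (intro sum.cong refl) (auto simp: PiE_iff)

lemma commutes_deriv_cong: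
  assumes "\<And>x y. x \<in> A \<Longrightarrow> y \<in> A \<Longrightarrow> X x y = Y x y" "commutes (deriv_op A {..<p} X)"
  shows "commutes (deriv_op A {..<p} Y)"
proof -
  have "op (deriv_op A {..<p} Y \<phi>) a = op (deriv_op A {..<p} X \<phi>) a" for \<phi> a
    unfolding op_def using deriv_op_cong_mat[of Y X] assms(1) by (intro sum.cong refl) simp
  then show ?thesis using assms deriv_op_cong_mat[of X Y] by (simp add: commutes_def)
qed

lemma commutes_deriv_sum:
  assumes "finite I" "\<And>i. i \<in> I \<Longrightarrow> commutes (deriv_op A {..<p} (X i))"
  shows "commutes (deriv_op A {..<p} (\<lambda>x y. \<Sum>i\<in>I. c i * X i x y))"
  using assms
proof (induction I rule: finite_induct)
  case empty
  have "deriv_op A {..<p} (\<lambda>x y. 0) \<phi> = (\<lambda>_. 0)" for \<phi> by (intro ext) (simp add: deriv_op_def site_def)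
  then show ?case by (simp add: commutes_def op_def)
next
  case (insert i I)
  then show ?case using commutes_deriv_lincomb[of "X i" _ "c i" 1] by simp
qed

lemma commutes_deriv_units:
  assumes E: "\<And>\<alpha> \<beta>. \<alpha> \<in> A \<Longrightarrow> \<beta> \<in> A \<Longrightarrow> commutes (deriv_op A {..<p} (\<lambda>x y. if x = \<alpha> \<and> y = \<beta> then 1 else 0))"
  shows "commutes (deriv_op A {..<p} X)"
proof (rule commutes_deriv_cong)
  show "commutes (deriv_op A {..<p} (\<lambda>x y. \<Sum>i\<in>A \<times> A. X (fst i) (snd i) * (if x = fst i \<and> y = snd i then 1 else 0)))"
    using finA E by (intro commutes_deriv_sum) auto
  fix x y assume xy: "x \<in> A" "y \<in> A"
  have "(\<Sum>i\<in>A \<times> A. X (fst i) (snd i) * (if x = fst i \<and> y = snd i then 1 else 0)) = (\<Sum>i\<in>A \<times> A. if i = (x, y) then X x y else 0)"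
    by (intro sum.cong refl) auto
  then show "(\<Sum>i\<in>A \<times> A. X (fst i) (snd i) * (if x = fst i \<and> y = snd i then 1 else 0)) = X x y"
    using xy finA by simp
qed

lemma deriv_op_kernel:
  assumes c: "c \<in> words"
  shows "deriv_op A {..<p} P \<phi> c = (\<Sum>d\<in>words. (\<Sum>s<p. P (c s) (d s) * (\<Prod>t\<in>{..<p} - {s}. if c t = d t then 1 else 0)) * \<phi> d)"
proof -
  have "(\<Sum>d\<in>words. P (c s) (d s) * (\<Prod>t\<in>{..<p} - {s}. if c t = d t then 1 else 0) * \<phi> d) = site A P s \<phi> c"
    if s: "s < p" for s
  proof -
    let ?D = "{d \<in> words. \<forall>t<p. t \<noteq> s \<longrightarrow> c t = d t}"
    have "(\<Prod>t\<in>{..<p} - {s}. if c t = d t then 1 else (0::complex)) = (if \<forall>t<p. t \<noteq> s \<longrightarrow> c t = d t then 1 else 0)" for d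
      by (auto intro!: prod.neutral)
    moreover have "x * (if b then 1 else 0) * y = (if b then x * y else 0)" for b and x y :: complex by simp
    ultimately have "(\<Sum>d\<in>words. P (c s) (d s) * (\<Prod>t\<in>{..<p} - {s}. if c t = d t then 1 else 0) * \<phi> d)
      = (\<Sum>d\<in>words. if \<forall>t<p. t \<noteq> s \<longrightarrow> c t = d t then P (c s) (d s) * \<phi> d else 0)"
      by (simp only:)
    also have "\<dots> = (\<Sum>d\<in>?D. P (c s) (d s) * \<phi> d)" by (rule sum.inter_filter[symmetric]) simp
    also have "\<dots> = (\<Sum>\<beta>\<in>A. P (c s) \<beta> * \<phi> (c(s := \<beta>)))"
    proof (rule sum.reindex_bij_witness[of _ "\<lambda>\<beta>. c(s := \<beta>)" "\<lambda>d. d s"], goal_cases)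
      case (1 d) then show ?case using c by (auto simp: fun_eq_iff PiE_iff extensional_def) metis
    next
      case (5 d)
      then have "c(s := d s) = d" using c by (auto simp: fun_eq_iff PiE_iff extensional_def) metis
      then show ?case by simp
    qed (use s c words_upd in \<open>auto simp: PiE_iff\<close>)
    finally show ?thesis by (simp only: site_def)
  qed
  then have "deriv_op A {..<p} P \<phi> c = (\<Sum>s<p. \<Sum>d\<in>words. P (c s) (d s) * (\<Prod>t\<in>{..<p} - {s}. if c t = d t then 1 else 0) * \<phi> d)"
    unfolding deriv_op_def by (intro sum.cong refl) simp
  then show ?thesis by (subst (asm) sum.swap) (simp only: sum_distrib_right)
qed

text \<open>Commuting with \<open>(1 + \<zeta>P)\<close> to the tensor power \<open>p\<close> is a polynomial condition in \<open>\<zeta>\<close>; its linear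
  coefficient is commutation with the derivation of \<open>P\<close>.\<close>
lemma commutes_deriv_of_pencil:
  assumes inf: "infinite Z"
    and V: "\<And>\<zeta> a b. \<zeta> \<in> Z \<Longrightarrow> a \<in> words \<Longrightarrow> b \<in> words \<Longrightarrow>
      (\<Sum>c\<in>words. T a c * (\<Prod>s<p. (if c s = b s then 1 else 0) + \<zeta> * P (c s) (b s)))
      = (\<Sum>c\<in>words. (\<Prod>s<p. (if a s = c s then 1 else 0) + \<zeta> * P (a s) (c s)) * T c b)"
  shows "commutes (deriv_op A {..<p} P)"
proof -
  let ?\<delta> = "\<lambda>c d s. if c s = d s then 1 else (0::complex)"
  let ?q = "\<lambda>c d. \<Prod>s<p. [:?\<delta> c d s, P (c s) (d s):]"
  let ?k = "\<lambda>c d. \<Sum>s<p. P (c s) (d s) * (\<Prod>t\<in>{..<p} - {s}. ?\<delta> c d t)"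
  have q1: "poly (pderiv (?q c d)) 0 = ?k c d" for c d
    unfolding pderiv_prod by (simp add: poly_sum poly_prod pderiv_pCons mult.commute)
  have k: "(\<Sum>c\<in>words. T a c * ?k c b) = (\<Sum>c\<in>words. ?k a c * T c b)" if a: "a \<in> words" and b: "b \<in> words" for a b
  proof -
    define Q where "Q = (\<Sum>c\<in>words. smult (T a c) (?q c b)) - (\<Sum>c\<in>words. smult (T c b) (?q a c))"
    have "poly Q \<zeta> = 0" if "\<zeta> \<in> Z" for \<zeta>
      using V[OF that a b] unfolding Q_def by (simp add: poly_sum poly_prod mult_ac)
    then have "Z \<subseteq> {\<zeta>. poly Q \<zeta> = 0}" by auto
    then have "Q = 0" using inf poly_roots_finite finite_subset by blast
    then have "poly (pderiv Q) 0 = 0" by simp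
    moreover have "pderiv Q = (\<Sum>c\<in>words. smult (T a c) (pderiv (?q c b))) - (\<Sum>c\<in>words. smult (T c b) (pderiv (?q a c)))"
      unfolding Q_def by (simp only: pderiv_diff pderiv_sum pderiv_smult)
    ultimately show ?thesis by (simp only: poly_diff poly_sum poly_smult q1) (simp add: mult.commute)
  qed
  show ?thesis unfolding commutes_def
  proof (intro ballI allI)
    fix a \<phi> assume a: "a \<in> words"
    have "op (deriv_op A {..<p} P \<phi>) a = (\<Sum>c\<in>words. T a c * (\<Sum>d\<in>words. ?k c d * \<phi> d))"
      unfolding op_def by (intro sum.cong refl) (simp only: deriv_op_kernel)
    also have "\<dots> = (\<Sum>d\<in>words. (\<Sum>c\<in>words. T a c * ?k c d) * \<phi> d)"
      unfolding sum_distrib_left sum_distrib_right by (subst sum.swap) (simp only: mult.assoc)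
    also have "\<dots> = (\<Sum>d\<in>words. (\<Sum>c\<in>words. ?k a c * T c d) * \<phi> d)"
      by (intro sum.cong refl) (simp only: k[OF a])
    also have "\<dots> = (\<Sum>c\<in>words. ?k a c * (\<Sum>d\<in>words. T c d * \<phi> d))"
      unfolding sum_distrib_left[of _ "\<lambda>d. T _ d * \<phi> d"] sum_distrib_right[of "\<lambda>c. _ c * T c _"]
      by (subst sum.swap) (simp only: mult.assoc)
    also have "\<dots> = deriv_op A {..<p} P (op \<phi>) a" unfolding deriv_op_kernel[OF a] op_def ..
    finally show "op (deriv_op A {..<p} P \<phi>) a = deriv_op A {..<p} P (op \<phi>) a" .
  qed
qed

text \<open>Over the complex numbers the projections onto unit vectors span all matrices, by
  polarization, and commutation is linear in the matrix.\<close>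

lemma commutes_deriv_projections:
  assumes P: "\<And>u. (\<Sum>x\<in>A. u x * cnj (u x)) = 1 \<Longrightarrow> commutes (deriv_op A {..<p} (\<lambda>x y. u x * cnj (u y)))"
  shows "commutes (deriv_op A {..<p} X)"
proof (rule commutes_deriv_units)
  fix \<alpha> \<beta> assume ab: "\<alpha> \<in> A" "\<beta> \<in> A"
  let ?E = "\<lambda>\<alpha> \<beta> x y. if x = \<alpha> \<and> y = \<beta> then 1 else (0::complex)"
  have diag: "commutes (deriv_op A {..<p} (?E \<gamma> \<gamma>))" if "\<gamma> \<in> A" for \<gamma>
  proof -
    let ?u = "\<lambda>x. if x = \<gamma> then 1 else (0::complex)"
    have "(\<Sum>x\<in>A. ?u x * cnj (?u x)) = (\<Sum>x\<in>A. if x = \<gamma> then 1 else 0)" by (intro sum.cong refl) auto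
    also have "\<dots> = 1" using that finA by simp
    finally have "commutes (deriv_op A {..<p} (\<lambda>x y. ?u x * cnj (?u y)))" by (rule P)
    then show ?thesis by (rule commutes_deriv_cong[rotated]) auto
  qed
  show "commutes (deriv_op A {..<p} (?E \<alpha> \<beta>))"
  proof (cases "\<alpha> = \<beta>")
    case True
    then show ?thesis using diag ab by simp
  next
    case False
    define B where "B = (\<lambda>\<omega> x y. (if x = \<alpha> then 1 else if x = \<beta> then \<omega> else 0) * cnj (if y = \<alpha> then 1 else if y = \<beta> then \<omega> else (0::complex)))"
    have B: "commutes (deriv_op A {..<p} (B \<omega>))" if w: "\<omega> * cnj \<omega> = 1" for \<omega>
    proof -
      let ?r = "complex_of_real (1 / sqrt 2)"
      let ?u = "\<lambda>x. ?r * (if x = \<alpha> then 1 else if x = \<beta> then \<omega> else 0)"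
      have r: "?r * ?r = 1 / 2" by (simp flip: of_real_mult)
      have "(\<Sum>x\<in>A. ?u x * cnj (?u x)) = (\<Sum>x\<in>A. (if x = \<alpha> then 1 / 2 else 0) + (if x = \<beta> then 1 / 2 else 0))"
      proof (intro sum.cong refl)
        fix x
        have "?u x * cnj (?u x) = (?r * ?r) * ((if x = \<alpha> then 1 else if x = \<beta> then \<omega> else 0) * cnj (if x = \<alpha> then 1 else if x = \<beta> then \<omega> else 0))"
          by (simp only: complex_cnj_mult complex_cnj_complex_of_real mult_ac)
        then show "?u x * cnj (?u x) = (if x = \<alpha> then 1 / 2 else 0) + (if x = \<beta> then 1 / 2 else 0)"
          unfolding r using w False by auto
      qed
      also have "\<dots> = 1" using ab finA by (simp add: sum.distrib)
      finally have "commutes (deriv_op A {..<p} (\<lambda>x y. ?u x * cnj (?u y)))" by (rule P)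
      \<comment> \<open>The factor 2 undoes the normalization of the vector. The zero multiple only
        serves to use the binary \<open>commutes_deriv_lincomb\<close> for scaling.\<close>
      then have "commutes (deriv_op A {..<p} (\<lambda>x y. 2 * (?u x * cnj (?u y)) + 0 * ?E \<alpha> \<alpha> x y))"
        by (rule commutes_deriv_lincomb) (rule diag[OF ab(1)])
      then show ?thesis
      proof (rule commutes_deriv_cong[rotated])
        fix x y
        have "2 * (?u x * cnj (?u y)) = 2 * (?r * ?r) * B \<omega> x y"
          unfolding B_def by (simp only: complex_cnj_mult complex_cnj_complex_of_real mult_ac)
        then show "2 * (?u x * cnj (?u y)) + 0 * ?E \<alpha> \<alpha> x y = B \<omega> x y" unfolding r by simp
      qed
    qed
    \<comment> \<open>\<open>B \<omega>\<close> has the conjugate of \<omega> at (\<alpha>,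
      \<beta>), \<omega> at (\<beta>, \<alpha>), and 1 at both diagonal places. The coefficients 1/2
      and \<i>/2 give 1 at the first place and 0 at the second; the (1 + \<i>)/2 left on the
      diagonal is subtracted below.\<close>
    have 1: "commutes (deriv_op A {..<p} (\<lambda>x y. (1/2) * B 1 x y + (\<i>/2) * B \<i> x y))"
      by (rule commutes_deriv_lincomb[OF B B]) auto
    have 2: "commutes (deriv_op A {..<p} (\<lambda>x y. 1 * ?E \<alpha> \<alpha> x y + 1 * ?E \<beta> \<beta> x y))"
      by (rule commutes_deriv_lincomb[OF diag[OF ab(1)] diag[OF ab(2)]])
    have "commutes (deriv_op A {..<p} (\<lambda>x y. 1 * ((1/2) * B 1 x y + (\<i>/2) * B \<i> x y) + (- (1 + \<i>) / 2) * (1 * ?E \<alpha> \<alpha> x y + 1 * ?E \<beta> \<beta> x y)))"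
      by (rule commutes_deriv_lincomb[OF 1 2])
    then show ?thesis
    proof (rule commutes_deriv_cong[rotated])
      fix x y
      show "1 * ((1/2) * B 1 x y + (\<i>/2) * B \<i> x y) + (- (1 + \<i>) / 2) * (1 * ?E \<alpha> \<alpha> x y + 1 * ?E \<beta> \<beta> x y) = ?E \<alpha> \<beta> x y"
        using False by (auto simp: B_def field_simps)
    qed
  qed
qed

end

section \<open>Expansion of a commuting kernel in permutation operators\<close>

lemma comp_perm_eq_iff:
  assumes "\<sigma> permutes S" shows "a \<circ> \<sigma> = d \<longleftrightarrow> a = d \<circ> inv \<sigma>"
  using permutes_inv_o[OF assms] by (metis comp_assoc comp_id)

lemma fixc_eq: "fixc A p g = real (card {c \<in> {..<p} \<rightarrow>\<^sub>E A. c \<circ> g = c})" if g: "g permutes {..<p}"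
proof -
  have "c \<circ> g = c \<longleftrightarrow> (\<forall>x<p. c (g x) = c x)" for c :: "nat \<Rightarrow> 'a"
  proof
    assume c: "\<forall>x<p. c (g x) = c x"
    show "c \<circ> g = c"
    proof
      fix x show "(c \<circ> g) x = c x" using c g by (cases "x < p") (auto simp: permutes_def)
    qed
  qed (auto simp: fun_eq_iff)
  then show ?thesis by (simp add: fixc_def)
qed

text \<open>Coefficients in the kernel of the Gram matrix of the permutation operators give the zero operator.\<close>
lemma gram_kernel:
  fixes E :: "(nat \<Rightarrow> nat) \<Rightarrow> real"
  assumes A: "finite A" and E: "\<And>z. z permutes {..<p} \<Longrightarrow> (\<Sum>g\<in>perms p. fixc A p g * E (g \<circ> z)) = 0"
    and a: "a \<in> {..<p} \<rightarrow>\<^sub>E A" and d: "d \<in> {..<p} \<rightarrow>\<^sub>E A"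
  shows "(\<Sum>\<sigma>\<in>perms p. if a \<circ> \<sigma> = d then E \<sigma> else 0) = 0"
proof -
  let ?W = "{..<p} \<rightarrow>\<^sub>E A"
  have fin: "finite ?W" using A by (simp add: finite_PiE)
  let ?y = "\<lambda>a d. \<Sum>\<sigma>\<in>perms p. if a \<circ> \<sigma> = d then E \<sigma> else 0"
  have row: "(\<Sum>d\<in>?W. (?y a d)\<^sup>2) = (\<Sum>\<sigma>\<in>perms p. \<Sum>\<sigma>'\<in>perms p. if a \<circ> \<sigma> = a \<circ> \<sigma>' then E \<sigma> * E \<sigma>' else 0)" if a: "a \<in> ?W" for a
  proof -
    have "(\<Sum>d\<in>?W. (?y a d)\<^sup>2) = (\<Sum>d\<in>?W. \<Sum>\<sigma>\<in>perms p. \<Sum>\<sigma>'\<in>perms p. if d = a \<circ> \<sigma> then (if a \<circ> \<sigma> = a \<circ> \<sigma>' then E \<sigma> * E \<sigma>' else 0) else 0)"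
      unfolding power2_eq_square sum_product by (intro sum.cong refl) auto
    also have "\<dots> = (\<Sum>\<sigma>\<in>perms p. \<Sum>\<sigma>'\<in>perms p. \<Sum>d\<in>?W. if d = a \<circ> \<sigma> then (if a \<circ> \<sigma> = a \<circ> \<sigma>' then E \<sigma> * E \<sigma>' else 0) else 0)"
      by (subst sum.swap, rule sum.cong[OF refl], rule sum.swap)
    also have "\<dots> = (\<Sum>\<sigma>\<in>perms p. \<Sum>\<sigma>'\<in>perms p. if a \<circ> \<sigma> = a \<circ> \<sigma>' then E \<sigma> * E \<sigma>' else 0)"
      using extensional_comp_perm[OF _ a] fin by (intro sum.cong refl) (simp del: comp_apply)
    finally show ?thesis .
  qed
  \<comment> \<open>The squared Hilbert-Schmidt norm of the operator is the quadratic form of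
    \<open>E\<close> under the Gram function, which the hypothesis makes zero; since
    \<open>E\<close> is real, every entry is then zero.\<close>
  have "(\<Sum>a\<in>?W. \<Sum>d\<in>?W. (?y a d)\<^sup>2) = (\<Sum>a\<in>?W. \<Sum>\<sigma>\<in>perms p. \<Sum>\<sigma>'\<in>perms p. if a \<circ> \<sigma> = a \<circ> \<sigma>' then E \<sigma> * E \<sigma>' else 0)"
    by (intro sum.cong refl row)
  also have "\<dots> = (\<Sum>\<sigma>'\<in>perms p. \<Sum>\<sigma>\<in>perms p. \<Sum>a\<in>?W. if a \<circ> \<sigma> = a \<circ> \<sigma>' then E \<sigma> * E \<sigma>' else 0)"
    by (subst sum.swap, subst (2) sum.swap, rule sum.swap)
  also have "\<dots> = (\<Sum>\<sigma>'\<in>perms p. \<Sum>g\<in>perms p. \<Sum>a\<in>?W. if a \<circ> (g \<circ> \<sigma>') = a \<circ> \<sigma>' then E (g \<circ> \<sigma>') * E \<sigma>' else 0)"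
    by (rule sum.cong[OF refl], rule sum_permutations_compose_right) simp
  also have "\<dots> = (\<Sum>\<sigma>'\<in>perms p. E \<sigma>' * (\<Sum>g\<in>perms p. fixc A p g * E (g \<circ> \<sigma>')))"
    unfolding sum_distrib_left
  proof (intro sum.cong refl)
    fix \<sigma>' g assume "\<sigma>' \<in> perms p" and "g \<in> perms p"
    then have \<sigma>': "\<sigma>' permutes {..<p}" and g: "g permutes {..<p}" by auto
    have "a \<circ> (g \<circ> \<sigma>') = a \<circ> \<sigma>' \<longleftrightarrow> a \<circ> g = a" for a :: "nat \<Rightarrow> 'a"
      using permutes_inv_o[OF \<sigma>'] by (metis comp_assoc comp_id)
    then have "(\<Sum>a\<in>?W. if a \<circ> (g \<circ> \<sigma>') = a \<circ> \<sigma>' then E (g \<circ> \<sigma>') * E \<sigma>' else 0)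
       = (\<Sum>a\<in>{a \<in> ?W. a \<circ> g = a}. E (g \<circ> \<sigma>') * E \<sigma>')"
      by (simp only: sum.inter_filter[OF fin])
    then show "(\<Sum>a\<in>?W. if a \<circ> (g \<circ> \<sigma>') = a \<circ> \<sigma>' then E (g \<circ> \<sigma>') * E \<sigma>' else 0) = E \<sigma>' * (fixc A p g * E (g \<circ> \<sigma>'))"
      unfolding fixc_eq[OF g] by simp
  qed
  also have "\<dots> = 0" by (simp add: E)
  finally have "(\<Sum>a\<in>?W. \<Sum>d\<in>?W. (?y a d)\<^sup>2) = 0" .
  then have "(?y a d)\<^sup>2 = 0"
    using a d fin by (simp add: sum_nonneg_eq_0_iff sum_nonneg)
  then show ?thesis by simp
qed

text \<open>\<Pi>(1) = 1 in entries: the two coefficient functions differ by an element of the Gram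
  kernel, so they define the same operator even when they are different.\<close>

lemma sum_sum_Wg_delta:
  assumes A: "finite A" "card A = N"
    and a: "a \<in> {..<p} \<rightarrow>\<^sub>E A" and d: "d \<in> {..<p} \<rightarrow>\<^sub>E A"
  shows "(\<Sum>\<sigma>\<in>perms p. if a \<circ> \<sigma> = d then (\<Sum>\<tau>\<in>perms p. Wg N p (inv \<sigma> \<circ> \<tau>) * fixc A p \<tau>) else 0)
       = (if a = d then 1 else 0)"
proof -
  let ?w = "\<lambda>\<sigma>. (\<Sum>\<tau>\<in>perms p. Wg N p (inv \<sigma> \<circ> \<tau>) * fixc A p \<tau>)"
  have "0 = (\<Sum>\<sigma>\<in>perms p. if a \<circ> \<sigma> = d then (if \<sigma> = id then 1 else 0) - ?w \<sigma> else 0)"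
    by (rule sym, rule gram_kernel[OF A(1) _ a d]) (rule sum_Wg_fixc[OF A])
  also have "\<dots> = (\<Sum>\<sigma>\<in>perms p. (if \<sigma> = id then (if a = d then 1 else 0) else 0) - (if a \<circ> \<sigma> = d then ?w \<sigma> else 0))"
    by (intro sum.cong refl) auto
  also have "\<dots> = (if a = d then 1 else 0) - (\<Sum>\<sigma>\<in>perms p. if a \<circ> \<sigma> = d then ?w \<sigma> else 0)"
    unfolding sum_subtractf by (subst sum.delta) (auto simp: permutes_id)
  finally show ?thesis by simp
qed

context kernel_on_words
begin

text \<open>The operator \<open>X \<mapsto> (\<Sum>\<sigma> \<tau>. Wg (\<sigma>\<inverse>\<tau>) Tr (P\<^sub>\<tau>\<inverse> X) P\<^sub>\<sigma>)\<close> fixes the identity, and its kernel \<open>Q\<close> is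
  permutation invariant, so it commutes with multiplication by \<open>T\<close> and fixes \<open>T\<close>.\<close>
theorem weingarten_expansion:
  assumes D: "\<And>X. commutes (deriv_op A {..<p} X)" and N: "card A = N"
    and a: "a \<in> words" and d: "d \<in> words"
  shows "T a d = (\<Sum>\<sigma>\<in>perms p. \<Sum>\<tau>\<in>perms p. if a \<circ> \<sigma> = d then of_real (Wg N p (inv \<sigma> \<circ> \<tau>)) * (\<Sum>c\<in>words. T c (c \<circ> \<tau>)) else 0)"
proof -
  let ?W = "\<lambda>\<sigma>. complex_of_real (Wg N p \<sigma>)"
  define Q :: "(nat \<Rightarrow> 'a) \<Rightarrow> (nat \<Rightarrow> 'a) \<Rightarrow> (nat \<Rightarrow> 'a) \<Rightarrow> (nat \<Rightarrow> 'a) \<Rightarrow> complex"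
    where "Q = (\<lambda>a d a' d'. \<Sum>\<sigma>\<in>perms p. \<Sum>\<tau>\<in>perms p. if a \<circ> \<sigma> = d \<and> a' \<circ> \<tau> = d' then ?W (inv \<sigma> \<circ> \<tau>) else 0)"
  define K :: "(nat \<Rightarrow> 'a) \<Rightarrow> (nat \<Rightarrow> 'a) \<Rightarrow> (nat \<Rightarrow> 'a) \<Rightarrow> (nat \<Rightarrow> 'a) \<Rightarrow> complex"
    where "K = (\<lambda>c c' a a'. \<Sum>\<rho>\<in>perms p. if a = c \<circ> \<rho> \<and> a' = c' \<circ> \<rho> then 1 else (0::complex))"
  \<comment> \<open>The substitution \<tau> = \<sigma> \<circ> \<pi> leaves a \<open>Wg\<close>
    factor in \<pi> alone. The sum over \<sigma> then makes \<open>Q\<close>, in its first and third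
    argument, a combination of symmetrized matrix units.\<close>
  have QK: "Q a d a' d' = (\<Sum>\<pi>\<in>perms p. ?W \<pi> * K d (d' \<circ> inv \<pi>) a a')" for a d a' d'
  proof -
    have "Q a d a' d' = (\<Sum>\<sigma>\<in>perms p. \<Sum>\<pi>\<in>perms p. if a \<circ> \<sigma> = d \<and> a' \<circ> (\<sigma> \<circ> \<pi>) = d' then ?W (inv \<sigma> \<circ> (\<sigma> \<circ> \<pi>)) else 0)"
      unfolding Q_def by (rule sum.cong[OF refl], rule setum_permutations_compose_left) simp
    also have "\<dots> = (\<Sum>\<sigma>\<in>perms p. \<Sum>\<pi>\<in>perms p. ?W \<pi> * (if a = d \<circ> inv \<sigma> \<and> a' = d' \<circ> inv \<pi> \<circ> inv \<sigma> then 1 else 0))"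
    proof (intro sum.cong refl)
      fix \<sigma> \<pi> assume "\<sigma> \<in> perms p" "\<pi> \<in> perms p"
      then have \<sigma>: "\<sigma> permutes {..<p}" and \<pi>: "\<pi> permutes {..<p}" by auto
      have 1: "a' \<circ> (\<sigma> \<circ> \<pi>) = d' \<longleftrightarrow> a' = d' \<circ> inv \<pi> \<circ> inv \<sigma>"
        unfolding comp_assoc[symmetric] comp_perm_eq_iff[OF \<pi>] comp_perm_eq_iff[OF \<sigma>] ..
      have 2: "inv \<sigma> \<circ> (\<sigma> \<circ> \<pi>) = \<pi>" using permutes_inv_o[OF \<sigma>] by (simp add: comp_assoc[symmetric] del: comp_apply)
      show "(if a \<circ> \<sigma> = d \<and> a' \<circ> (\<sigma> \<circ> \<pi>) = d' then ?W (inv \<sigma> \<circ> (\<sigma> \<circ> \<pi>)) else 0)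
         = ?W \<pi> * (if a = d \<circ> inv \<sigma> \<and> a' = d' \<circ> inv \<pi> \<circ> inv \<sigma> then 1 else 0)"
        unfolding 1 2 comp_perm_eq_iff[OF \<sigma>] by (simp only: if_distrib[of "(*) _"] mult_1_right mult_zero_right)
    qed
    also have "\<dots> = (\<Sum>\<pi>\<in>perms p. \<Sum>\<sigma>\<in>perms p. ?W \<pi> * (if a = d \<circ> inv \<sigma> \<and> a' = d' \<circ> inv \<pi> \<circ> inv \<sigma> then 1 else 0))"
      by (rule sum.swap)
    also have "\<dots> = (\<Sum>\<pi>\<in>perms p. ?W \<pi> * (\<Sum>\<sigma>\<in>perms p. if a = d \<circ> inv \<sigma> \<and> a' = d' \<circ> inv \<pi> \<circ> inv \<sigma> then 1 else 0))"
      by (simp only: sum_distrib_left)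
    also have "\<dots> = (\<Sum>\<pi>\<in>perms p. ?W \<pi> * K d (d' \<circ> inv \<pi>) a a')"
    proof -
      have "(\<Sum>\<sigma>\<in>perms p. if a = d \<circ> inv \<sigma> \<and> a' = d' \<circ> inv \<pi> \<circ> inv \<sigma> then 1 else (0::complex)) = K d (d' \<circ> inv \<pi>) a a'" for \<pi>
        unfolding K_def by (rule sum_permutations_inverse[symmetric])
      then show ?thesis by (simp only:)
    qed
    finally show ?thesis .
  qed
  have comm: "(\<Sum>b\<in>words. T a b * Q b d a' d') = (\<Sum>b\<in>words. Q a d b d' * T b a')"
    if w: "a \<in> words" "d \<in> words" "a' \<in> words" "d' \<in> words" for a d a' d'
  proof -
    have "(\<Sum>b\<in>words. T a b * Q b d a' d') = (\<Sum>\<pi>\<in>perms p. ?W \<pi> * (\<Sum>b\<in>words. T a b * K d (d' \<circ> inv \<pi>) b a'))"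
      unfolding QK sum_distrib_left by (subst sum.swap) (simp only: mult_ac)
    also have "\<dots> = (\<Sum>\<pi>\<in>perms p. ?W \<pi> * (\<Sum>b\<in>words. K d (d' \<circ> inv \<pi>) a b * T b a'))"
    proof (rule sum.cong[OF refl])
      fix \<pi> assume "\<pi> \<in> perms p"
      then have "inv \<pi> permutes {..<p}" by (simp add: permutes_inv)
      from commutes_symmetrized_unit[OF D w(1,3,2) extensional_comp_perm[OF this w(4)]]
      show "?W \<pi> * (\<Sum>b\<in>words. T a b * K d (d' \<circ> inv \<pi>) b a') = ?W \<pi> * (\<Sum>b\<in>words. K d (d' \<circ> inv \<pi>) a b * T b a')"
        unfolding K_def by (simp only:)
    qed
    also have "\<dots> = (\<Sum>b\<in>words. Q a d b d' * T b a')"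
      unfolding QK sum_distrib_left sum_distrib_right by (subst sum.swap) (simp only: mult_ac)
    finally show ?thesis .
  qed
  have unit: "(\<Sum>c\<in>words. Q b d c c) = (if b = d then 1 else 0)" if b: "b \<in> words" for b
  proof -
    have "(\<Sum>c\<in>words. Q b d c c) = (\<Sum>\<sigma>\<in>perms p. \<Sum>\<tau>\<in>perms p. \<Sum>c\<in>words. if b \<circ> \<sigma> = d \<and> c \<circ> \<tau> = c then ?W (inv \<sigma> \<circ> \<tau>) else 0)"
      unfolding Q_def by (subst sum.swap, rule sum.cong[OF refl], rule sum.swap)
    also have "\<dots> = (\<Sum>\<sigma>\<in>perms p. of_real (if b \<circ> \<sigma> = d then (\<Sum>\<tau>\<in>perms p. Wg N p (inv \<sigma> \<circ> \<tau>) * fixc A p \<tau>) else 0))"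
    proof (rule sum.cong[OF refl])
      fix \<sigma>
      have "(\<Sum>c\<in>words. if c \<circ> \<tau> = c then ?W (inv \<sigma> \<circ> \<tau>) else 0) = of_real (Wg N p (inv \<sigma> \<circ> \<tau>) * fixc A p \<tau>)"
        if "\<tau> \<in> perms p" for \<tau>
        using that by (simp add: sum.inter_filter[symmetric] fixc_eq)
      then show "(\<Sum>\<tau>\<in>perms p. \<Sum>c\<in>words. if b \<circ> \<sigma> = d \<and> c \<circ> \<tau> = c then ?W (inv \<sigma> \<circ> \<tau>) else 0)
        = of_real (if b \<circ> \<sigma> = d then (\<Sum>\<tau>\<in>perms p. Wg N p (inv \<sigma> \<circ> \<tau>) * fixc A p \<tau>) else 0)"
        by (cases "b \<circ> \<sigma> = d") (simp_all only: of_real_sum if_True if_False simp_thms of_real_0 sum.neutral_const cong: sum.cong)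
    qed
    also have "\<dots> = of_real (if b = d then 1 else 0)"
      unfolding of_real_sum[symmetric] sum_sum_Wg_delta[OF finA N b d] ..
    finally show ?thesis by simp
  qed
  have "T a d = (\<Sum>b\<in>words. T a b * (if b = d then 1 else 0))"
    using d by (simp add: if_distrib[of "(*) _"] cong: if_cong)
  also have "\<dots> = (\<Sum>b\<in>words. T a b * (\<Sum>c\<in>words. Q b d c c))"
    by (intro sum.cong refl) (simp only: unit)
  also have "\<dots> = (\<Sum>c\<in>words. \<Sum>b\<in>words. T a b * Q b d c c)"
    unfolding sum_distrib_left by (rule sum.swap)
  also have "\<dots> = (\<Sum>c\<in>words. \<Sum>b\<in>words. Q a d b c * T b c)"
    by (intro sum.cong refl comm a d)
  also have "\<dots> = (\<Sum>c\<in>words. \<Sum>b\<in>words. \<Sum>\<sigma>\<in>perms p. \<Sum>\<tau>\<in>perms p. if a \<circ> \<sigma> = d \<and> b \<circ> \<tau> = c then ?W (inv \<sigma> \<circ> \<tau>) * T b c else 0)"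
    unfolding Q_def sum_distrib_right by (simp only: if_distrib[of "\<lambda>x. x * _"] mult_zero_left)
  also have "\<dots> = (\<Sum>\<sigma>\<in>perms p. \<Sum>\<tau>\<in>perms p. \<Sum>b\<in>words. \<Sum>c\<in>words. if a \<circ> \<sigma> = d \<and> b \<circ> \<tau> = c then ?W (inv \<sigma> \<circ> \<tau>) * T b c else 0)"
  proof -
    have sw: "(\<Sum>b\<in>words. \<Sum>\<sigma>\<in>perms p. \<Sum>\<tau>\<in>perms p. f b \<sigma> \<tau>) = (\<Sum>\<sigma>\<in>perms p. \<Sum>\<tau>\<in>perms p. \<Sum>b\<in>words. f b \<sigma> \<tau>)"
      for f :: "(nat \<Rightarrow> 'a) \<Rightarrow> (nat \<Rightarrow> nat) \<Rightarrow> (nat \<Rightarrow> nat) \<Rightarrow> complex"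
      by (subst sum.swap, rule sum.cong[OF refl], rule sum.swap)
    show ?thesis by (subst sum.swap) (simp only: sw)
  qed
  also have "\<dots> = (\<Sum>\<sigma>\<in>perms p. \<Sum>\<tau>\<in>perms p. if a \<circ> \<sigma> = d then ?W (inv \<sigma> \<circ> \<tau>) * (\<Sum>c\<in>words. T c (c \<circ> \<tau>)) else 0)"
  proof (intro sum.cong refl)
    fix \<sigma> \<tau> assume "\<tau> \<in> perms p"
    then have \<tau>: "\<tau> permutes {..<p}" by simp
    have "(\<Sum>c\<in>words. if b \<circ> \<tau> = c then ?W (inv \<sigma> \<circ> \<tau>) * T b c else 0) = ?W (inv \<sigma> \<circ> \<tau>) * T b (b \<circ> \<tau>)" if "b \<in> words" for b
      using extensional_comp_perm[OF \<tau> that] by (simp del: comp_apply)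
    then show "(\<Sum>b\<in>words. \<Sum>c\<in>words. if a \<circ> \<sigma> = d \<and> b \<circ> \<tau> = c then ?W (inv \<sigma> \<circ> \<tau>) * T b c else 0)
      = (if a \<circ> \<sigma> = d then ?W (inv \<sigma> \<circ> \<tau>) * (\<Sum>c\<in>words. T c (c \<circ> \<tau>)) else 0)"
      by (cases "a \<circ> \<sigma> = d") (simp_all only: sum_distrib_left if_True if_False simp_thms sum.neutral_const cong: sum.cong)
  qed
  finally show ?thesis .
qed

end

section \<open>Moments of the Haar measure\<close>

lemma cyc_eq:
  assumes \<tau>: "\<tau> permutes {..<p}" and x: "x < p" and y: "y \<in> cyc \<tau> x"
  shows "cyc \<tau> y = cyc \<tau> x"
proof
  show "cyc \<tau> y \<subseteq> cyc \<tau> x" using y by (intro cyc_subsetI) (auto intro: cyc_closed)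
  have yp: "y < p" using cyc_subset[OF \<tau> x] y by auto
  obtain m where m: "y = (\<tau> ^^ m) x" using y unfolding cyc_def by blast
  have "x \<in> cyc \<tau> y" if "(\<tau> ^^ m) x \<in> cyc \<tau> y" for m
    using that
  proof (induction m)
    case (Suc m)
    have l: "\<tau> ((\<tau> ^^ m) x) < p" using Suc.prems cyc_subset[OF \<tau> yp] by auto
    have "inv \<tau> (\<tau> ((\<tau> ^^ m) x)) \<in> cyc \<tau> (\<tau> ((\<tau> ^^ m) x))" by (rule inv_in_cyc[OF \<tau> l])
    moreover have "cyc \<tau> (\<tau> ((\<tau> ^^ m) x)) \<subseteq> cyc \<tau> y"
      using Suc.prems by (intro cyc_subsetI) (auto intro: cyc_closed)
    ultimately have "(\<tau> ^^ m) x \<in> cyc \<tau> y" using permutes_inverses(2)[OF \<tau>] by auto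
    then show ?case by (rule Suc.IH)
  qed simp
  then have "x \<in> cyc \<tau> y" using m cyc_self by metis
  then show "cyc \<tau> x \<subseteq> cyc \<tau> y" by (intro cyc_subsetI) (auto intro: cyc_closed)
qed

text \<open>A word fixed by \<tau> is a free choice of one letter per cycle, and a cycle with letter
  a contributes lam a once for each of its points.\<close>

lemma sum_fixed_words:
  fixes lam :: "(nat \<Rightarrow> nat) \<Rightarrow> real"
  assumes \<tau>: "\<tau> permutes {..<p}" and A: "finite A"
  shows "(\<Sum>e\<in>{e \<in> {..<p} \<rightarrow>\<^sub>E A. \<forall>s<p. e (\<tau> s) = e s}. \<Prod>s<p. lam (e s)) = Tr_perm p A lam \<tau>"
proof -
  let ?C = "cycles_of p \<tau>" and ?F = "{e \<in> {..<p} \<rightarrow>\<^sub>E A. \<forall>s<p. e (\<tau> s) = e s}"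
  have C: "?C = cyc \<tau> ` {..<p}" unfolding cycles_of_def cyc_def by auto
  have finC: "finite ?C" unfolding C by simp
  have inC: "cyc \<tau> s \<in> ?C" if "s < p" for s unfolding C using that by simp
  have fib: "{s \<in> {..<p}. cyc \<tau> s = c} = c" if cC: "c \<in> ?C" for c
  proof -
    obtain x where x: "x < p" "c = cyc \<tau> x" using cC unfolding C by auto
    show ?thesis unfolding x(2) using cyc_eq[OF \<tau> x(1)] cyc_subset[OF \<tau> x(1)] cyc_self by blast
  qed
  have "Tr_perm p A lam \<tau> = (\<Sum>g\<in>?C \<rightarrow>\<^sub>E A. \<Prod>c\<in>?C. lam (g c) ^ card c)"
    unfolding Tr_perm_def by (rule prod_sum_PiE[OF finC]) (rule A)
  also have "\<dots> = (\<Sum>e\<in>?F. \<Prod>s<p. lam (e s))"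
  \<comment> \<open>Any representative of the cycle gives the same letter, because the word is
    constant on cycles.\<close>
  proof (rule sum.reindex_bij_witness[of _ "\<lambda>e. \<lambda>c\<in>?C. e (SOME s. s \<in> c)" "\<lambda>g. \<lambda>s\<in>{..<p}. g (cyc \<tau> s)"], goal_cases)
    case (1 g)
    show ?case
    proof
      fix c
      show "(\<lambda>c\<in>?C. (\<lambda>s\<in>{..<p}. g (cyc \<tau> s)) (SOME s. s \<in> c)) c = g c"
      proof (cases "c \<in> ?C")
      case c: True
      then have "c \<noteq> {}" using cyc_self unfolding C by blast
      then have "(SOME s. s \<in> c) \<in> c" by (simp add: some_in_eq)
      then have "(SOME s. s \<in> c) \<in> {s \<in> {..<p}. cyc \<tau> s = c}" using fib[OF c] by simp
      then show "(\<lambda>c\<in>?C. (\<lambda>s\<in>{..<p}. g (cyc \<tau> s)) (SOME s. s \<in> c)) c = g c" using c by simp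
      qed (use 1 in \<open>auto simp: PiE_iff extensional_def\<close>)
    qed
  next
    case (2 g)
    have "cyc \<tau> (\<tau> s) = cyc \<tau> s" if "s < p" for s
      by (rule cyc_eq[OF \<tau> that]) (rule cyc_closed[OF cyc_self])
    then show ?case using 2 inC permutes_bound[OF \<tau>] by auto
  next
    case (3 e)
    then have e: "e \<in> {..<p} \<rightarrow>\<^sub>E A" and inv: "\<And>s. s < p \<Longrightarrow> e (\<tau> s) = e s" by auto
    have const: "e t = e s" if "s < p" "t \<in> cyc \<tau> s" for s t
    proof -
      have "cyc \<tau> s \<subseteq> {t. t < p \<and> e t = e s}"
        by (rule cyc_subsetI) (use that inv permutes_bound[OF \<tau>] in auto)
      then show ?thesis using that by auto
    qed
    have "e (SOME t. t \<in> cyc \<tau> s) = e s" if "s < p" for s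
      by (rule const[OF that]) (rule someI[of "\<lambda>t. t \<in> cyc \<tau> s", OF cyc_self])
    then show ?case using e inC by (auto simp: PiE_iff extensional_def fun_eq_iff)
  next
    case (4 e)
    then have e: "e \<in> {..<p} \<rightarrow>\<^sub>E A" by auto
    have "e (SOME s. s \<in> c) \<in> A" if c: "c \<in> ?C" for c
    proof -
      have "c \<noteq> {}" using c cyc_self unfolding C by blast
      then have "(SOME s. s \<in> c) \<in> c" by (simp add: some_in_eq)
      then have "(SOME s. s \<in> c) < p" using fib[OF c] by blast
      then show ?thesis using e by auto
    qed
    then show ?case by auto
  next
    case (5 g)
    have "(\<Prod>s<p. lam (g (cyc \<tau> s))) = (\<Prod>c\<in>?C. \<Prod>s\<in>{s \<in> {..<p}. cyc \<tau> s = c}. lam (g (cyc \<tau> s)))"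
      by (rule prod.group[symmetric]) (use finC inC in auto)
    also have "\<dots> = (\<Prod>c\<in>?C. lam (g c) ^ card c)"
    proof (rule prod.cong[OF refl])
      fix c assume c: "c \<in> ?C"
      have "(\<Prod>s\<in>{s \<in> {..<p}. cyc \<tau> s = c}. lam (g (cyc \<tau> s))) = (\<Prod>s\<in>{s \<in> {..<p}. cyc \<tau> s = c}. lam (g c))"
        by (rule prod.cong) auto
      then show "(\<Prod>s\<in>{s \<in> {..<p}. cyc \<tau> s = c}. lam (g (cyc \<tau> s))) = lam (g c) ^ card c"
        by (simp only: prod_constant fib[OF c])
    qed
    finally show ?case by simp
  qed
  finally show ?thesis ..
qed

text \<open>\<open>U\<^sup>\<dagger>U\<close> is a Hermitian idempotent whose trace is the dimension.\<close>
lemma unitary_columns: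
  assumes A: "finite A" and U: "unitary_on A U" and cd: "c \<in> A" "d \<in> A"
  shows "(\<Sum>a\<in>A. cnj (U a c) * U a d) = (if c = d then 1 else 0)"
proof -
  define P where "P = (\<lambda>c d. \<Sum>a\<in>A. cnj (U a c) * U a d)"
  let ?\<delta> = "\<lambda>a b. if a = b then 1 else (0::complex)"
  have row: "(\<Sum>c\<in>A. U a c * cnj (U b c)) = ?\<delta> a b" if "a \<in> A" "b \<in> A" for a b
    using U that by (simp add: unitary_on_def)
  have tr: "(\<Sum>c\<in>A. P c c) = of_nat (card A)"
  proof -
    have "(\<Sum>c\<in>A. P c c) = (\<Sum>a\<in>A. \<Sum>c\<in>A. U a c * cnj (U a c))"
      unfolding P_def by (subst sum.swap) (simp only: mult.commute)
    also have "\<dots> = of_nat (card A)" by (simp add: row)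
    finally show ?thesis .
  qed
  have sq: "(\<Sum>c\<in>A. \<Sum>d\<in>A. P c d * cnj (P c d)) = of_nat (card A)"
  proof -
    have "(\<Sum>c\<in>A. \<Sum>d\<in>A. P c d * cnj (P c d))
       = (\<Sum>c\<in>A. \<Sum>d\<in>A. \<Sum>a\<in>A. \<Sum>b\<in>A. (U b c * cnj (U a c)) * (U a d * cnj (U b d)))"
      unfolding P_def cnj_sum sum_product by (simp add: mult_ac)
    also have "\<dots> = (\<Sum>c\<in>A. \<Sum>a\<in>A. \<Sum>b\<in>A. \<Sum>d\<in>A. (U b c * cnj (U a c)) * (U a d * cnj (U b d)))"
      by (rule sum.cong[OF refl], subst sum.swap, rule sum.cong[OF refl], rule sum.swap)
    also have "\<dots> = (\<Sum>a\<in>A. \<Sum>b\<in>A. \<Sum>c\<in>A. \<Sum>d\<in>A. (U b c * cnj (U a c)) * (U a d * cnj (U b d)))"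
      by (subst sum.swap, rule sum.cong[OF refl], rule sum.swap)
    also have "\<dots> = (\<Sum>a\<in>A. \<Sum>b\<in>A. ?\<delta> b a * ?\<delta> a b)"
      by (intro sum.cong refl) (simp only: sum_product[symmetric] row)
    also have "\<dots> = (\<Sum>a\<in>A. \<Sum>b\<in>A. ?\<delta> a b)" by (intro sum.cong refl) auto
    also have "\<dots> = of_nat (card A)" using A by simp
    finally show ?thesis .
  qed
  have cP: "(\<Sum>c\<in>A. cnj (P c c)) = of_nat (card A)" using arg_cong[OF tr, of cnj] by simp
  have "complex_of_real (\<Sum>c\<in>A. \<Sum>d\<in>A. (norm (P c d - ?\<delta> c d))\<^sup>2)
    = (\<Sum>c\<in>A. \<Sum>d\<in>A. P c d * cnj (P c d) - (if c = d then cnj (P c d) else 0) - (if c = d then P c d else 0) + ?\<delta> c d)"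
    unfolding of_real_sum complex_norm_square by (intro sum.cong refl) (auto simp: algebra_simps)
  also have "\<dots> = 0"
    using A by (simp add: sum.distrib sum_subtractf tr cP sq)
  finally have "(\<Sum>c\<in>A. \<Sum>d\<in>A. (norm (P c d - ?\<delta> c d))\<^sup>2) = 0" by (simp only: of_real_eq_0_iff)
  then have "(norm (P c d - ?\<delta> c d))\<^sup>2 = 0"
    using cd A by (simp add: sum_nonneg_eq_0_iff sum_nonneg)
  then show ?thesis by (simp add: P_def)
qed

text \<open>The trace of a permutation operator against the tensor power of H, constant over all
  unitary U. After expanding H, the sum over c produces entries of U\<dagger>U, which force the word
  of eigenvalue indices to be fixed by \<tau>.\<close>

lemma sum_words_Hmat:
  assumes A: "finite A" and U: "unitary_on A U" and \<tau>: "\<tau> permutes {..<p}"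
  shows "(\<Sum>c\<in>{..<p} \<rightarrow>\<^sub>E A. \<Prod>s<p. Hmat A lam U (c s) (c (\<tau> s))) = of_real (Tr_perm p A lam \<tau>)"
proof -
  let ?W = "{..<p} \<rightarrow>\<^sub>E A"
  have fin: "finite ?W" using A by (simp add: finite_PiE)
  note i\<tau> = permutes_inv[OF \<tau>]
  have "(\<Sum>c\<in>?W. \<Prod>s<p. Hmat A lam U (c s) (c (\<tau> s)))
      = (\<Sum>c\<in>?W. \<Sum>e\<in>?W. \<Prod>s<p. U (c s) (e s) * of_real (lam (e s)) * cnj (U (c (\<tau> s)) (e s)))"
    unfolding Hmat_def by (intro sum.cong refl prod_sum_PiE) (use A in auto)
  also have "\<dots> = (\<Sum>e\<in>?W. \<Sum>c\<in>?W. (\<Prod>s<p. of_real (lam (e s))) * (\<Prod>s<p. cnj (U (c s) (e (inv \<tau> s))) * U (c s) (e s)))"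
  proof (subst sum.swap, intro sum.cong refl)
    fix e c
    have "(\<Prod>s<p. cnj (U (c (\<tau> s)) (e s))) = (\<Prod>s<p. cnj (U (c s) (e (inv \<tau> s))))"
      using prod.permute[OF \<tau>, of "\<lambda>s. cnj (U (c s) (e (inv \<tau> s)))"] permutes_inverses(2)[OF \<tau>] by simp
    then show "(\<Prod>s<p. U (c s) (e s) * of_real (lam (e s)) * cnj (U (c (\<tau> s)) (e s)))
      = (\<Prod>s<p. of_real (lam (e s))) * (\<Prod>s<p. cnj (U (c s) (e (inv \<tau> s))) * U (c s) (e s))"
      by (simp add: prod.distrib mult_ac)
  qed
  also have "\<dots> = (\<Sum>e\<in>?W. (\<Prod>s<p. of_real (lam (e s))) * (\<Prod>s<p. \<Sum>x\<in>A. cnj (U x (e (inv \<tau> s))) * U x (e s)))"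
    using A by (intro sum.cong refl) (simp add: sum_distrib_left[symmetric] prod_sum_PiE)
  also have "\<dots> = (\<Sum>e\<in>?W. if \<forall>s<p. e (inv \<tau> s) = e s then (\<Prod>s<p. of_real (lam (e s))) else 0)"
  proof (intro sum.cong refl)
    fix e assume e: "e \<in> ?W"
    have "(\<Prod>s<p. \<Sum>x\<in>A. cnj (U x (e (inv \<tau> s))) * U x (e s)) = (\<Prod>s<p. if e (inv \<tau> s) = e s then 1 else 0)"
    proof (rule prod.cong[OF refl])
      fix s assume "s \<in> {..<p}"
      then have "e (inv \<tau> s) \<in> A" "e s \<in> A" using e permutes_bound[OF i\<tau>] by auto
      then show "(\<Sum>x\<in>A. cnj (U x (e (inv \<tau> s))) * U x (e s)) = (if e (inv \<tau> s) = e s then 1 else 0)"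
        by (rule unitary_columns[OF A U])
    qed
    also have "\<dots> = (if \<forall>s<p. e (inv \<tau> s) = e s then 1 else 0)" by (auto intro!: prod.neutral)
    finally have pe: "(\<Prod>s<p. \<Sum>x\<in>A. cnj (U x (e (inv \<tau> s))) * U x (e s)) = \<dots>" .
    show "(\<Prod>s<p. of_real (lam (e s))) * (\<Prod>s<p. \<Sum>x\<in>A. cnj (U x (e (inv \<tau> s))) * U x (e s))
       = (if \<forall>s<p. e (inv \<tau> s) = e s then (\<Prod>s<p. of_real (lam (e s))) else 0)"
      unfolding pe by (simp only: if_distrib[of "(*) _"] mult_1_right mult_zero_right)
  qed
  also have "\<dots> = (\<Sum>e\<in>{e \<in> ?W. \<forall>s<p. e (inv \<tau> s) = e s}. \<Prod>s<p. of_real (lam (e s)))"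
    by (rule sum.inter_filter[OF fin, symmetric])
  also have "{e \<in> ?W. \<forall>s<p. e (inv \<tau> s) = e s} = {e \<in> ?W. \<forall>s<p. e (\<tau> s) = e s}"
  proof -
    have "(\<forall>s<p. e (inv \<tau> s) = e s) \<longleftrightarrow> (\<forall>s<p. e (\<tau> s) = e s)" for e :: "nat \<Rightarrow> nat \<Rightarrow> nat"
      using permutes_bound[OF \<tau>] permutes_bound[OF i\<tau>] permutes_inverses[OF \<tau>] by metis
    then show ?thesis by simp
  qed
  finally show ?thesis
    using arg_cong[OF sum_fixed_words[OF \<tau> A, of lam], of complex_of_real] by simp
qed

text \<open>H(VU) = V H(U) V\<dagger>, multiplied by V on the right. Only V has to be unitary, so
  the identity can be used under the integral at every U.\<close>

lemma Hmat_mmul: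
  assumes A: "finite A" and V: "\<And>c d. c \<in> A \<Longrightarrow> d \<in> A \<Longrightarrow> (\<Sum>a\<in>A. cnj (V a c) * V a d) = (if c = d then 1 else 0)"
    and x: "x \<in> A" and f: "f \<in> A"
  shows "(\<Sum>y\<in>A. Hmat A lam (mmul A V U) x y * V y f) = (\<Sum>d\<in>A. V x d * Hmat A lam U d f)"
proof -
  have col: "(\<Sum>y\<in>A. cnj (mmul A V U y c) * V y f) = cnj (U f c)" if c: "c \<in> A" for c
  proof -
    have "(\<Sum>y\<in>A. cnj (mmul A V U y c) * V y f) = (\<Sum>y\<in>A. \<Sum>e\<in>A. cnj (U e c) * (cnj (V y e) * V y f))"
      using c by (intro sum.cong refl) (simp add: mmul_def sum_distrib_left sum_distrib_right mult_ac)
    also have "\<dots> = (\<Sum>e\<in>A. cnj (U e c) * (\<Sum>y\<in>A. cnj (V y e) * V y f))"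
      by (subst sum.swap) (simp only: sum_distrib_left)
    also have "\<dots> = (\<Sum>e\<in>A. cnj (U e c) * (if e = f then 1 else 0))"
      by (intro sum.cong refl) (simp only: V f)
    also have "\<dots> = cnj (U f c)" using f A by (simp add: if_distrib[of "(*) _"] cong: if_cong)
    finally show ?thesis .
  qed
  have "(\<Sum>y\<in>A. Hmat A lam (mmul A V U) x y * V y f)
      = (\<Sum>c\<in>A. mmul A V U x c * of_real (lam c) * (\<Sum>y\<in>A. cnj (mmul A V U y c) * V y f))"
    unfolding Hmat_def sum_distrib_left sum_distrib_right by (subst sum.swap) (simp only: mult.assoc)
  also have "\<dots> = (\<Sum>c\<in>A. \<Sum>d\<in>A. V x d * (U d c * of_real (lam c) * cnj (U f c)))"
  proof (rule sum.cong[OF refl])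
    fix c assume c: "c \<in> A"
    show "mmul A V U x c * of_real (lam c) * (\<Sum>y\<in>A. cnj (mmul A V U y c) * V y f) = (\<Sum>d\<in>A. V x d * (U d c * of_real (lam c) * cnj (U f c)))"
      unfolding col[OF c] using x c by (simp add: mmul_def sum_distrib_right mult.assoc)
  qed
  also have "\<dots> = (\<Sum>d\<in>A. V x d * Hmat A lam U d f)"
    unfolding Hmat_def sum_distrib_left by (rule sum.swap)
  finally show ?thesis .
qed

text \<open>The circle of radius 1 around -1, on which 1 + \<zeta>P is unitary for every rank one
  projection P. It has a point above each real part between -1 and 0.\<close>

lemma infinite_unit_circle_shift: "infinite {\<zeta>::complex. \<zeta> + cnj \<zeta> + \<zeta> * cnj \<zeta> = 0}"
proof
  assume fin: "finite {\<zeta>::complex. \<zeta> + cnj \<zeta> + \<zeta> * cnj \<zeta> = 0}"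
  have "{0..1::real} \<subseteq> (\<lambda>\<zeta>. Re \<zeta> + 1) ` {\<zeta>. \<zeta> + cnj \<zeta> + \<zeta> * cnj \<zeta> = 0}"
  proof
    fix r :: real assume r: "r \<in> {0..1}"
    then have "r\<^sup>2 \<le> 1" by (simp add: power_le_one)
    then have "Complex (r - 1) (sqrt (1 - r\<^sup>2)) \<in> {\<zeta>. \<zeta> + cnj \<zeta> + \<zeta> * cnj \<zeta> = 0}"
      by (simp add: complex_eq_iff power2_eq_square algebra_simps)
    then show "r \<in> (\<lambda>\<zeta>. Re \<zeta> + 1) ` {\<zeta>. \<zeta> + cnj \<zeta> + \<zeta> * cnj \<zeta> = 0}"
      by (rule rev_image_eqI) simp
  qed
  then have "finite {0..1::real}" using fin finite_subset by blast
  then show False using infinite_Icc[of 0 "1::real"] by simp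
qed

section \<open>Moments as a kernel on words\<close>

locale haar_measure =
  fixes A :: "(nat \<Rightarrow> nat) set" and M :: "mmat measure" and lam :: "(nat \<Rightarrow> nat) \<Rightarrow> real"
  assumes finA: "finite A" and haar: "haar_unitary A M"
begin

sublocale prob_space M using haar by (simp add: haar_unitary_def)

lemma sets_M [measurable_cong]: "sets M = sets (matspace A)"
  using haar by (simp add: haar_unitary_def)

lemma AE_unitary: "AE U in M. unitary_on A U"
  using haar by (simp add: haar_unitary_def)

lemma entry_measurable:
  assumes "x \<in> A" "c \<in> A" shows "(\<lambda>U. U x c) \<in> borel_measurable (matspace A)"
proof -
  have "(\<lambda>U. U x) \<in> measurable (matspace A) (PiM A (\<lambda>_. borel :: complex measure))"
    unfolding matspace_def using assms(1) by (rule measurable_component_singleton)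
  from measurable_compose[OF this measurable_component_singleton[OF assms(2)]]
  show ?thesis by simp
qed

lemma cnj_measurable: "f \<in> borel_measurable N \<Longrightarrow> (\<lambda>x. cnj (f x)) \<in> borel_measurable N"
  by (rule measurable_compose[OF _ borel_measurable_continuous_onI])
     (auto intro: continuous_intros)

lemma prod_Hmat_measurable:
  assumes "\<And>s. s < p \<Longrightarrow> a s \<in> A \<and> b s \<in> A"
  shows "(\<lambda>U. \<Prod>s<p. Hmat A lam U (a s) (b s)) \<in> borel_measurable (matspace A)"
  unfolding Hmat_def
  by (rule borel_measurable_prod, rule borel_measurable_sum, rule borel_measurable_times,
      rule borel_measurable_times, rule entry_measurable, use assms in blast, assumption,
      rule borel_measurable_const, rule cnj_measurable, rule entry_measurable, use assms in blast, assumption)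

lemma prod_Hmat_measurable_M:
  assumes "\<And>s. s < p \<Longrightarrow> a s \<in> A \<and> b s \<in> A"
  shows "(\<lambda>U. \<Prod>s<p. Hmat A lam U (a s) (b s)) \<in> borel_measurable M"
  unfolding measurable_cong_sets[OF sets_M refl] by (rule prod_Hmat_measurable[OF assms])

text \<open>The rows of U are unit vectors, so its entries have modulus at most 1. The bound is
  uniform in U and makes all the products of entries integrable.\<close>

lemma norm_Hmat_le:
  assumes U: "unitary_on A U" and x: "x \<in> A" "y \<in> A"
  shows "norm (Hmat A lam U x y) \<le> (\<Sum>c\<in>A. \<bar>lam c\<bar>)"
proof -
  have entry: "norm (U x c) \<le> 1" if x: "x \<in> A" and c: "c \<in> A" for x c
  proof -
    have "complex_of_real (\<Sum>c\<in>A. (norm (U x c))\<^sup>2) = 1"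
      unfolding of_real_sum complex_norm_square using U x by (simp add: unitary_on_def)
    then have "(\<Sum>c\<in>A. (norm (U x c))\<^sup>2) = 1" by (simp only: of_real_eq_1_iff)
    moreover have "(norm (U x c))\<^sup>2 \<le> (\<Sum>c\<in>A. (norm (U x c))\<^sup>2)"
      using c finA by (intro member_le_sum) auto
    ultimately have "(norm (U x c))\<^sup>2 \<le> 1\<^sup>2" by simp
    then show ?thesis by (rule power2_le_imp_le) simp
  qed
  have "norm (Hmat A lam U x y) \<le> (\<Sum>c\<in>A. norm (U x c * of_real (lam c) * cnj (U y c)))"
    unfolding Hmat_def by (rule norm_sum)
  also have "\<dots> \<le> (\<Sum>c\<in>A. \<bar>lam c\<bar>)"
  proof (rule sum_mono)
    fix c assume c: "c \<in> A"
    have "norm (U x c) * \<bar>lam c\<bar> * norm (U y c) \<le> 1 * \<bar>lam c\<bar> * 1"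
      using entry[OF x(1) c] entry[OF x(2) c] by (intro mult_mono) auto
    then show "norm (U x c * of_real (lam c) * cnj (U y c)) \<le> \<bar>lam c\<bar>" by (simp add: norm_mult)
  qed
  finally show ?thesis .
qed

lemma prod_Hmat_integrable:
  assumes ab: "\<And>s. s < p \<Longrightarrow> a s \<in> A \<and> b s \<in> A"
  shows "integrable M (\<lambda>U. \<Prod>s<p. Hmat A lam U (a s) (b s))"
proof (rule integrable_const_bound)
  show "AE U in M. norm (\<Prod>s<p. Hmat A lam U (a s) (b s)) \<le> (\<Prod>s<p. \<Sum>c\<in>A. \<bar>lam c\<bar>)"
    using AE_unitary
  proof eventually_elim
    case (elim U)
    show ?case unfolding prod_norm[symmetric] using ab norm_Hmat_le[OF elim] by (intro prod_mono) auto
  qed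
qed (rule prod_Hmat_measurable_M[OF ab])

definition moment :: "nat \<Rightarrow> (nat \<Rightarrow> nat \<Rightarrow> nat) \<Rightarrow> (nat \<Rightarrow> nat \<Rightarrow> nat) \<Rightarrow> complex" where
  "moment p a b = (\<integral>U. (\<Prod>s<p. Hmat A lam U (a s) (b s)) \<partial>M)"

lemma mmul_measurable: "mmul A V \<in> measurable (matspace A) (matspace A)"
proof -
  have "(\<lambda>U. \<lambda>a\<in>A. \<lambda>b\<in>A. \<Sum>c\<in>A. V a c * U c b) \<in> measurable (matspace A) (PiM A (\<lambda>_. PiM A (\<lambda>_. (borel :: complex measure))))"
    by (intro measurable_restrict borel_measurable_sum borel_measurable_times borel_measurable_const entry_measurable)
  then show ?thesis unfolding mmul_def[abs_def] by (simp add: matspace_def)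
qed

lemma moment_mmul:
  assumes V: "V \<in> space (matspace A)" "unitary_on A V" and ab: "\<And>s. s < p \<Longrightarrow> a s \<in> A \<and> b s \<in> A"
  shows "(\<integral>U. (\<Prod>s<p. Hmat A lam (mmul A V U) (a s) (b s)) \<partial>M) = moment p a b"
    and "integrable M (\<lambda>U. \<Prod>s<p. Hmat A lam (mmul A V U) (a s) (b s))"
proof -
  have mm: "mmul A V \<in> measurable M (matspace A)"
    unfolding measurable_cong_sets[OF sets_M refl] by (rule mmul_measurable)
  have d: "distr M (matspace A) (mmul A V) = M" using haar V by (simp add: haar_unitary_def)
  show "(\<integral>U. (\<Prod>s<p. Hmat A lam (mmul A V U) (a s) (b s)) \<partial>M) = moment p a b"
    using integral_distr[OF mm prod_Hmat_measurable[where p = p and a = a and b = b, OF ab]] unfolding d moment_def by simp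
  show "integrable M (\<lambda>U. \<Prod>s<p. Hmat A lam (mmul A V U) (a s) (b s))"
    using integrable_distr[OF mm, of "\<lambda>U. \<Prod>s<p. Hmat A lam U (a s) (b s)"] prod_Hmat_integrable[where p = p and a = a and b = b, OF ab]
    unfolding d by simp
qed

text \<open>Invariance replaces U by VU under the integral, and \<open>Hmat_mmul\<close> carries V
  from the right of H to its left in every tensor factor.\<close>

lemma moment_commutes_unitary:
  assumes V: "V \<in> space (matspace A)" "unitary_on A V"
    and a: "a \<in> {..<p} \<rightarrow>\<^sub>E A" and b: "b \<in> {..<p} \<rightarrow>\<^sub>E A"
  shows "(\<Sum>c\<in>{..<p} \<rightarrow>\<^sub>E A. moment p a c * (\<Prod>s<p. V (c s) (b s)))
       = (\<Sum>c\<in>{..<p} \<rightarrow>\<^sub>E A. (\<Prod>s<p. V (a s) (c s)) * moment p c b)"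
proof -
  let ?W = "{..<p} \<rightarrow>\<^sub>E A"
  have mem: "c s \<in> A" if "c \<in> ?W" "s < p" for c s using that by auto
  have "(\<Sum>c\<in>?W. moment p a c * (\<Prod>s<p. V (c s) (b s)))
     = (\<Sum>c\<in>?W. (\<integral>U. (\<Prod>s<p. Hmat A lam (mmul A V U) (a s) (c s)) * (\<Prod>s<p. V (c s) (b s)) \<partial>M))"
    using a mem by (intro sum.cong refl) (simp add: moment_mmul(1)[OF V] integral_mult_left_zero)
  also have "\<dots> = (\<integral>U. (\<Sum>c\<in>?W. (\<Prod>s<p. Hmat A lam (mmul A V U) (a s) (c s)) * (\<Prod>s<p. V (c s) (b s))) \<partial>M)"
    using a mem by (intro Bochner_Integration.integral_sum[symmetric] integrable_mult_left moment_mmul(2)[OF V]) auto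
  also have "\<dots> = (\<integral>U. (\<Sum>c\<in>?W. (\<Prod>s<p. V (a s) (c s)) * (\<Prod>s<p. Hmat A lam U (c s) (b s))) \<partial>M)"
  proof (rule Bochner_Integration.integral_cong[OF refl])
    fix U
    have "(\<Sum>c\<in>?W. (\<Prod>s<p. Hmat A lam (mmul A V U) (a s) (c s)) * (\<Prod>s<p. V (c s) (b s)))
        = (\<Prod>s<p. \<Sum>y\<in>A. Hmat A lam (mmul A V U) (a s) y * V y (b s))"
      using finA by (simp add: prod_sum_PiE prod.distrib)
    also have "\<dots> = (\<Prod>s<p. \<Sum>d\<in>A. V (a s) d * Hmat A lam U d (b s))"
      using a b by (intro prod.cong refl Hmat_mmul[OF finA unitary_columns[OF finA V(2)]]) auto
    also have "\<dots> = (\<Sum>c\<in>?W. (\<Prod>s<p. V (a s) (c s)) * (\<Prod>s<p. Hmat A lam U (c s) (b s)))"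
      using finA by (simp add: prod_sum_PiE prod.distrib)
    finally show "(\<Sum>c\<in>?W. (\<Prod>s<p. Hmat A lam (mmul A V U) (a s) (c s)) * (\<Prod>s<p. V (c s) (b s))) = \<dots>" .
  qed
  also have "\<dots> = (\<Sum>c\<in>?W. (\<integral>U. (\<Prod>s<p. V (a s) (c s)) * (\<Prod>s<p. Hmat A lam U (c s) (b s)) \<partial>M))"
    using b mem by (intro Bochner_Integration.integral_sum integrable_mult_right prod_Hmat_integrable) auto
  also have "\<dots> = (\<Sum>c\<in>?W. (\<Prod>s<p. V (a s) (c s)) * moment p c b)"
    by (simp add: moment_def integral_mult_right_zero)
  finally show ?thesis .
qed

text \<open>The integrand is almost everywhere constant, so no integration takes place.\<close>

lemma moment_trace:
  assumes \<tau>: "\<tau> permutes {..<p}"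
  shows "(\<Sum>c\<in>{..<p} \<rightarrow>\<^sub>E A. moment p c (c \<circ> \<tau>)) = of_real (Tr_perm p A lam \<tau>)"
proof -
  let ?W = "{..<p} \<rightarrow>\<^sub>E A"
  have mem: "c s \<in> A \<and> (c \<circ> \<tau>) s \<in> A" if "c \<in> ?W" "s < p" for c s
    using that permutes_bound[OF \<tau>] by auto
  have "(\<Sum>c\<in>?W. moment p c (c \<circ> \<tau>)) = (\<integral>U. (\<Sum>c\<in>?W. \<Prod>s<p. Hmat A lam U (c s) ((c \<circ> \<tau>) s)) \<partial>M)"
    unfolding moment_def using mem by (intro Bochner_Integration.integral_sum[symmetric] prod_Hmat_integrable) blast
  also have "\<dots> = (\<integral>U. of_real (Tr_perm p A lam \<tau>) \<partial>M)"
  proof (rule integral_cong_AE)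
    show "(\<lambda>U. \<Sum>c\<in>?W. \<Prod>s<p. Hmat A lam U (c s) ((c \<circ> \<tau>) s)) \<in> borel_measurable M"
      using mem by (intro borel_measurable_sum prod_Hmat_measurable_M) blast
    show "AE U in M. (\<Sum>c\<in>?W. \<Prod>s<p. Hmat A lam U (c s) ((c \<circ> \<tau>) s)) = of_real (Tr_perm p A lam \<tau>)"
      using AE_unitary by eventually_elim (simp add: sum_words_Hmat[OF finA _ \<tau>])
  qed simp
  also have "\<dots> = of_real (Tr_perm p A lam \<tau>)" by (simp add: prob_space)
  finally show ?thesis .
qed

lemma moment_commutes_deriv:
  "kernel_on_words.commutes A p (moment p) (deriv_op A {..<p} X)"
proof -
  interpret kernel_on_words A p "moment p" by unfold_locales (rule finA)
  let ?Z = "{\<zeta>::complex. \<zeta> + cnj \<zeta> + \<zeta> * cnj \<zeta> = 0}"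
  show ?thesis
  proof (rule commutes_deriv_projections, rule commutes_deriv_of_pencil[OF infinite_unit_circle_shift])
    fix u \<zeta> a b
    assume u: "(\<Sum>x\<in>A. u x * cnj (u x)) = 1" and z: "\<zeta> \<in> ?Z" and a: "a \<in> words" and b: "b \<in> words"
    \<comment> \<open>The identity plus \<zeta> times the projection onto \<open>u\<close>,
      restricted to \<open>A\<close> because Haar invariance is stated for elements of the space of
      \<open>matspace A\<close>.\<close>
    define V where "V = (\<lambda>x\<in>A. \<lambda>y\<in>A. (if x = y then 1 else 0) + \<zeta> * (u x * cnj (u y)))"
    have Vs: "V \<in> space (matspace A)"
      unfolding V_def matspace_def by (auto simp: space_PiM)
    have "(\<Sum>c\<in>A. V x c * cnj (V y c)) = (if x = y then 1 else 0)" if xy: "x \<in> A" "y \<in> A" for x y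
    proof -
      let ?d = "if x = y then 1 else (0::complex)"
      have "(\<Sum>c\<in>A. V x c * cnj (V y c)) = (\<Sum>c\<in>A. (if c = x then ?d else 0) + (if c = x then cnj \<zeta> * (u x * cnj (u y)) else 0)
         + (if c = y then \<zeta> * (u x * cnj (u y)) else 0) + \<zeta> * cnj \<zeta> * (u x * cnj (u y)) * (u c * cnj (u c)))"
        using xy by (intro sum.cong refl) (auto simp: V_def algebra_simps)
      also have "\<dots> = ?d + (\<zeta> + cnj \<zeta> + \<zeta> * cnj \<zeta>) * (u x * cnj (u y))"
        unfolding sum.distrib sum_distrib_left[symmetric] u using xy finA by (simp add: algebra_simps)
      also have "\<dots> = ?d" using z by simp
      finally show ?thesis .
    qed
    then have "unitary_on A V" by (simp add: unitary_on_def)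
    from moment_commutes_unitary[OF Vs this a b]
    have "(\<Sum>c\<in>words. moment p a c * (\<Prod>s<p. V (c s) (b s))) = (\<Sum>c\<in>words. (\<Prod>s<p. V (a s) (c s)) * moment p c b)" .
    moreover have "(\<Prod>s<p. V (c s) (d s)) = (\<Prod>s<p. (if c s = d s then 1 else 0) + \<zeta> * (u (c s) * cnj (u (d s))))"
      if "c \<in> words" "d \<in> words" for c d
      using that by (intro prod.cong refl) (auto simp: V_def PiE_iff)
    ultimately show "(\<Sum>c\<in>words. moment p a c * (\<Prod>s<p. (if c s = b s then 1 else 0) + \<zeta> * (u (c s) * cnj (u (b s)))))
      = (\<Sum>c\<in>words. (\<Prod>s<p. (if a s = c s then 1 else 0) + \<zeta> * (u (a s) * cnj (u (c s)))) * moment p c b)"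
      using a b by (simp cong: sum.cong)
  qed
qed

theorem moment_eq:
  assumes a: "a \<in> {..<p} \<rightarrow>\<^sub>E A" and b: "b \<in> {..<p} \<rightarrow>\<^sub>E A"
  shows "moment p a b = of_real (\<Sum>\<sigma>\<in>perms p. \<Sum>\<tau>\<in>perms p.
    Wg (card A) p (inv \<sigma> \<circ> \<tau>) * Tr_perm p A lam \<tau> * (if a \<circ> \<sigma> = b then 1 else 0))"
proof -
  interpret kernel_on_words A p "moment p" by unfold_locales (rule finA)
  show ?thesis
    unfolding weingarten_expansion[OF moment_commutes_deriv refl a b] of_real_sum
    by (intro sum.cong refl) (simp add: moment_trace)
qed

end

section \<open>Reduction of the partial trace\<close>

lemma finite_mi: "finite (mi n k)"
proof (rule finite_subset)
  show "mi n k \<subseteq> {f. \<forall>x. (x \<in> {..<n} \<longrightarrow> f x \<in> {..k}) \<and> (x \<notin> {..<n} \<longrightarrow> f x = 0)}"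
  proof
    fix a assume a: "a \<in> mi n k"
    have "a i \<le> k" if "i < n" for i
      using a that member_le_sum[of i "{..<n}" a] by (auto simp: mi_def)
    then show "a \<in> {f. \<forall>x. (x \<in> {..<n} \<longrightarrow> f x \<in> {..k}) \<and> (x \<notin> {..<n} \<longrightarrow> f x = 0)}"
      using a by (auto simp: mi_def)
  qed
  show "finite {f. \<forall>x. (x \<in> {..<n} \<longrightarrow> f x \<in> {..k}) \<and> (x \<notin> {..<n} \<longrightarrow> f x = (0::nat))}"
    by (rule finite_set_of_finite_funs) auto
qed

lemma card_mi: "card (mi n k) = (n + k - 1) choose k"
proof -
  have "bij_betw (\<lambda>a. map a [0..<n]) (mi n k) {l. length l = n \<and> sum_list l = k}"
  proof (rule bij_betw_byWitness[where f' = "\<lambda>l t. if t < n then l ! t else 0"])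
    show "\<forall>a\<in>mi n k. (\<lambda>t. if t < n then map a [0..<n] ! t else 0) = a"
      by (auto simp: mi_def fun_eq_iff)
    show "\<forall>l\<in>{l. length l = n \<and> sum_list l = k}. map (\<lambda>t. if t < n then l ! t else 0) [0..<n] = l"
      by (auto intro: nth_equalityI)
    show "(\<lambda>a. map a [0..<n]) ` mi n k \<subseteq> {l. length l = n \<and> sum_list l = k}"
      by (auto simp: mi_def sum_list_sum_nth atLeast0LessThan)
    show "(\<lambda>l t. if t < n then l ! t else 0) ` {l. length l = n \<and> sum_list l = k} \<subseteq> mi n k"
      by (auto simp: mi_def sum_list_sum_nth atLeast0LessThan)
  qed
  then have "card (mi n k) = card {l::nat list. size l = n \<and> sum_list l = k}" by (rule bij_betw_same_card)
  also have "\<dots> = (k + n - 1) choose k" by (rule card_length_sum_list)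
  finally show ?thesis by (simp only: add.commute)
qed

text \<open>The lists with given counts are the orderings of one multiset, so their number is a
  multinomial coefficient; the product form avoids division.\<close>

lemma card_tab_fibre:
  assumes g: "\<gamma> \<in> mi n m"
  shows "card {l. set l \<subseteq> {..<n} \<and> length l = m \<and> tab n l = \<gamma>} * mfact n \<gamma> = fact m"
proof -
  have "\<gamma> t = 0" if "n \<le> t" for t using g that by (simp add: mi_def)
  then have sub: "t < n" if "0 < \<gamma> t" for t using that by (metis not_less less_irrefl)
  have "{t. 0 < \<gamma> t} \<subseteq> {..<n}" using sub by blast
  then have fin: "finite {t. 0 < \<gamma> t}" by (rule finite_subset) simp
  define X where "X = Abs_multiset \<gamma>"
  have cX: "count X = \<gamma>" unfolding X_def using fin by (simp add: count_Abs_multiset)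
  have sX: "set_mset X \<subseteq> {..<n}" using sub unfolding set_mset_def cX by auto
  have "size X = (\<Sum>t\<in>set_mset X. \<gamma> t)" unfolding size_multiset_overloaded_eq cX ..
  also have "\<dots> = (\<Sum>t<n. \<gamma> t)" using sX by (intro sum.mono_neutral_left) (auto simp: set_mset_def cX)
  also have "\<dots> = m" using g by (simp add: mi_def)
  finally have size: "size X = m" .
  have "{l. set l \<subseteq> {..<n} \<and> length l = m \<and> tab n l = \<gamma>} = permutations_of_multiset X"
  proof (intro set_eqI iffI)
    fix l assume l: "l \<in> {l. set l \<subseteq> {..<n} \<and> length l = m \<and> tab n l = \<gamma>}"
    have "count (mset l) t = \<gamma> t" for t
    proof (cases "t < n")
      case True
      then have "count_list l t = tab n l t" by (simp add: tab_def)
      then show ?thesis using l by (simp add: count_mset)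
    next
      case False
      then have "t \<notin> set l" using l by auto
      then show ?thesis using g False by (simp add: mi_def)
    qed
    then have "mset l = X" by (intro multiset_eqI) (simp add: cX)
    then show "l \<in> permutations_of_multiset X" by (simp add: permutations_of_multiset_def)
  next
    fix l assume "l \<in> permutations_of_multiset X"
    then have l: "mset l = X" by (simp add: permutations_of_multiset_def)
    have "set l \<subseteq> {..<n}" using sX unfolding l[symmetric] by simp
    moreover have "length l = m" using size unfolding l[symmetric] by simp
    moreover have "tab n l = \<gamma>"
    proof
      fix t show "tab n l t = \<gamma> t"
        using g cX unfolding l[symmetric] by (auto simp: tab_def mi_def count_mset)
    qed
    ultimately show "l \<in> {l. set l \<subseteq> {..<n} \<and> length l = m \<and> tab n l = \<gamma>}" by simp
  qed
  moreover have "(\<Prod>x\<in>set_mset X. fact (count X x)) = mfact n \<gamma>"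
    unfolding mfact_def cX using sX by (intro prod.mono_neutral_left) (auto simp: set_mset_def cX)
  ultimately show ?thesis using card_permutations_of_multiset_aux[of X] size by simp
qed

text \<open>The multi-index e_i + \<gamma>, in the pointwise form that occurs in
  \<open>Delta\<close>.\<close>

definition raise :: "nat \<Rightarrow> (nat \<Rightarrow> nat) \<Rightarrow> nat \<Rightarrow> nat" where
  "raise i \<gamma> = (\<lambda>t. unitvec i t + \<gamma> t)"

lemma raise_eq: "raise i \<gamma> = \<gamma>(i := Suc (\<gamma> i))"
  by (auto simp: raise_def unitvec_def)

lemma raise_mi:
  assumes "i < n" "1 \<le> k" "\<gamma> \<in> mi n (k - 1)" shows "raise i \<gamma> \<in> mi n k"
proof -
  have "(\<Sum>t<n. unitvec i t) = 1" using assms(1) by (simp add: unitvec_def)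
  then show ?thesis using assms by (auto simp: raise_def mi_def sum.distrib unitvec_def)
qed

lemma tab_Cons: "i < n \<Longrightarrow> tab n (i # l) = raise i (tab n l)"
  by (auto simp: tab_def raise_def unitvec_def fun_eq_iff)

lemma tab_mi:
  assumes "set l \<subseteq> {..<n}" shows "tab n l \<in> mi n (length l)"
  using assms
proof (induction l)
  case Nil
  then show ?case by (simp add: tab_def mi_def)
next
  case (Cons i l)
  then show ?case using raise_mi[of i n "Suc (length l)" "tab n l"] by (simp add: tab_Cons)
qed

lemma mfact_raise:
  assumes "i < n" shows "mfact n (raise i \<gamma>) = (\<gamma> i + 1) * mfact n \<gamma>"
  unfolding mfact_def raise_eq using assms by (simp add: prod.remove[of "{..<n}" i] algebra_simps)

text \<open>For each l the matrix S selects a single entry of H, which depends only on \<gamma> =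
  \<open>tab n l\<close>. There are (k-1)!/\<gamma>! lists for each \<gamma>, and the two weights of
  S multiply to \<gamma>!/k! times the square root; the quotient leaves 1/k.\<close>

lemma piH_eq:
  assumes k: "1 \<le> k" and i: "i < n" and j: "j < n"
  shows "piH n k H i j = (\<Sum>\<gamma>\<in>mi n (k - 1). of_real (sqrt (real ((\<gamma> i + 1) * (\<gamma> j + 1))) / real k) * H (raise i \<gamma>) (raise j \<gamma>))"
proof -
  let ?L = "{l. set l \<subseteq> {..<n} \<and> length l = k - 1}"
  let ?s = "\<lambda>a. complex_of_real (sqrt (real (mfact n a) / real (fact k)))"
  let ?F = "\<lambda>\<gamma>. ?s (raise i \<gamma>) * H (raise i \<gamma>) (raise j \<gamma>) * ?s (raise j \<gamma>)"
  have finL: "finite ?L" by (rule finite_lists_length_eq) simp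
  have tabL: "tab n l \<in> mi n (k - 1)" if "l \<in> ?L" for l using tab_mi[of l n] that by simp
  have "piH n k H i j = (\<Sum>l\<in>?L. ?F (tab n l))"
    unfolding piH_def
  proof (rule sum.cong[OF refl])
    fix l assume l: "l \<in> ?L"
    let ?a = "raise i (tab n l)" and ?b = "raise j (tab n l)"
    have S: "complex_of_real (Smat n k (i # l) a) = (if a = ?a then ?s ?a else 0)"
        "complex_of_real (Smat n k (j # l) a) = (if a = ?b then ?s ?b else 0)" for a
      using i j by (auto simp: Smat_def tab_Cons)
    have "(\<Sum>a\<in>mi n k. \<Sum>b\<in>mi n k. complex_of_real (Smat n k (i # l) a) * H a b * complex_of_real (Smat n k (j # l) b))
      = (\<Sum>a\<in>mi n k. if a = ?a then (\<Sum>b\<in>mi n k. if b = ?b then ?F (tab n l) else 0) else 0)"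
      unfolding S by (intro sum.cong refl) (auto intro!: sum.cong)
    also have "\<dots> = ?F (tab n l)"
      using raise_mi[OF i k tabL[OF l]] raise_mi[OF j k tabL[OF l]] by (simp add: finite_mi)
    finally show "(\<Sum>a\<in>mi n k. \<Sum>b\<in>mi n k. complex_of_real (Smat n k (i # l) a) * H a b * complex_of_real (Smat n k (j # l) b)) = ?F (tab n l)" .
  qed
  also have "\<dots> = (\<Sum>\<gamma>\<in>mi n (k - 1). \<Sum>l\<in>{l \<in> ?L. tab n l = \<gamma>}. ?F (tab n l))"
    by (rule sum.group[symmetric, OF finL finite_mi]) (use tabL in auto)
  also have "\<dots> = (\<Sum>\<gamma>\<in>mi n (k - 1). of_real (sqrt (real ((\<gamma> i + 1) * (\<gamma> j + 1))) / real k) * H (raise i \<gamma>) (raise j \<gamma>))"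
  proof (rule sum.cong[OF refl])
    fix \<gamma> assume g: "\<gamma> \<in> mi n (k - 1)"
    let ?c = "card {l \<in> ?L. tab n l = \<gamma>}"
    have "?c * mfact n \<gamma> = fact (k - 1)" using card_tab_fibre[OF g] by (simp add: conj_assoc)
    from arg_cong[OF this, of real] have c: "real ?c * real (mfact n \<gamma>) = fact (k - 1)"
      by (simp only: of_nat_mult of_nat_fact)
    have fk: "fact k = real k * fact (k - 1)" using k by (simp add: fact_reduce)
    have m: "real (mfact n \<gamma>) > 0" by (simp add: mfact_def prod_pos)
    have "real ?c * (sqrt (real (mfact n (raise i \<gamma>)) / real (fact k)) * sqrt (real (mfact n (raise j \<gamma>)) / real (fact k)))
       = sqrt (real ((\<gamma> i + 1) * (\<gamma> j + 1))) / real k"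
    proof -
      have "sqrt (real (mfact n (raise i \<gamma>)) / real (fact k)) * sqrt (real (mfact n (raise j \<gamma>)) / real (fact k))
          = sqrt ((real (mfact n \<gamma>) / fact k)\<^sup>2 * real ((\<gamma> i + 1) * (\<gamma> j + 1)))"
        unfolding real_sqrt_mult[symmetric] mfact_raise[OF i] mfact_raise[OF j]
        by (simp add: power2_eq_square field_simps)
      also have "\<dots> = real (mfact n \<gamma>) / fact k * sqrt (real ((\<gamma> i + 1) * (\<gamma> j + 1)))"
        unfolding real_sqrt_mult real_sqrt_abs using m by simp
      finally have "real ?c * (sqrt (real (mfact n (raise i \<gamma>)) / real (fact k)) * sqrt (real (mfact n (raise j \<gamma>)) / real (fact k)))
          = (real ?c * real (mfact n \<gamma>)) / fact k * sqrt (real ((\<gamma> i + 1) * (\<gamma> j + 1)))" by simp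
      also have "\<dots> = sqrt (real ((\<gamma> i + 1) * (\<gamma> j + 1))) / real k"
        unfolding c fk using k by simp
      finally show ?thesis .
    qed
    from arg_cong[OF this, of complex_of_real] have "of_nat ?c * (?s (raise i \<gamma>) * ?s (raise j \<gamma>)) = complex_of_real (sqrt (real ((\<gamma> i + 1) * (\<gamma> j + 1))) / real k)"
      by (simp only: of_real_mult of_real_of_nat_eq)
    moreover have "(\<Sum>l\<in>{l \<in> ?L. tab n l = \<gamma>}. ?F (tab n l)) = of_nat ?c * ?F \<gamma>" by simp
    ultimately show "(\<Sum>l\<in>{l \<in> ?L. tab n l = \<gamma>}. ?F (tab n l))
      = of_real (sqrt (real ((\<gamma> i + 1) * (\<gamma> j + 1))) / real k) * H (raise i \<gamma>) (raise j \<gamma>)"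
      by (simp only: mult_ac)
  qed
  finally show ?thesis .
qed

theorem theorem3p2:
  fixes n k p :: nat and lam :: "(nat \<Rightarrow> nat) \<Rightarrow> real" and M :: "mmat measure"
    and ii jj :: "nat \<Rightarrow> nat"
  assumes "n \<ge> 2" and "k \<ge> 1"
    and "haar_unitary (mi n k) M"
    and "\<forall>s<p. ii s < n" and "\<forall>s<p. jj s < n"
  shows "(\<integral>U. (\<Prod>s<p. piH n k (Hmat (mi n k) lam U) (ii s) (jj s)) \<partial>M) =
    complex_of_real (\<Sum>\<sigma>\<in>{\<sigma>. \<sigma> permutes {..<p}}. \<Sum>\<tau>\<in>{\<tau>. \<tau> permutes {..<p}}.
       Wg (n + k - 1 choose k) p (inv \<sigma> \<circ> \<tau>) * Tr_perm p (mi n k) lam \<tau> * Delta n k p \<sigma> ii jj)"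
proof -
  interpret haar_measure "mi n k" M lam by unfold_locales (rule finite_mi, rule assms(3))
  let ?A = "mi n k" and ?G = "{..<p} \<rightarrow>\<^sub>E mi n (k - 1)"
  let ?q = "\<lambda>\<gamma>. \<Prod>s<p. sqrt (real ((\<gamma> s (ii s) + 1) * (\<gamma> s (jj s) + 1)))"
  let ?a = "\<lambda>\<gamma>. \<lambda>s\<in>{..<p}. raise (ii s) (\<gamma> s)" and ?b = "\<lambda>\<gamma>. \<lambda>s\<in>{..<p}. raise (jj s) (\<gamma> s)"
  let ?c = "\<lambda>\<sigma> \<tau>. Wg (card ?A) p (inv \<sigma> \<circ> \<tau>) * Tr_perm p ?A lam \<tau>"
  have ab: "?a \<gamma> \<in> {..<p} \<rightarrow>\<^sub>E ?A" "?b \<gamma> \<in> {..<p} \<rightarrow>\<^sub>E ?A" if "\<gamma> \<in> ?G" for \<gamma>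
    using that assms(2,4,5) by (auto intro!: raise_mi)
  \<comment> \<open>Each factor brings its own multi-index, so the product becomes a sum over
    families \<gamma>. The shifted families are restricted to p so that they are words to which
    \<open>moment_eq\<close> applies.\<close>
  have "(\<Prod>s<p. piH n k (Hmat ?A lam U) (ii s) (jj s))
      = (\<Sum>\<gamma>\<in>?G. of_real (?q \<gamma> / real k ^ p) * (\<Prod>s<p. Hmat ?A lam U (?a \<gamma> s) (?b \<gamma> s)))" for U
  proof -
    have "(\<Prod>s<p. piH n k (Hmat ?A lam U) (ii s) (jj s))
      = (\<Prod>s<p. \<Sum>\<gamma>\<in>mi n (k - 1). of_real (sqrt (real ((\<gamma> (ii s) + 1) * (\<gamma> (jj s) + 1))) / real k)
           * Hmat ?A lam U (raise (ii s) \<gamma>) (raise (jj s) \<gamma>))"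
      using assms(2,4,5) by (intro prod.cong refl piH_eq) auto
    also have "\<dots> = (\<Sum>\<gamma>\<in>?G. \<Prod>s<p. of_real (sqrt (real ((\<gamma> s (ii s) + 1) * (\<gamma> s (jj s) + 1))) / real k)
           * Hmat ?A lam U (raise (ii s) (\<gamma> s)) (raise (jj s) (\<gamma> s)))"
      by (rule prod_sum_PiE) (simp_all add: finite_mi)
    also have "\<dots> = (\<Sum>\<gamma>\<in>?G. of_real (?q \<gamma> / real k ^ p) * (\<Prod>s<p. Hmat ?A lam U (?a \<gamma> s) (?b \<gamma> s)))"
      by (intro sum.cong refl) (simp add: prod.distrib prod_dividef)
    finally show ?thesis .
  qed
  then have "(\<integral>U. (\<Prod>s<p. piH n k (Hmat ?A lam U) (ii s) (jj s)) \<partial>M)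
      = (\<integral>U. (\<Sum>\<gamma>\<in>?G. of_real (?q \<gamma> / real k ^ p) * (\<Prod>s<p. Hmat ?A lam U (?a \<gamma> s) (?b \<gamma> s))) \<partial>M)"
    by (simp only:)
  also have "\<dots> = (\<Sum>\<gamma>\<in>?G. (\<integral>U. of_real (?q \<gamma> / real k ^ p) * (\<Prod>s<p. Hmat ?A lam U (?a \<gamma> s) (?b \<gamma> s)) \<partial>M))"
    using ab by (intro Bochner_Integration.integral_sum integrable_mult_right prod_Hmat_integrable) (blast dest: PiE_mem)
  also have "\<dots> = (\<Sum>\<gamma>\<in>?G. of_real (?q \<gamma> / real k ^ p) * moment p (?a \<gamma>) (?b \<gamma>))"
    by (simp only: moment_def integral_mult_right_zero)
  also have "\<dots> = (\<Sum>\<gamma>\<in>?G. of_real (\<Sum>\<sigma>\<in>perms p. \<Sum>\<tau>\<in>perms p. ?c \<sigma> \<tau> * (1 / real k ^ p * (?q \<gamma> * (if ?a \<gamma> \<circ> \<sigma> = ?b \<gamma> then 1 else 0)))))"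
  proof (rule sum.cong[OF refl])
    fix \<gamma> assume g: "\<gamma> \<in> ?G"
    show "of_real (?q \<gamma> / real k ^ p) * moment p (?a \<gamma>) (?b \<gamma>)
      = of_real (\<Sum>\<sigma>\<in>perms p. \<Sum>\<tau>\<in>perms p. ?c \<sigma> \<tau> * (1 / real k ^ p * (?q \<gamma> * (if ?a \<gamma> \<circ> \<sigma> = ?b \<gamma> then 1 else 0))))"
      unfolding moment_eq[OF ab(1)[OF g] ab(2)[OF g]] of_real_mult[symmetric] sum_distrib_left
      by (intro arg_cong[where f = of_real] sum.cong refl) (simp only: divide_inverse mult_ac mult_1_left)
  qed
  also have "\<dots> = of_real (\<Sum>\<sigma>\<in>perms p. \<Sum>\<tau>\<in>perms p. \<Sum>\<gamma>\<in>?G. ?c \<sigma> \<tau> * (1 / real k ^ p * (?q \<gamma> * (if ?a \<gamma> \<circ> \<sigma> = ?b \<gamma> then 1 else 0))))"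
    unfolding of_real_sum[symmetric]
    by (subst sum.swap, rule arg_cong[where f = of_real], rule sum.cong[OF refl], rule sum.swap)
  also have "\<dots> = of_real (\<Sum>\<sigma>\<in>perms p. \<Sum>\<tau>\<in>perms p. ?c \<sigma> \<tau> * Delta n k p \<sigma> ii jj)"
  proof (intro arg_cong[where f = of_real] sum.cong refl)
    fix \<sigma> \<tau> assume "\<sigma> \<in> perms p"
    then have \<sigma>: "\<sigma> permutes {..<p}" by simp
    \<comment> \<open>Both sides of the equation are words, hence agree as soon as they agree below
      p; this is the product of deltas in \<open>delta_perm\<close>.\<close>
    have "(if ?a \<gamma> \<circ> \<sigma> = ?b \<gamma> then 1 else 0) = delta_perm p \<sigma> (\<lambda>s t. unitvec (ii s) t + \<gamma> s t) (\<lambda>s t. unitvec (jj s) t + \<gamma> s t)"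
      if g: "\<gamma> \<in> ?G" for \<gamma>
    proof -
      have "?a \<gamma> \<circ> \<sigma> = ?b \<gamma> \<longleftrightarrow> (\<forall>r<p. (?a \<gamma> \<circ> \<sigma>) r = ?b \<gamma> r)"
      proof
        assume "\<forall>r<p. (?a \<gamma> \<circ> \<sigma>) r = ?b \<gamma> r"
        then show "?a \<gamma> \<circ> \<sigma> = ?b \<gamma>"
          by (intro PiE_ext[OF extensional_comp_perm[OF \<sigma> ab(1)[OF g]] ab(2)[OF g]]) (simp only: lessThan_iff)
      qed (simp only: simp_thms)
      also have "\<dots> \<longleftrightarrow> (\<forall>r<p. raise (ii (\<sigma> r)) (\<gamma> (\<sigma> r)) = raise (jj r) (\<gamma> r))"
        using permutes_bound[OF \<sigma>] by simp
      finally have e: "?a \<gamma> \<circ> \<sigma> = ?b \<gamma> \<longleftrightarrow> \<dots>" .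
      show ?thesis
        unfolding e unfolding delta_perm_def raise_def by (auto intro!: prod.neutral[symmetric])
    qed
    then show "(\<Sum>\<gamma>\<in>?G. ?c \<sigma> \<tau> * (1 / real k ^ p * (?q \<gamma> * (if ?a \<gamma> \<circ> \<sigma> = ?b \<gamma> then 1 else 0)))) = ?c \<sigma> \<tau> * Delta n k p \<sigma> ii jj"
      unfolding Delta_def by (simp only: sum_distrib_left cong: sum.cong)
  qed
  finally show ?thesis unfolding card_mi .
qed

end
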